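(* Let $N=(N_t)_{t\in[0,T]}$ be a Poisson process with intensity $\lambda>0$, let $\tilde N_t=N_t-\lambda t$, and let $D_{\tilde N}$ be the operator--covariant derivative of $\tilde N$. For every $\mathcal{F}_T^N$-measurable $F\in L^2(\Omega)$, $$F=\mathbb{E}[F]+\int_0^T(D_{\tilde N}F)_t\,d\tilde N_t .$$
   Context: $(\Omega,\mathcal{F},P)$ is a complete probability space. $(\mathcal{F}_t^N)_{t\in[0,T]}$ is the natural filtration of $N$, augmented to satisfy the usual conditions; "predictable" refers to this filtration. The energy space is the real Hilbert space $\mathcal{H}_{\tilde N}$ of (equivalence classes of) predictable processes $u=(u_t)_{t\in[0,T]}$ with $\|u\|_{\mathcal{H}_{\tilde N}}^2:=\lambda\,\mathbb{E}\bigl[\int_0^T|u_t|^2\,dt\bigr]<\infty$, with inner product $\langle g,u\rangle_{\mathcal{H}_{\tilde N}}=\lambda\,\mathbb{E}\bigl[\int_0^Tg_tu_t\,dt\bigr]$. The stochastic integral is $\delta_{\tilde N}(u)=\int_0^Tu_t\,d\tilde N_t$, which maps $\mathcal{H}_{\tilde N}$ isometrically into $L^2(\Omega)$. The operator--covariant derivative $D_{\tilde N}\colon L^2(\Omega)\to\mathcal{H}_{\tilde N}$ is the Hilbert space adjoint of $\delta_{\tilde N}$: $D_{\tilde N}F$ is the unique element of $\mathcal{H}_{\tilde N}$ with $\mathbb{E}[F\,\delta_{\tilde N}(u)]=\langle D_{\tilde N}F,u\rangle_{\mathcal{H}_{\tilde N}}$ for all $u\in\mathcal{H}_{\tilde N}$.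 *)

theory Defs
  imports "HOL-Probability.Probability"
begin

text \<open>
  Poisson process of intensity \<open>lam\<close> on \<open>[0,T]\<close>. The values are natural numbers; since almost all
  paths are nondecreasing on \<open>[0,T]\<close>, the truncated difference \<open>N t \<omega> - N s \<omega>\<close> is almost surely
  the true increment. Left limits exist automatically for nondecreasing paths.
\<close>

locale poisson_process = prob_space M for M :: "'a measure" +
  fixes T lam :: real and N :: "real \<Rightarrow> 'a \<Rightarrow> nat"
  assumes horizon: "0 \<le> T"
    and intensity: "0 < lam"
    and random_variable_N: "\<And>t. t \<in> {0..T} \<Longrightarrow> random_variable (count_space UNIV) (N t)"
    and paths: "AE \<omega> in M. N 0 \<omega> = 0 \<and> mono_on {0..T} (\<lambda>t. N t \<omega>) \<and>
                  (\<forall>t\<in>{0..<T}. continuous (at_right t) (\<lambda>s. N s \<omega>))"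
    and indep_increments: "\<And>(n::nat) t. strict_mono_on {..n} t \<Longrightarrow> t ` {..n} \<subseteq> {0..T} \<Longrightarrow>
          indep_vars (\<lambda>_. count_space UNIV) (\<lambda>i \<omega>. N (t (Suc i)) \<omega> - N (t i) \<omega>) {..<n}"
    and increments: "\<And>s t. 0 \<le> s \<Longrightarrow> s < t \<Longrightarrow> t \<le> T \<Longrightarrow>
          distr M (count_space UNIV) (\<lambda>\<omega>. N t \<omega> - N s \<omega>) = measure_pmf (poisson_pmf (lam * (t - s)))"

definition compensated :: "real \<Rightarrow> (real \<Rightarrow> 'a \<Rightarrow> nat) \<Rightarrow> real \<Rightarrow> 'a \<Rightarrow> real" where
  "compensated lam N t \<omega> = real (N t \<omega>) - lam * t"

definition natural_sigma_completed :: "'a measure \<Rightarrow> (real \<Rightarrow> 'a \<Rightarrow> nat) \<Rightarrow> real \<Rightarrow> 'a measure" where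
  "natural_sigma_completed M N t =
     sigma (space M) ((\<Union>r\<in>{0..t}. {N r -` A \<inter> space M | A. True}) \<union> null_sets M)"

text \<open>
  The usual augmentation: intersect the completed \<open>\<sigma>\<close>-algebras over all later times up to the
  horizon. The index \<open>T\<close>, already in \<open>{t<..T}\<close> when \<open>t < T\<close>, is inserted so that at \<open>t = T\<close> one
  gets the completed \<open>\<sigma>\<close>-algebra at \<open>T\<close> itself. Only the sets of this measure are meaningful.
\<close>

definition natural_filtration ::
    "'a measure \<Rightarrow> real \<Rightarrow> (real \<Rightarrow> 'a \<Rightarrow> nat) \<Rightarrow> real \<Rightarrow> 'a measure" where
  "natural_filtration M T N t =
     sigma (space M) (\<Inter>s\<in>insert T {t<..T}. sets (natural_sigma_completed M N s))"

text \<open>\<open>\<F>\<close> denotes a filtration indexed by \<open>[0,T]\<close>.\<close>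

definition predictable_sigma ::
    "'a measure \<Rightarrow> real \<Rightarrow> (real \<Rightarrow> 'a measure) \<Rightarrow> (real \<times> 'a) measure" where
  "predictable_sigma M T \<F> = sigma ({0..T} \<times> space M)
     ({{0} \<times> A | A. A \<in> sets (\<F> 0)} \<union>
      {{s<..t} \<times> A | s t A. 0 \<le> s \<and> s < t \<and> t \<le> T \<and> A \<in> sets (\<F> s)})"

definition energy_sqnorm ::
    "'a measure \<Rightarrow> real \<Rightarrow> real \<Rightarrow> (real \<Rightarrow> 'a \<Rightarrow> real) \<Rightarrow> ennreal" where
  "energy_sqnorm M T lam u =
     ennreal lam * (\<integral>\<^sup>+\<omega>. (\<integral>\<^sup>+t\<in>{0..T}. ennreal (\<bar>u t \<omega>\<bar>\<^sup>2) \<partial>lborel) \<partial>M)"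

definition energy_inner ::
    "'a measure \<Rightarrow> real \<Rightarrow> real \<Rightarrow> (real \<Rightarrow> 'a \<Rightarrow> real) \<Rightarrow> (real \<Rightarrow> 'a \<Rightarrow> real) \<Rightarrow> real" where
  "energy_inner M T lam g u =
     lam * (\<integral>\<omega>. (LINT t:{0..T}|lborel. g t \<omega> * u t \<omega>) \<partial>M)"

text \<open>
  Elements of the energy space and of \<open>L\<^sup>2\<close> are represented by functions rather than by their
  equivalence classes; values of a process outside \<open>[0,T] \<times> \<Omega>\<close> play no role.
\<close>

definition energy_space ::
    "'a measure \<Rightarrow> real \<Rightarrow> (real \<Rightarrow> 'a measure) \<Rightarrow> real \<Rightarrow> (real \<Rightarrow> 'a \<Rightarrow> real) set" where
  "energy_space M T \<F> lam =
     {u. (\<lambda>(t, \<omega>). u t \<omega>) \<in> borel_measurable (predictable_sigma M T \<F>) \<and>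
         energy_sqnorm M T lam u < \<infinity>}"

definition L2_space :: "'a measure \<Rightarrow> ('a \<Rightarrow> real) set" where
  "L2_space M = {X \<in> borel_measurable M. integrable M (\<lambda>\<omega>. (X \<omega>)\<^sup>2)}"

text \<open>
  The stochastic integral is the isometric \<open>L\<^sup>2\<close> extension of the elementary integral of bounded
  step processes \<open>\<Sum>i<n. \<xi> i * indicator {\<tau> i<..\<tau> (Suc i)}\<close> with \<open>\<xi> i\<close> measurable at time \<open>\<tau> i\<close>.
  A summand supported on \<open>{0} \<times> \<Omega>\<close> is omitted: it is zero in the energy space.
\<close>

definition predictable_step ::
    "'a measure \<Rightarrow> real \<Rightarrow> (real \<Rightarrow> 'a measure) \<Rightarrow> nat \<Rightarrow> (nat \<Rightarrow> real) \<Rightarrow> (nat \<Rightarrow> 'a \<Rightarrow> real) \<Rightarrow> bool"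
where
  "predictable_step M T \<F> n \<tau> \<xi> \<longleftrightarrow>
     mono_on {..n} \<tau> \<and> \<tau> ` {..n} \<subseteq> {0..T} \<and>
     (\<forall>i<n. \<xi> i \<in> borel_measurable (\<F> (\<tau> i)) \<and> (\<exists>B. \<forall>\<omega>\<in>space M. \<bar>\<xi> i \<omega>\<bar> \<le> B))"

definition step_process ::
    "nat \<Rightarrow> (nat \<Rightarrow> real) \<Rightarrow> (nat \<Rightarrow> 'a \<Rightarrow> real) \<Rightarrow> real \<Rightarrow> 'a \<Rightarrow> real" where
  "step_process n \<tau> \<xi> s \<omega> = (\<Sum>i<n. \<xi> i \<omega> * indicator {\<tau> i<..\<tau> (Suc i)} s)"

definition step_integral ::
    "(real \<Rightarrow> 'a \<Rightarrow> real) \<Rightarrow> nat \<Rightarrow> (nat \<Rightarrow> real) \<Rightarrow> (nat \<Rightarrow> 'a \<Rightarrow> real) \<Rightarrow> 'a \<Rightarrow> real" where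
  "step_integral Z n \<tau> \<xi> \<omega> = (\<Sum>i<n. \<xi> i \<omega> * (Z (\<tau> (Suc i)) \<omega> - Z (\<tau> i) \<omega>))"

definition has_stochastic_integral ::
    "'a measure \<Rightarrow> real \<Rightarrow> real \<Rightarrow> (real \<Rightarrow> 'a \<Rightarrow> nat) \<Rightarrow> (real \<Rightarrow> 'a \<Rightarrow> real) \<Rightarrow> ('a \<Rightarrow> real) \<Rightarrow> bool"
where
  "has_stochastic_integral M T lam N u X \<longleftrightarrow>
     u \<in> energy_space M T (natural_filtration M T N) lam \<and> X \<in> L2_space M \<and>
     (\<exists>(n :: nat \<Rightarrow> nat) \<tau> \<xi>.
        (\<forall>k. predictable_step M T (natural_filtration M T N) (n k) (\<tau> k) (\<xi> k)) \<and>
        (\<lambda>k. energy_sqnorm M T lam (\<lambda>t \<omega>. step_process (n k) (\<tau> k) (\<xi> k) t \<omega> - u t \<omega>))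
          \<longlonglongrightarrow> 0 \<and>
        (\<lambda>k. \<integral>\<^sup>+\<omega>. ennreal ((step_integral (compensated lam N) (n k) (\<tau> k) (\<xi> k) \<omega> - X \<omega>)\<^sup>2) \<partial>M)
          \<longlonglongrightarrow> 0)"

text \<open>\<open>\<integral>\<^sub>0\<^sup>T u\<^sub>t dZ\<^sub>t\<close> for the compensated process \<open>Z = compensated lam N\<close>, determined up to null sets.\<close>

definition stochastic_integral ::
    "'a measure \<Rightarrow> real \<Rightarrow> real \<Rightarrow> (real \<Rightarrow> 'a \<Rightarrow> nat) \<Rightarrow> (real \<Rightarrow> 'a \<Rightarrow> real) \<Rightarrow> 'a \<Rightarrow> real" where
  "stochastic_integral M T lam N u = (SOME X. has_stochastic_integral M T lam N u X)"

definition has_covariant_derivative ::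
    "'a measure \<Rightarrow> real \<Rightarrow> real \<Rightarrow> (real \<Rightarrow> 'a \<Rightarrow> nat) \<Rightarrow> ('a \<Rightarrow> real) \<Rightarrow> (real \<Rightarrow> 'a \<Rightarrow> real) \<Rightarrow> bool"
where
  "has_covariant_derivative M T lam N F g \<longleftrightarrow>
     g \<in> energy_space M T (natural_filtration M T N) lam \<and>
     (\<forall>u \<in> energy_space M T (natural_filtration M T N) lam.
        (\<integral>\<omega>. F \<omega> * stochastic_integral M T lam N u \<omega> \<partial>M) = energy_inner M T lam g u)"

text \<open>
  The adjoint of the stochastic integral, applied to \<open>F\<close>: a representative of the element of the
  energy space that is unique up to \<open>dt \<otimes> P\<close>-null sets.
\<close>

definition covariant_derivative ::
    "'a measure \<Rightarrow> real \<Rightarrow> real \<Rightarrow> (real \<Rightarrow> 'a \<Rightarrow> nat) \<Rightarrow> ('a \<Rightarrow> real) \<Rightarrow> real \<Rightarrow> 'a \<Rightarrow> real" where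
  "covariant_derivative M T lam N F = (SOME g. has_covariant_derivative M T lam N F g)"

end

theory Submission
  imports Defs
begin

text \<open>
  The formula follows from the martingale representation theorem: a square integrable
  \<open>F\<close> that is measurable at time \<open>T\<close> has the form \<open>F = c +
  \<delta>(u)\<close> with \<open>u\<close> in the energy space
  (\<open>martingale_representation\<close>). Since integrals are centred, \<open>c = E F\<close>,
  and the isometry gives \<open>E (F \<delta>(v)) = \<langle>u, v\<rangle>\<close> for all
  \<open>v\<close>, so that \<open>u\<close> represents the adjoint at \<open>F\<close>. The
  derivative is a chosen representative; two representatives have the same integral almost surely
  (\<open>clark_formula\<close>).

  The representation is a density argument. The variables \<open>c + \<delta>(u)\<close> form a
  linear space, closed in \<open>L\<^sup>2\<close> because the energy space is complete and
  \<open>\<delta>\<close> is an isometry up to the factor \<open>\<lambda>\<close>. It contains the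
  products \<open>\<Prod> a\<^sub>i ^ (N(t\<^bsub>i+1\<^esub>) - N(t\<^sub>i))\<close> with \<open>0
  < a\<^sub>i \<le> 1\<close>. Normalised to mean one, such a product is the final value of a
  discrete martingale \<open>Z\<close>; on a grid of mesh \<open>h\<close> its steps differ from the
  integral steps \<open>(a\<^sub>i - 1) Z\<^sub>i (N(t\<^bsub>i+1\<^esub>) - N(t\<^sub>i) -
  \<lambda> h)\<close> by orthogonal errors of mean square \<open>O(h\<^sup>2)\<close>, so the total
  mean square error is \<open>O(h)\<close> and vanishes under refinement
  (\<open>exp_martingale_step_error\<close>). Finally, the closure of these products under linear
  combinations and bounded limits is an algebra and contains the indicators of all events at time
  \<open>T\<close> (\<open>indicator_in_closure\<close>).

  The same closure argument on \<open>[0,s]\<close> proves that increments after \<open>s\<close>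
  are independent of the completed past; right continuity of the paths extends this to the augmented
  past (\<open>augmented_increment_independent\<close>). Independence gives the isometry for step
  processes (\<open>simple_isometry\<close>). To extend \<open>\<delta>\<close> linearly, each
  predictable integrand is approximated on the regular grids of \<open>[0,T]\<close> for all grid
  sizes at once, so that two approximations can be added without merging partitions
  (\<open>energy_space_approximable\<close>).
\<close>

section \<open>Mean square convergence\<close>

text \<open>
  Mean squares take values in \<open>[0,\<infinity>]\<close>, so that the triangle inequality and
  limits need no integrability side conditions; real integrals appear only where products are
  integrated.
\<close>

definition msq :: "'b measure \<Rightarrow> ('b \<Rightarrow> real) \<Rightarrow> ennreal" where
  "msq M f = (\<integral>\<^sup>+x. ennreal ((f x)^2) \<partial>M)"

abbreviation L2_lim :: "'b measure \<Rightarrow> (nat \<Rightarrow> 'b \<Rightarrow> real) \<Rightarrow> ('b \<Rightarrow> real) \<Rightarrow> bool" where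
  "L2_lim M f g \<equiv> (\<lambda>k. msq M (\<lambda>x. f k x - g x)) \<longlonglongrightarrow> 0"

lemma msq_cong_AE:
  assumes "AE x in M. f x = g x"
  shows "msq M f = msq M g"
  unfolding msq_def by (rule nn_integral_cong_AE) (use assms in auto)

lemma msq_mono: "(AE x in M. \<bar>f x\<bar> \<le> \<bar>g x\<bar>) \<Longrightarrow> msq M f \<le> msq M g"
  unfolding msq_def by (rule nn_integral_mono_AE) (auto simp: abs_le_square_iff intro!: ennreal_leI)

lemma msq_add_le:
  assumes [measurable]: "f \<in> borel_measurable M" "g \<in> borel_measurable M"
  shows "msq M (\<lambda>x. f x + g x) \<le> 2 * msq M f + 2 * msq M g"
proof -
  have "(a + b)^2 \<le> 2 * a^2 + 2 * b^2" for a b :: real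
    using sum_squares_bound[of a b] by (simp add: power2_sum)
  then have "msq M (\<lambda>x. f x + g x) \<le> (\<integral>\<^sup>+x. 2 * ennreal ((f x)^2) + 2 * ennreal ((g x)^2) \<partial>M)"
    unfolding msq_def
    by (intro nn_integral_mono) (simp add: ennreal_mult'[symmetric] flip: ennreal_numeral ennreal_plus)
  also have "\<dots> = 2 * msq M f + 2 * msq M g"
    unfolding msq_def by (simp add: nn_integral_add nn_integral_cmult)
  finally show ?thesis .
qed

lemma msq_cmult:
  assumes [measurable]: "f \<in> borel_measurable M"
  shows "msq M (\<lambda>x. c * f x) = ennreal (c^2) * msq M f"
  unfolding msq_def by (simp add: power_mult_distrib ennreal_mult nn_integral_cmult)

lemma msq_minus_commute: "msq M (\<lambda>x. f x - g x) = msq M (\<lambda>x. g x - f x)"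
  unfolding msq_def by (simp add: power2_commute)

lemma msq_triangle:
  assumes [measurable]: "f \<in> borel_measurable M" "g \<in> borel_measurable M" "h \<in> borel_measurable M"
  shows "msq M (\<lambda>x. f x - h x) \<le> 2 * msq M (\<lambda>x. f x - g x) + 2 * msq M (\<lambda>x. g x - h x)"
  using msq_add_le[of "\<lambda>x. f x - g x" M "\<lambda>x. g x - h x"] by simp

lemma msq_diff_finite:
  assumes [measurable]: "f \<in> borel_measurable M" "g \<in> borel_measurable M"
    and "msq M f < top" "msq M g < top"
  shows "msq M (\<lambda>x. f x - g x) < top"
proof -
  have "msq M (\<lambda>x. f x - g x) \<le> 2 * msq M f + 2 * msq M g"
    using msq_triangle[of f M "\<lambda>_. 0" g] by (simp add: msq_def)
  also have "\<dots> < top" using assms by (simp add: ennreal_mult_less_top)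
  finally show ?thesis .
qed

lemma msq_add_finite:
  assumes [measurable]: "f \<in> borel_measurable M" "g \<in> borel_measurable M"
    and "msq M f < top" "msq M g < top"
  shows "msq M (\<lambda>x. f x + g x) < top"
proof -
  have "2 * msq M f + 2 * msq M g < top" using assms by (simp add: ennreal_mult_less_top)
  then show ?thesis using msq_add_le[OF assms(1,2)] by (auto intro: le_less_trans)
qed

lemma msq_cmult_finite:
  assumes [measurable]: "f \<in> borel_measurable M" and "msq M f < top"
  shows "msq M (\<lambda>x. c * f x) < top"
  using assms by (simp add: msq_cmult ennreal_mult_less_top)

lemma msq_finite_iff:
  assumes [measurable]: "f \<in> borel_measurable M"
  shows "msq M f < top \<longleftrightarrow> integrable M (\<lambda>x. (f x)^2)"
  unfolding integrable_iff_bounded msq_def by simp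

lemma msq_eq_integral:
  assumes "integrable M (\<lambda>x. (f x)^2)"
  shows "msq M f = ennreal (\<integral>x. (f x)^2 \<partial>M)"
  unfolding msq_def by (rule nn_integral_eq_integral[OF assms]) simp

lemma L2_space_iff: "X \<in> L2_space M \<longleftrightarrow> X \<in> borel_measurable M \<and> msq M X < top"
  unfolding L2_space_def using msq_finite_iff by auto

lemma integrable_mult_square:
  assumes [measurable]: "f \<in> borel_measurable M" "g \<in> borel_measurable M"
    and "integrable M (\<lambda>x. (f x)^2)" "integrable M (\<lambda>x. (g x)^2 :: real)"
  shows "integrable M (\<lambda>x. f x * g x)"
proof (rule Bochner_Integration.integrable_bound[OF Bochner_Integration.integrable_add[OF assms(3,4)]])
  have "\<bar>a * b\<bar> \<le> a^2 + b^2" for a b :: real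
  proof -
    have "2 * (\<bar>a\<bar> * \<bar>b\<bar>) \<le> a^2 + b^2" using sum_squares_bound[of "\<bar>a\<bar>" "\<bar>b\<bar>"] by simp
    moreover have "0 \<le> \<bar>a\<bar> * \<bar>b\<bar>" by simp
    ultimately show ?thesis unfolding abs_mult by linarith
  qed
  then show "AE x in M. norm (f x * g x) \<le> norm ((f x)^2 + (g x)^2)" by auto
qed simp

lemma msq_eq_0:
  assumes [measurable]: "f \<in> borel_measurable M" and "msq M f = 0"
  shows "AE x in M. f x = 0"
  using assms unfolding msq_def by (simp add: nn_integral_0_iff_AE)

lemma abs_lincomb_le:
  fixes a b x y :: real
  assumes "\<bar>x\<bar> \<le> B" "\<bar>y\<bar> \<le> B'"
  shows "\<bar>a * x + b * y\<bar> \<le> \<bar>a\<bar> * B + \<bar>b\<bar> * B'"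
proof -
  have "\<bar>a * x + b * y\<bar> \<le> \<bar>a\<bar> * \<bar>x\<bar> + \<bar>b\<bar> * \<bar>y\<bar>"
    using abs_triangle_ineq[of "a * x" "b * y"] by (simp add: abs_mult)
  also have "\<dots> \<le> \<bar>a\<bar> * B + \<bar>b\<bar> * B'" using assms by (intro add_mono mult_left_mono) auto
  finally show ?thesis .
qed

lemma ennreal_tendsto_0_le:
  fixes f g :: "nat \<Rightarrow> ennreal"
  assumes "g \<longlonglongrightarrow> 0" "eventually (\<lambda>k. f k \<le> g k) sequentially"
  shows "f \<longlonglongrightarrow> 0"
  by (rule tendsto_sandwich[OF _ assms(2) tendsto_const assms(1)]) simp

lemma ennreal_tendsto_0_lincomb:
  fixes f g :: "nat \<Rightarrow> ennreal"
  assumes "f \<longlonglongrightarrow> 0" "g \<longlonglongrightarrow> 0" "a < top" "b < top"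
  shows "(\<lambda>k. a * f k + b * g k) \<longlonglongrightarrow> 0"
proof -
  have "(\<lambda>k. a * f k + b * g k) \<longlonglongrightarrow> a * 0 + b * 0"
    by (intro tendsto_add ennreal_tendsto_cmult) (use assms in auto)
  then show ?thesis by simp
qed

lemma msq_lim_triangle:
  assumes "\<And>k. f k \<in> borel_measurable M" "\<And>k. g k \<in> borel_measurable M" "h \<in> borel_measurable M"
    and "(\<lambda>k. msq M (\<lambda>x. f k x - g k x)) \<longlonglongrightarrow> 0" "L2_lim M g h"
  shows "L2_lim M f h"
  by (rule ennreal_tendsto_0_le[OF ennreal_tendsto_0_lincomb[OF assms(4,5), of 2 2]])
    (auto intro!: always_eventually msq_triangle assms)

lemma msq_lim_lincomb:
  assumes [measurable]: "\<And>k. f k \<in> borel_measurable M" "\<And>k. g k \<in> borel_measurable M"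
    "f' \<in> borel_measurable M" "g' \<in> borel_measurable M"
    and "L2_lim M f f'" "L2_lim M g g'"
  shows "L2_lim M (\<lambda>k x. a * f k x + b * g k x) (\<lambda>x. a * f' x + b * g' x)"
proof (rule ennreal_tendsto_0_le[OF ennreal_tendsto_0_lincomb[OF assms(5,6), of "2 * ennreal (a^2)" "2 * ennreal (b^2)"]])
  show "\<forall>\<^sub>F k in sequentially. msq M (\<lambda>x. a * f k x + b * g k x - (a * f' x + b * g' x))
        \<le> 2 * ennreal (a^2) * msq M (\<lambda>x. f k x - f' x) + 2 * ennreal (b^2) * msq M (\<lambda>x. g k x - g' x)"
  proof (intro always_eventually allI)
    fix k
    have "msq M (\<lambda>x. a * f k x + b * g k x - (a * f' x + b * g' x)) =
        msq M (\<lambda>x. a * (f k x - f' x) + b * (g k x - g' x))"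
      by (simp add: algebra_simps)
    also have "\<dots> \<le> 2 * msq M (\<lambda>x. a * (f k x - f' x)) + 2 * msq M (\<lambda>x. b * (g k x - g' x))"
      by (intro msq_add_le) auto
    finally show "msq M (\<lambda>x. a * f k x + b * g k x - (a * f' x + b * g' x))
        \<le> 2 * ennreal (a^2) * msq M (\<lambda>x. f k x - f' x) + 2 * ennreal (b^2) * msq M (\<lambda>x. g k x - g' x)"
      by (simp add: msq_cmult mult.assoc)
  qed
qed (auto simp: ennreal_mult_less_top)

text \<open>
  Pointwise \<open>\<bar>f\<^sup>2 - g\<^sup>2\<bar> \<le> (1 + 1/e) (f - g)\<^sup>2 + e
  g\<^sup>2\<close>. The second term has integral below \<open>r / 2\<close> for a small fixed
  \<open>e\<close>, and then the first one tends to zero.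
\<close>

lemma msq_tendsto:
  assumes [measurable]: "\<And>k. f k \<in> borel_measurable M" "g \<in> borel_measurable M"
    and fin: "msq M g < top" and lim: "L2_lim M f g"
  shows "(\<lambda>k. msq M (f k)) \<longlonglongrightarrow> msq M g"
proof -
  have g: "integrable M (\<lambda>x. (g x)^2)" using fin by (simp add: msq_finite_iff)
  define p where "p = (\<integral>x. (g x)^2 \<partial>M)"
  have p0: "0 \<le> p" unfolding p_def by simp
  have "eventually (\<lambda>k. msq M (\<lambda>x. f k x - g x) < 1) sequentially"
    using order_tendstoD(2)[OF lim, of 1] by simp
  then have dint: "eventually (\<lambda>k. integrable M (\<lambda>x. (f k x - g x)^2)) sequentially"
    by (rule eventually_mono) (subst msq_finite_iff[symmetric], auto intro: less_trans)
  have fint: "eventually (\<lambda>k. integrable M (\<lambda>x. (f k x)^2)) sequentially"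
    using dint
  proof (rule eventually_mono)
    fix k assume "integrable M (\<lambda>x. (f k x - g x)^2)"
    then have "msq M (\<lambda>x. (f k x - g x) + g x) < top" using fin
      by (intro msq_add_finite) (auto simp: msq_finite_iff)
    then show "integrable M (\<lambda>x. (f k x)^2)" by (simp add: msq_finite_iff)
  qed
  have dlim: "(\<lambda>k. \<integral>x. (f k x - g x)^2 \<partial>M) \<longlonglongrightarrow> 0"
  proof -
    have "(\<lambda>k. ennreal (\<integral>x. (f k x - g x)^2 \<partial>M)) \<longlonglongrightarrow> ennreal 0"
      unfolding ennreal_0 by (rule Lim_transform_eventually[OF lim], rule eventually_mono[OF dint], rule msq_eq_integral)
    then show ?thesis by (subst (asm) tendsto_ennreal_iff) auto
  qed
  have "(\<lambda>k. \<integral>x. (f k x)^2 \<partial>M) \<longlonglongrightarrow> p"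
  proof (rule LIMSEQ_I, goal_cases)
    case (1 r)
    define e where "e = r / (2 * (p + 1))"
    have e: "0 < e" "e * p < r / 2" using 1 p0 by (auto simp: e_def field_simps)
    have "eventually (\<lambda>k. (\<integral>x. (f k x - g x)^2 \<partial>M) < r / 2 / (1 + 1 / e)) sequentially"
      using order_tendstoD(2)[OF dlim, of "r / 2 / (1 + 1 / e)"] 1 e by (simp add: add_pos_pos)
    with dint fint have "eventually (\<lambda>k. norm ((\<integral>x. (f k x)^2 \<partial>M) - p) < r) sequentially"
    proof eventually_elim
      case (elim k)
      have "\<bar>a^2 - b^2\<bar> \<le> (1 + 1 / e) * (a - b)^2 + e * b^2" for a b :: real
      proof -
        have "(\<bar>a - b\<bar> - e * \<bar>b\<bar>)^2 / e \<ge> 0" using e by simp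
        then have "2 * (\<bar>a - b\<bar> * \<bar>b\<bar>) \<le> (a - b)^2 / e + e * b^2"
          using e by (simp add: power2_diff field_simps power2_eq_square)
        moreover have "a^2 - b^2 = (a - b)^2 + 2 * ((a - b) * b)"
          by (simp add: power2_eq_square algebra_simps)
        then have "\<bar>a^2 - b^2\<bar> \<le> (a - b)^2 + 2 * (\<bar>a - b\<bar> * \<bar>b\<bar>)"
          using abs_triangle_ineq[of "(a - b)^2" "2 * ((a - b) * b)"] by (simp add: abs_mult)
        ultimately show ?thesis by (simp add: field_simps)
      qed
      note bd = this
      have "norm ((\<integral>x. (f k x)^2 \<partial>M) - p) = norm (\<integral>x. (f k x)^2 - (g x)^2 \<partial>M)"
        unfolding p_def using elim g by simp
      also have "\<dots> \<le> (\<integral>x. \<bar>(f k x)^2 - (g x)^2\<bar> \<partial>M)"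
        using integral_norm_bound by (metis (no_types, lifting) Bochner_Integration.integral_cong real_norm_def)
      also have "\<dots> \<le> (\<integral>x. (1 + 1 / e) * (f k x - g x)^2 + e * (g x)^2 \<partial>M)"
        using elim g bd by (intro integral_mono) auto
      also have "\<dots> = (1 + 1 / e) * (\<integral>x. (f k x - g x)^2 \<partial>M) + e * p"
        unfolding p_def using elim g by simp
      also have "\<dots> < r"
      proof -
        have "(1 + 1 / e) * (\<integral>x. (f k x - g x)^2 \<partial>M) < r / 2"
          using elim(3) e by (subst (asm) pos_less_divide_eq) (auto simp: add_pos_pos mult.commute)
        then show ?thesis using e(2) by linarith
      qed
      finally show ?case .
    qed
    then show ?case by (auto simp: eventually_sequentially)
  qed
  then have "(\<lambda>k. ennreal (\<integral>x. (f k x)^2 \<partial>M)) \<longlonglongrightarrow> msq M g"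
    unfolding msq_eq_integral[OF g] p_def by (rule tendsto_ennrealI)
  then show ?thesis
    by (rule Lim_transform_eventually, intro eventually_mono[OF fint]) (simp add: msq_eq_integral)
qed

lemma msq_dominated:
  assumes [measurable]: "\<And>k. f k \<in> borel_measurable M" "g \<in> borel_measurable M" "w \<in> borel_measurable M"
    and fin: "msq M w < top" and bd: "\<And>k. AE x in M. \<bar>f k x\<bar> \<le> w x"
    and lim: "AE x in M. (\<lambda>k. f k x) \<longlonglongrightarrow> g x"
  shows "L2_lim M f g"
proof -
  have bd': "AE x in M. \<forall>k. \<bar>f k x\<bar> \<le> w x" using bd by (simp add: AE_all_countable)
  have "(\<lambda>k. \<integral>\<^sup>+x. ennreal ((f k x - g x)^2) \<partial>M) \<longlonglongrightarrow> (\<integral>\<^sup>+x. ennreal 0 \<partial>M)"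
  proof (rule nn_integral_dominated_convergence[where w="\<lambda>x. ennreal ((2 * w x)^2)"])
    show "AE x in M. ennreal ((f k x - g x)^2) \<le> ennreal ((2 * w x)^2)" for k
      using bd' lim
    proof eventually_elim
      case (elim x)
      have "(\<lambda>k. \<bar>f k x\<bar>) \<longlonglongrightarrow> \<bar>g x\<bar>" using elim by (intro tendsto_rabs) auto
      then have "\<bar>g x\<bar> \<le> w x" by (rule LIMSEQ_le_const2) (use elim in auto)
      moreover have "\<bar>f k x\<bar> \<le> w x" using elim by auto
      ultimately have "\<bar>f k x - g x\<bar> \<le> \<bar>2 * w x\<bar>" by linarith
      then show ?case by (intro ennreal_leI) (simp add: abs_le_square_iff)
    qed
    show "(\<integral>\<^sup>+x. ennreal ((2 * w x)^2) \<partial>M) < \<infinity>"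
      using msq_cmult_finite[OF _ fin, of 2] by (simp add: msq_def)
    show "AE x in M. (\<lambda>k. ennreal ((f k x - g x)^2)) \<longlonglongrightarrow> ennreal 0"
      using lim
    proof eventually_elim
      case (elim x)
      have "(\<lambda>k. (f k x - g x)^2) \<longlonglongrightarrow> (g x - g x)^2" using elim by (intro tendsto_intros)
      then show ?case by (intro tendsto_ennrealI) simp
    qed
  qed auto
  then show ?thesis by (simp add: msq_def)
qed

definition L2_Cauchy :: "'b measure \<Rightarrow> (nat \<Rightarrow> 'b \<Rightarrow> real) \<Rightarrow> bool" where
  "L2_Cauchy M f \<longleftrightarrow> (\<forall>e>0. \<exists>n0. \<forall>m\<ge>n0. \<forall>n\<ge>n0. msq M (\<lambda>x. f m x - f n x) < ennreal e)"

text \<open>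
  Completeness is used in both directions: a convergent sequence of integrands yields a stochastic
  integral, and a convergent sequence of integrals yields an integrand.
\<close>

lemma L2_Cauchy_isometry:
  assumes c: "0 < c" and iso: "\<And>m n. msq M (\<lambda>x. f m x - f n x) = ennreal c * msq Q (\<lambda>x. g m x - g n x)"
  shows "L2_Cauchy M f \<longleftrightarrow> L2_Cauchy Q g"
proof -
  have less: "ennreal c * a < ennreal (c * e) \<longleftrightarrow> a < ennreal e" for a e
  proof -
    have "ennreal (c * e) = ennreal c * ennreal e" using c by (simp add: ennreal_mult')
    moreover have "a < ennreal e" if "ennreal c * a < ennreal c * ennreal e"
      using that mult_left_mono[of "ennreal e" a "ennreal c"] by (meson not_le zero_le)
    moreover have "ennreal c * a < ennreal c * ennreal e" if "a < ennreal e"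
      using that c by (intro ennreal_mult_strict_left_mono) auto
    ultimately show ?thesis by metis
  qed
  have "L2_Cauchy M f \<longleftrightarrow> (\<forall>e>0. \<exists>n0. \<forall>m\<ge>n0. \<forall>n\<ge>n0. msq M (\<lambda>x. f m x - f n x) < ennreal (c * e))"
    unfolding L2_Cauchy_def
  proof (intro iffI allI impI)
    fix e :: real assume *: "\<forall>e>0. \<exists>n0. \<forall>m\<ge>n0. \<forall>n\<ge>n0. msq M (\<lambda>x. f m x - f n x) < ennreal (c * e)" and "0 < e"
    then show "\<exists>n0. \<forall>m\<ge>n0. \<forall>n\<ge>n0. msq M (\<lambda>x. f m x - f n x) < ennreal e"
      using *[rule_format, of "e / c"] c by simp
  qed (use c in simp)
  then show ?thesis unfolding iso less L2_Cauchy_def .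
qed

text \<open>
  The Riesz--Fischer argument. A fast subsequence converges almost everywhere, because its
  differences are dominated by a geometric series; Fatou's lemma turns this into convergence in mean
  square of the whole sequence.
\<close>

lemma msq_complete:
  assumes [measurable]: "\<And>k. f k \<in> borel_measurable M" and cau: "L2_Cauchy M f"
  obtains g where "g \<in> borel_measurable M" "L2_lim M f g"
proof -
  have "\<exists>n0. \<forall>m\<ge>n0. \<forall>n\<ge>n0. msq M (\<lambda>x. f m x - f n x) < ennreal ((1/8)^k)" for k :: nat
    using cau unfolding L2_Cauchy_def by simp
  then obtain r0 where r0: "\<And>k m n. m \<ge> r0 k \<Longrightarrow> n \<ge> r0 k \<Longrightarrow> msq M (\<lambda>x. f m x - f n x) < ennreal ((1/8)^k)"
    by metis
  define r where "r k = (\<Sum>i\<le>k. r0 i)" for k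
  have r: "r0 k \<le> r k" "r k \<le> r (Suc k)" for k
    unfolding r_def by (auto simp: lessThan_Suc_atMost[symmetric])
  define d where "d k x = f (r (Suc k)) x - f (r k) x" for k x
  have [measurable]: "d k \<in> borel_measurable M" for k unfolding d_def by measurable
  have dk: "msq M (d k) \<le> ennreal ((1/8)^k)" for k
    unfolding d_def using r0[of k "r (Suc k)" "r k"] r[of k] by (simp add: less_imp_le)
  \<comment> \<open>The weight \<open>4 ^ k\<close> leaves \<open>4 ^ k * (1/8) ^ k = (1/2) ^ k\<close>, which is
    summable; and a bounded \<open>4 ^ k * (d k)\<^sup>2\<close> means \<open>\<bar>d k\<bar>
    \<le> c / 2 ^ k\<close>.\<close>
  have "(\<integral>\<^sup>+x. (\<Sum>k. ennreal (4 ^ k * (d k x)^2)) \<partial>M) = (\<Sum>k. \<integral>\<^sup>+x. ennreal (4 ^ k * (d k x)^2) \<partial>M)"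
    by (intro nn_integral_suminf) auto
  also have "\<dots> = (\<Sum>k. ennreal (4 ^ k) * msq M (d k))"
    unfolding msq_def by (simp add: ennreal_mult nn_integral_cmult)
  also have "\<dots> \<le> (\<Sum>k. ennreal ((1/2) ^ k))"
  proof (intro suminf_le)
    fix k
    have "ennreal (4 ^ k) * msq M (d k) \<le> ennreal (4 ^ k) * ennreal ((1/8)^k)"
      by (intro mult_left_mono dk) auto
    also have "\<dots> = ennreal ((1/2) ^ k)"
      by (subst ennreal_mult'[symmetric]) (auto simp: power_mult_distrib[symmetric])
    finally show "ennreal (4 ^ k) * msq M (d k) \<le> ennreal ((1/2) ^ k)" .
  qed auto
  also have "\<dots> < top"
    by (subst suminf_ennreal_eq[of _ 2]) (use geometric_sums[of "1/2::real"] in auto)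
  finally have "AE x in M. (\<Sum>k. ennreal (4 ^ k * (d k x)^2)) \<noteq> \<infinity>"
    by (intro nn_integral_PInf_AE) auto
  then have conv: "AE x in M. convergent (\<lambda>k. f (r k) x)"
  proof eventually_elim
    case (elim x)
    then have "summable (\<lambda>k. 4 ^ k * (d k x)^2)"
      by (intro summable_suminf_not_top) auto
    then have "(\<lambda>k. 4 ^ k * (d k x)^2) \<longlonglongrightarrow> 0" by (rule summable_LIMSEQ_zero)
    then have "eventually (\<lambda>k. 4 ^ k * (d k x)^2 < 1) sequentially"
      by (rule order_tendstoD) simp
    then have "eventually (\<lambda>k. norm (d k x) \<le> (1/2) ^ k) sequentially"
    proof eventually_elim
      case (elim k)
      then have "(2 ^ k * d k x)^2 \<le> 1^2"
        by (simp add: power_mult_distrib power_mult[symmetric] mult.commute[of _ 2] power_mult)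
      then have "\<bar>2 ^ k * d k x\<bar> \<le> 1" by (metis abs_le_square_iff abs_one)
      then show ?case by (simp add: abs_mult field_simps)
    qed
    then have "summable (\<lambda>k. d k x)"
      by (rule summable_comparison_test_ev) (simp add: summable_geometric)
    then have "convergent (\<lambda>n. \<Sum>k<n. d k x)" by (simp add: summable_iff_convergent)
    moreover have "(\<Sum>k<n. d k x) = f (r n) x - f (r 0) x" for n
      unfolding d_def by (rule sum_lessThan_telescope)
    ultimately have "convergent (\<lambda>n. f (r n) x - f (r 0) x)" by simp
    then have "convergent (\<lambda>n. (f (r n) x - f (r 0) x) + f (r 0) x)"
      by (intro convergent_add convergent_const)
    then show ?case by simp
  qed
  define g where "g x = lim (\<lambda>k. f (r k) x)" for x
  have [measurable]: "g \<in> borel_measurable M" unfolding g_def by measurable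
  have glim: "AE x in M. (\<lambda>k. f (r k) x) \<longlonglongrightarrow> g x"
    using conv by eventually_elim (simp add: g_def convergent_LIMSEQ_iff)
  have bound: "msq M (\<lambda>x. f n x - g x) \<le> ennreal ((1/8)^k)" if n: "n \<ge> r0 k" for n k
  proof -
    have "msq M (\<lambda>x. f n x - g x) = (\<integral>\<^sup>+x. liminf (\<lambda>j. ennreal ((f n x - f (r j) x)^2)) \<partial>M)"
      unfolding msq_def
    proof (rule nn_integral_cong_AE, use glim in eventually_elim)
      case (elim x)
      have "(\<lambda>j. ennreal ((f n x - f (r j) x)^2)) \<longlonglongrightarrow> ennreal ((f n x - g x)^2)"
        by (intro tendsto_ennrealI tendsto_intros elim)
      then show ?case by (rule lim_imp_Liminf[OF sequentially_bot, symmetric])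
    qed
    also have "\<dots> \<le> liminf (\<lambda>j. msq M (\<lambda>x. f n x - f (r j) x))"
      unfolding msq_def by (rule nn_integral_liminf) auto
    also have "\<dots> \<le> limsup (\<lambda>j. msq M (\<lambda>x. f n x - f (r j) x))"
      by (rule Liminf_le_Limsup) simp
    also have "\<dots> \<le> ennreal ((1/8)^k)"
    proof (rule Limsup_bounded, rule eventually_sequentiallyI)
      fix j assume "k \<le> j"
      then have "r k \<le> r j" by (rule lift_Suc_mono_le[of r, OF r(2)])
      then have "r0 k \<le> r j" using r(1)[of k] by simp
      then show "msq M (\<lambda>x. f n x - f (r j) x) \<le> ennreal ((1/8)^k)"
        using r0[OF n] by (simp add: less_imp_le)
    qed
    finally show ?thesis .
  qed
  have "L2_lim M f g"
  proof (rule order_tendstoI)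
    fix a :: ennreal assume a: "0 < a"
    have "(\<lambda>k. ennreal ((1/8)^k)) \<longlonglongrightarrow> ennreal 0"
      by (intro tendsto_ennrealI LIMSEQ_power_zero) simp
    then have "eventually (\<lambda>k. ennreal ((1/8)^k) < a) sequentially"
      using a by (intro order_tendstoD(2)) auto
    then obtain k where k: "ennreal ((1/8)^k) < a" by (auto simp: eventually_sequentially)
    show "eventually (\<lambda>k. msq M (\<lambda>x. f k x - g x) < a) sequentially"
      by (rule eventually_sequentiallyI[of "r0 k"]) (use bound k in \<open>auto intro: le_less_trans\<close>)
  qed auto
  then show thesis by (intro that[of g]) auto
qed

lemma msq_const_finite:
  assumes "finite_measure M" shows "msq M (\<lambda>_. c) < top"
  using finite_measure.emeasure_finite[OF assms, of "space M"]
  unfolding msq_def by (simp add: ennreal_mult_less_top less_top)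

lemma msq_limit_finite:
  assumes f: "\<And>k. f k \<in> borel_measurable M" "\<And>k. msq M (f k) < top"
    and g: "g \<in> borel_measurable M" and lim: "L2_lim M f g"
  shows "msq M g < top"
proof -
  obtain k where k: "msq M (\<lambda>x. f k x - g x) < 1"
    using order_tendstoD(2)[OF lim, of 1] by (auto simp: eventually_sequentially)
  from msq_diff_finite[OF f(1)[of k] borel_measurable_diff[OF f(1) g] f(2) less_trans[OF k ennreal_one_less_top]]
  show ?thesis by simp
qed

lemma L2_lim_Cauchy:
  assumes [measurable]: "\<And>k. f k \<in> borel_measurable M" "g \<in> borel_measurable M"
    and lim: "L2_lim M f g"
  shows "L2_Cauchy M f"
  unfolding L2_Cauchy_def
proof (intro allI impI)
  fix e :: real assume e: "0 < e"
  have "eventually (\<lambda>k. msq M (\<lambda>x. f k x - g x) < ennreal (e/4)) sequentially"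
    by (rule order_tendstoD(2)[OF lim]) (use e in simp)
  then obtain n0 where n0: "\<And>k. k \<ge> n0 \<Longrightarrow> msq M (\<lambda>x. f k x - g x) < ennreal (e/4)"
    by (auto simp: eventually_sequentially)
  show "\<exists>n0. \<forall>m\<ge>n0. \<forall>n\<ge>n0. msq M (\<lambda>x. f m x - f n x) < ennreal e"
  proof (intro exI allI impI)
    fix m n assume mn: "m \<ge> n0" "n \<ge> n0"
    have "msq M (\<lambda>x. f m x - f n x) \<le> 2 * msq M (\<lambda>x. f m x - g x) + 2 * msq M (\<lambda>x. g x - f n x)"
      by (rule msq_triangle) auto
    also have "\<dots> < 2 * ennreal (e/4) + 2 * ennreal (e/4)"
      using n0[OF mn(1)] n0[OF mn(2)]
      by (intro add_strict_mono ennreal_mult_strict_left_mono) (auto simp: msq_minus_commute[of M g])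
    also have "\<dots> = ennreal e"
      using e by (simp flip: ennreal_numeral ennreal_mult' ennreal_plus)
    finally show "msq M (\<lambda>x. f m x - f n x) < ennreal e" .
  qed
qed

lemma ennreal_cmult_tendsto_0_iff:
  fixes f :: "nat \<Rightarrow> ennreal"
  assumes "0 < c"
  shows "(\<lambda>k. ennreal c * f k) \<longlonglongrightarrow> 0 \<longleftrightarrow> f \<longlonglongrightarrow> 0"
proof
  assume "(\<lambda>k. ennreal c * f k) \<longlonglongrightarrow> 0"
  then have "(\<lambda>k. ennreal (1 / c) * (ennreal c * f k)) \<longlonglongrightarrow> ennreal (1 / c) * 0"
    by (intro ennreal_tendsto_cmult) auto
  moreover have "ennreal (1 / c) * (ennreal c * x) = x" for x
    using assms by (simp add: mult.assoc[symmetric] ennreal_mult'[symmetric])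
  ultimately show "f \<longlonglongrightarrow> 0" by simp
next
  assume "f \<longlonglongrightarrow> 0"
  then have "(\<lambda>k. ennreal c * f k) \<longlonglongrightarrow> ennreal c * 0"
    by (intro ennreal_tendsto_cmult) auto
  then show "(\<lambda>k. ennreal c * f k) \<longlonglongrightarrow> 0" by simp
qed

text \<open>
  Candidates at stage \<open>n\<close> are the \<open>x\<close> with \<open>P n x\<close>, and
  \<open>d n x\<close> is their error. Choosing a near-minimiser at each stage gives one sequence
  that serves all \<open>e\<close>.
\<close>

lemma diagonal_choice:
  fixes d :: "nat \<Rightarrow> 'c \<Rightarrow> ennreal"
  assumes ex: "\<And>n. \<exists>x. P n x"
    and ev: "\<And>e. 0 < e \<Longrightarrow> \<forall>\<^sub>F n in sequentially. \<exists>x. P n x \<and> d n x \<le> ennreal e"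
  obtains x where "\<And>n. P n (x n)" "(\<lambda>n. d n (x n)) \<longlonglongrightarrow> 0"
proof -
  define m where "m n = (INF x\<in>{x. P n x}. d n x)" for n
  have "\<exists>x. P n x \<and> (m n < top \<longrightarrow> d n x \<le> m n + ennreal (1 / Suc n))" for n
  proof (cases "m n < top")
    case True
    then have "m n < m n + ennreal (1 / Suc n)" by (simp add: ennreal_add_left_cancel_less less_top[symmetric])
    then obtain x where "P n x" "d n x < m n + ennreal (1 / Suc n)"
      unfolding m_def INF_less_iff by blast
    then show ?thesis by (auto intro: less_imp_le)
  qed (use ex in auto)
  then obtain x where x: "\<And>n. P n (x n)" "\<And>n. m n < top \<Longrightarrow> d n (x n) \<le> m n + ennreal (1 / Suc n)" by metis
  have "(\<lambda>n. d n (x n)) \<longlonglongrightarrow> 0"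
  proof (rule order_tendstoI)
    fix a :: ennreal assume "0 < a"
    then obtain c where c: "0 < c" "c < a" using dense by blast
    then obtain e where "c = ennreal e" "0 \<le> e" by (cases c) auto
    then have e: "0 < e" "ennreal e < a" using c by auto
    have "\<forall>\<^sub>F n in sequentially. 1 / real (Suc n) < e / 2"
      using e by (intro order_tendstoD(2)[OF LIMSEQ_Suc[OF lim_1_over_n]]) simp
    moreover have "\<forall>\<^sub>F n in sequentially. \<exists>x. P n x \<and> d n x \<le> ennreal (e / 2)" using ev[of "e / 2"] e by simp
    ultimately show "\<forall>\<^sub>F n in sequentially. d n (x n) < a"
    proof eventually_elim
      case (elim n)
      then have m: "m n \<le> ennreal (e / 2)" unfolding m_def by (meson INF_lower2 mem_Collect_eq)
      then have "d n (x n) \<le> m n + ennreal (1 / Suc n)" by (intro x(2)) (auto intro: le_less_trans)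
      also have "\<dots> \<le> ennreal (e / 2) + ennreal (e / 2)" using elim by (intro add_mono m ennreal_leI) auto
      also have "\<dots> = ennreal e" using e by (simp flip: ennreal_plus)
      finally show ?case using e by simp
    qed
  qed auto
  with x(1) show thesis by (rule that)
qed

text \<open>
  Every square integrable function is a mean square limit of simple functions, so a property that is
  linear and closed under such limits needs to be checked on indicators only.
\<close>

lemma L2_induct:
  assumes [measurable]: "f \<in> borel_measurable M" and fin: "msq M f < top"
    and indi: "\<And>A. A \<in> sets M \<Longrightarrow> P (indicator A)"
    and lin: "\<And>f g a b. P f \<Longrightarrow> P g \<Longrightarrow> P (\<lambda>x. a * f x + b * g x)"
    and lim: "\<And>F f. (\<And>i. P (F i)) \<Longrightarrow> (\<And>i. F i \<in> borel_measurable M) \<Longrightarrow> f \<in> borel_measurable M \<Longrightarrow>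
       msq M f < top \<Longrightarrow> L2_lim M F f \<Longrightarrow> P f"
  shows "P f"
proof -
  obtain F where F: "\<And>i. simple_function M (F i)" "\<And>x. x \<in> space M \<Longrightarrow> (\<lambda>i. F i x) \<longlonglongrightarrow> f x"
    "\<And>i x. x \<in> space M \<Longrightarrow> \<bar>F i x\<bar> \<le> 2 * \<bar>f x\<bar>"
    using borel_measurable_implies_sequence_metric[OF assms(1), of 0] unfolding dist_real_def by simp metis
  define G where "G i x = (\<Sum>y\<in>F i ` space M. y * indicator (F i -` {y} \<inter> space M) x)" for i x
  have sF: "F i -` {y} \<inter> space M \<in> sets M" for i y
    using F(1) by (rule simple_functionD)
  have FG: "F i x = G i x" if "x \<in> space M" for i x
  proof -
    have "G i x = (\<Sum>y\<in>F i ` space M. if y = F i x then y else 0)"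
      unfolding G_def using that by (intro sum.cong) (auto simp: indicator_def)
    then show ?thesis using that simple_functionD(1)[OF F(1)] by simp
  qed
  have 0: "P (\<lambda>_. 0)" using lin[of "indicator {}" "indicator {}" 0 0] indi[of "{}"] by simp
  have "P (\<lambda>x. \<Sum>y\<in>S. y * indicator (F i -` {y} \<inter> space M) x)" if "finite S" for i S
    using that
  proof induct
    case (insert y S)
    have "P (\<lambda>x. y * indicator (F i -` {y} \<inter> space M) x
        + 1 * (\<Sum>y\<in>S. y * indicator (F i -` {y} \<inter> space M) x))"
      by (rule lin[OF indi[OF sF] insert(3)])
    then show ?case by (simp only: sum.insert[OF insert(1,2)] mult_1_left)
  qed (simp add: 0)
  then have PG: "P (G i)" for i unfolding G_def using simple_functionD(1)[OF F(1)] by simp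
  have [measurable]: "G i \<in> borel_measurable M" for i unfolding G_def using sF by measurable
  show ?thesis
  proof (rule lim[OF PG])
    show "(\<lambda>i. msq M (\<lambda>x. G i x - f x)) \<longlonglongrightarrow> 0"
    proof (rule msq_dominated[where w="\<lambda>x. 2 * \<bar>f x\<bar>"])
      have "msq M (\<lambda>x. 2 * \<bar>f x\<bar>) = msq M (\<lambda>x. 2 * f x)" by (simp add: msq_def power_mult_distrib)
      then show "msq M (\<lambda>x. 2 * \<bar>f x\<bar>) < top" using msq_cmult_finite[OF _ fin] by simp
      show "AE x in M. \<bar>G k x\<bar> \<le> 2 * \<bar>f x\<bar>" for k using F(3) FG by auto
      show "AE x in M. (\<lambda>k. G k x) \<longlonglongrightarrow> f x" using F(2) FG by auto
    qed auto
  qed (use fin in auto)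
qed

section \<open>Moments of the Poisson distribution\<close>

abbreviation "has_poisson_mean \<mu> \<equiv> has_bochner_integral (measure_pmf (poisson_pmf \<mu>))"

lemma has_bochner_integral_poisson:
  assumes \<mu>: "0 < \<mu>" and f: "\<And>k. 0 \<le> f k" and S: "(\<lambda>k. \<mu> ^ k / fact k * f k) sums S"
  shows "has_poisson_mean \<mu> f (exp (-\<mu>) * S)"
proof -
  have S': "(\<lambda>k. pmf (poisson_pmf \<mu>) k * f k) sums (exp (-\<mu>) * S)"
    using sums_mult[OF S, of "exp (-\<mu>)"] \<mu> by (simp add: mult_ac)
  then have i: "integrable (count_space UNIV) (\<lambda>k. pmf (poisson_pmf \<mu>) k * f k)"
    using f by (simp add: integrable_count_space_nat_iff abs_mult sums_iff)
  show ?thesis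
    unfolding has_bochner_integral_iff measure_pmf_eq_density
    using i S' by (auto simp: integrable_density integral_density integral_count_space_nat sums_iff)
qed

lemma poisson_power:
  assumes "0 < \<mu>" "0 \<le> a"
  shows "has_poisson_mean \<mu> (\<lambda>k. a ^ k) (exp ((a - 1) * \<mu>))"
proof -
  have "(\<lambda>k. \<mu> ^ k / fact k * a ^ k) sums exp (a * \<mu>)"
    using exp_converges[of "a * \<mu>"] by (simp add: power_mult_distrib field_simps)
  from has_bochner_integral_poisson[OF assms(1) _ this] assms show ?thesis
    by (simp add: exp_add[symmetric] algebra_simps)
qed

text \<open>
  The identity \<open>E (K f(K)) = \<mu> E (f(K + 1))\<close> for a Poisson variable
  \<open>K\<close> of mean \<open>\<mu>\<close>: the factor \<open>k\<close> cancels against the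
  factorial. Here \<open>S\<close> is \<open>e\<^sup>\<mu> E (f(K + 1))\<close>.
\<close>

lemma poisson_shift:
  assumes \<mu>: "0 < \<mu>" and f: "\<And>k. 0 \<le> f k"
    and S: "(\<lambda>k. \<mu> ^ k / fact k * f (Suc k)) sums S"
  shows "has_poisson_mean \<mu> (\<lambda>k. real k * f k) (\<mu> * (exp (-\<mu>) * S))"
proof -
  have "\<mu> ^ Suc k / fact (Suc k) * (real (Suc k) * f (Suc k)) = \<mu> * (\<mu> ^ k / fact k * f (Suc k))" for k
    by (simp add: divide_simps)
  then have "(\<lambda>k. \<mu> ^ Suc k / fact (Suc k) * (real (Suc k) * f (Suc k))) sums (\<mu> * S)"
    using sums_mult[OF S, of \<mu>] by (simp only:)
  from sums_Suc[OF this]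
  have "(\<lambda>k. \<mu> ^ k / fact k * (real k * f k)) sums (\<mu> * S)" by simp
  from has_bochner_integral_poisson[OF \<mu> _ this] f show ?thesis by (simp add: mult_ac)
qed

lemma poisson_power_weighted:
  assumes "0 < \<mu>" "0 \<le> a"
  shows "has_poisson_mean \<mu> (\<lambda>k. real k * a ^ k) (\<mu> * (a * exp ((a - 1) * \<mu>)))"
proof -
  have "(\<lambda>k. \<mu> ^ k / fact k * a ^ Suc k) sums (a * exp (a * \<mu>))"
    using sums_mult[OF exp_converges[of "a * \<mu>"], of a] by (simp add: power_mult_distrib field_simps)
  from poisson_shift[OF assms(1) _ this] assms show ?thesis
    by (simp add: exp_add[symmetric] algebra_simps)
qed

lemma poisson_mean:
  assumes "0 < \<mu>"
  shows "has_poisson_mean \<mu> real \<mu>"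
  using poisson_power_weighted[OF assms, of 1] by simp

lemma poisson_square:
  assumes "0 < \<mu>"
  shows "has_poisson_mean \<mu> (\<lambda>k. (real k)^2) (\<mu>^2 + \<mu>)"
proof -
  have 0: "(\<lambda>k. \<mu> ^ k / fact k) sums exp \<mu>"
    using exp_converges[of \<mu>] by (simp add: field_simps)
  have "(\<lambda>k. \<mu> ^ Suc k / fact (Suc k) * real (Suc k)) sums (\<mu> * exp \<mu>)"
    using sums_mult[OF 0, of \<mu>] by (simp add: divide_simps)
  from sums_add[OF sums_Suc[OF this] 0]
  have "(\<lambda>k. \<mu> ^ k / fact k * real (Suc k)) sums (\<mu> * exp \<mu> + exp \<mu>)"
    by (simp add: algebra_simps add_divide_distrib)
  from poisson_shift[OF assms _ this] have "has_poisson_mean \<mu>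
      (\<lambda>k. real k * real k) (\<mu> * (exp (-\<mu>) * (\<mu> * exp \<mu> + exp \<mu>)))" by simp
  moreover have "exp (-\<mu>) * exp \<mu> = 1" by (simp add: exp_add[symmetric])
  then have "\<mu> * (exp (-\<mu>) * (\<mu> * exp \<mu> + exp \<mu>)) = \<mu>^2 + \<mu>" by algebra
  ultimately show ?thesis by (simp add: power2_eq_square)
qed

lemma poisson_centred:
  assumes "0 < \<mu>"
  shows "has_poisson_mean \<mu> (\<lambda>k. real k - \<mu>) 0"
    and "has_poisson_mean \<mu> (\<lambda>k. (real k - \<mu>)^2) \<mu>"
proof -
  have c: "has_poisson_mean \<mu> (\<lambda>k. c) c" for c :: real
    by (simp add: has_bochner_integral_iff)
  show "has_poisson_mean \<mu> (\<lambda>k. real k - \<mu>) 0"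
    using has_bochner_integral_diff[OF poisson_mean[OF assms] c[of \<mu>]] by simp
  have "has_poisson_mean \<mu>
      (\<lambda>k. (real k)^2 - (2 * \<mu>) * real k + \<mu>^2) (\<mu>^2 + \<mu> - (2 * \<mu>) * \<mu> + \<mu>^2)"
    by (intro has_bochner_integral_add has_bochner_integral_diff poisson_square assms c
        has_bochner_integral_mult_right poisson_mean)
  then show "has_poisson_mean \<mu> (\<lambda>k. (real k - \<mu>)^2) \<mu>"
    by (simp add: power2_eq_square algebra_simps)
qed

text \<open>
  For \<open>K\<close> of mean \<open>\<mu>\<close> the factor \<open>a ^ K * exp ((1 - a) *
  \<mu>)\<close> has mean one. This is the difference from the first order term \<open>1 + (a - 1) *
  (K - \<mu>)\<close>, which is the part that a step integral can reproduce.
\<close>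

definition exp_remainder :: "real \<Rightarrow> real \<Rightarrow> nat \<Rightarrow> real" where
  "exp_remainder a \<mu> k = a ^ k * exp ((1 - a) * \<mu>) - 1 - (a - 1) * (real k - \<mu>)"

text \<open>
  Let \<open>x = \<mu> (1 - a)\<^sup>2\<close>. The mean-one factor has variance \<open>e\<^sup>x -
  1\<close>, the term \<open>(a - 1) (K - \<mu>)\<close> has variance \<open>x\<close>, and their
  covariance is \<open>x\<close> too. Hence the variance of the remainder is \<open>e\<^sup>x - 1 -
  x\<close>, of second order in \<open>\<mu>\<close>.
\<close>

lemma poisson_exp_remainder:
  assumes "0 < \<mu>" "0 \<le> a"
  shows "has_poisson_mean \<mu> (exp_remainder a \<mu>) 0"
    and "has_poisson_mean \<mu> (\<lambda>k. (exp_remainder a \<mu> k)^2)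
           (exp (\<mu> * (1 - a)^2) - 1 - \<mu> * (1 - a)^2)"
proof -
  define E where "E = exp ((1 - a) * \<mu>)"
  have E1: "exp ((a - 1) * \<mu>) * E = 1" by (simp add: E_def exp_add[symmetric] algebra_simps)
  have c: "has_poisson_mean \<mu> (\<lambda>k. c) c" for c :: real
    by (simp add: has_bochner_integral_iff)
  have "has_poisson_mean \<mu>
      (\<lambda>k. a ^ k * E - 1 - (a - 1) * (real k - \<mu>)) (exp ((a - 1) * \<mu>) * E - 1 - (a - 1) * 0)"
    by (intro has_bochner_integral_diff c has_bochner_integral_mult_right has_bochner_integral_mult_left
        poisson_centred poisson_power assms)
  then show "has_poisson_mean \<mu> (exp_remainder a \<mu>) 0"
    unfolding exp_remainder_def E_def[symmetric] by (simp add: E1)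
  have "has_poisson_mean \<mu>
      (\<lambda>k. (a^2) ^ k * E^2 + 1 + (a - 1)^2 * (real k - \<mu>)^2 - a ^ k * (2 * E - 2 * (a - 1) * E * \<mu>)
        - (real k * a ^ k) * (2 * (a - 1) * E) + 2 * (a - 1) * (real k - \<mu>))
      (exp ((a^2 - 1) * \<mu>) * E^2 + 1 + (a - 1)^2 * \<mu> - exp ((a - 1) * \<mu>) * (2 * E - 2 * (a - 1) * E * \<mu>)
        - (\<mu> * (a * exp ((a - 1) * \<mu>))) * (2 * (a - 1) * E) + 2 * (a - 1) * 0)"
    by (intro has_bochner_integral_diff has_bochner_integral_add c has_bochner_integral_mult_right
        has_bochner_integral_mult_left poisson_centred poisson_power poisson_power_weighted assms) simp
  moreover have "(a^2) ^ k * E^2 + 1 + (a - 1)^2 * (real k - \<mu>)^2 - a ^ k * (2 * E - 2 * (a - 1) * E * \<mu>)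
        - (real k * a ^ k) * (2 * (a - 1) * E) + 2 * (a - 1) * (real k - \<mu>) = (exp_remainder a \<mu> k)^2" for k
  proof -
    have "(a^2) ^ k = (a ^ k)^2" by (simp add: power_mult[symmetric] mult.commute)
    then show ?thesis unfolding exp_remainder_def E_def[symmetric]
      by (simp add: power2_eq_square algebra_simps)
  qed
  moreover have "exp ((a^2 - 1) * \<mu>) * E^2 + 1 + (a - 1)^2 * \<mu> - exp ((a - 1) * \<mu>) * (2 * E - 2 * (a - 1) * E * \<mu>)
        - (\<mu> * (a * exp ((a - 1) * \<mu>))) * (2 * (a - 1) * E) + 2 * (a - 1) * 0
      = exp (\<mu> * (1 - a)^2) - 1 - \<mu> * (1 - a)^2"
  proof -
    have "exp ((a^2 - 1) * \<mu>) * E^2 = exp (\<mu> * (1 - a)^2)"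
      unfolding E_def by (simp add: exp_add[symmetric] exp_double[symmetric] power2_eq_square algebra_simps)
    moreover have "x + 1 + (a - 1)^2 * \<mu> - p * (2 * E - 2 * (a - 1) * E * \<mu>)
        - (\<mu> * (a * p)) * (2 * (a - 1) * E) + 2 * (a - 1) * 0 = x - 1 - \<mu> * (1 - a)^2"
      if "p * E = 1" for p x :: real
      using that by algebra
    ultimately show ?thesis using E1 by (simp only:)
  qed
  ultimately show "has_poisson_mean \<mu> (\<lambda>k. (exp_remainder a \<mu> k)^2)
           (exp (\<mu> * (1 - a)^2) - 1 - \<mu> * (1 - a)^2)"
    by (simp only:)
qed

section \<open>Closure under bounded limits\<close>

text \<open>
  A functional form of the monotone class theorem: the closure of a multiplicative class of bounded
  functions is an algebra, and so it contains the indicators of a \<open>\<sigma>\<close>-algebra.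
  The limit rule with a constant sequence also allows changes on null sets.
\<close>

inductive_set bounded_closure :: "'b measure \<Rightarrow> ('b \<Rightarrow> real) set \<Rightarrow> ('b \<Rightarrow> real) set"
  for M :: "'b measure" and C :: "('b \<Rightarrow> real) set" where
  base: "X \<in> C \<Longrightarrow> X \<in> bounded_closure M C"
| lincomb: "X \<in> bounded_closure M C \<Longrightarrow> Y \<in> bounded_closure M C \<Longrightarrow>
    (\<lambda>w. a * X w + b * Y w) \<in> bounded_closure M C"
| limit: "(\<And>n::nat. X n \<in> bounded_closure M C) \<Longrightarrow> (\<And>n. AE w in M. \<bar>X n w\<bar> \<le> B) \<Longrightarrow>
    Y \<in> borel_measurable M \<Longrightarrow> AE w in M. (\<lambda>n. X n w) \<longlonglongrightarrow> Y w \<Longrightarrow> Y \<in> bounded_closure M C"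

text \<open>
  Products have to lie in \<open>C\<close> almost everywhere only: for functions of a Poisson path
  the identities hold where the path is nondecreasing.
\<close>

locale multiplicative_class =
  fixes M :: "'b measure" and C :: "('b \<Rightarrow> real) set"
  assumes C_measurable: "X \<in> C \<Longrightarrow> X \<in> borel_measurable M"
    and C_bounded: "X \<in> C \<Longrightarrow> \<exists>B. AE w in M. \<bar>X w\<bar> \<le> B"
    and C_mult: "X \<in> C \<Longrightarrow> Y \<in> C \<Longrightarrow> \<exists>Z\<in>C. AE w in M. X w * Y w = Z w"
    and C_one: "\<exists>Z\<in>C. AE w in M. Z w = 1"
begin

lemma closure_measurable: "X \<in> bounded_closure M C \<Longrightarrow> X \<in> borel_measurable M"
  by (induct rule: bounded_closure.induct) (auto simp: C_measurable)

lemma closure_bounded: "X \<in> bounded_closure M C \<Longrightarrow> \<exists>B. AE w in M. \<bar>X w\<bar> \<le> B"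
proof (induct rule: bounded_closure.induct)
  case (base X)
  then show ?case by (rule C_bounded)
next
  case (lincomb X Y a b)
  then obtain B1 B2 where B: "AE w in M. \<bar>X w\<bar> \<le> B1" "AE w in M. \<bar>Y w\<bar> \<le> B2" by blast
  have "AE w in M. \<bar>a * X w + b * Y w\<bar> \<le> \<bar>a\<bar> * B1 + \<bar>b\<bar> * B2"
    using B by eventually_elim (rule abs_lincomb_le)
  then show ?case by blast
next
  case (limit X B Y)
  have "AE w in M. \<forall>n. \<bar>X n w\<bar> \<le> B" using limit(3) by (simp add: AE_all_countable)
  then have "AE w in M. \<bar>Y w\<bar> \<le> B"
    using limit(5)
  proof eventually_elim
    case (elim w)
    have "(\<lambda>n. \<bar>X n w\<bar>) \<longlonglongrightarrow> \<bar>Y w\<bar>" using elim by (intro tendsto_rabs) auto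
    then show ?case by (rule LIMSEQ_le_const2) (use elim in auto)
  qed
  then show ?case by blast
qed

lemma closure_cong_AE:
  assumes X: "X \<in> bounded_closure M C" and Y: "Y \<in> borel_measurable M" and eq: "AE w in M. X w = Y w"
  shows "Y \<in> bounded_closure M C"
proof -
  obtain B where B: "AE w in M. \<bar>X w\<bar> \<le> B" using closure_bounded[OF X] by blast
  show ?thesis
    by (rule bounded_closure.limit[of "\<lambda>_. X" M C B]) (use X B Y eq in auto)
qed

lemma closure_const: "(\<lambda>_. c) \<in> bounded_closure M C"
proof -
  obtain Z where Z: "Z \<in> C" "AE w in M. Z w = 1" using C_one by blast
  have "(\<lambda>w. c * Z w + 0 * Z w) \<in> bounded_closure M C"
    by (intro bounded_closure.lincomb bounded_closure.base Z)
  then show ?thesis by (rule closure_cong_AE) (use Z in auto)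
qed

lemma closure_mult_limit:
  assumes Y: "AE w in M. \<bar>Y w\<bar> \<le> B'" "Y \<in> borel_measurable M"
    and X: "\<And>n::nat. (\<lambda>w. Y w * X n w) \<in> bounded_closure M C"
      "\<And>n. AE w in M. \<bar>X n w\<bar> \<le> B" "X' \<in> borel_measurable M" "AE w in M. (\<lambda>n. X n w) \<longlonglongrightarrow> X' w"
  shows "(\<lambda>w. Y w * X' w) \<in> bounded_closure M C"
proof (rule bounded_closure.limit[OF X(1)])
  fix n
  show "AE w in M. \<bar>Y w * X n w\<bar> \<le> \<bar>B'\<bar> * \<bar>B\<bar>"
    using Y(1) X(2)[of n]
  proof eventually_elim
    case (elim w)
    then have "\<bar>Y w\<bar> * \<bar>X n w\<bar> \<le> \<bar>B'\<bar> * \<bar>B\<bar>" by (intro mult_mono) auto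
    then show ?case by (simp add: abs_mult)
  qed
next
  show "AE w in M. (\<lambda>n. Y w * X n w) \<longlonglongrightarrow> Y w * X' w"
    using X(4) by eventually_elim (intro tendsto_mult_left)
qed (use X(3) Y(2) in measurable)

text \<open>
  Two inductions: first multiply by a fixed generator, then by a fixed element of the closure.
\<close>

lemma closure_mult:
  assumes "X \<in> bounded_closure M C" "Y \<in> bounded_closure M C"
  shows "(\<lambda>w. X w * Y w) \<in> bounded_closure M C"
proof -
  have 1: "(\<lambda>w. Z w * Y w) \<in> bounded_closure M C" if "Y \<in> bounded_closure M C" and Z: "Z \<in> C" for Y Z
    using that(1)
  proof (induct rule: bounded_closure.induct)
    case (base X)
    then obtain W where "W \<in> C" "AE w in M. Z w * X w = W w" using C_mult Z by blast
    then show ?case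
      by (intro closure_cong_AE[OF bounded_closure.base[of W]]) (use Z base C_measurable in auto)
  next
    case (lincomb X Y a b)
    from bounded_closure.lincomb[OF lincomb(2,4), of a b] show ?case by (simp add: algebra_simps)
  next
    case (limit X B Y)
    obtain B' where "AE w in M. \<bar>Z w\<bar> \<le> B'" using C_bounded[OF Z] by blast
    then show ?case
      by (rule closure_mult_limit[OF _ C_measurable[OF Z] limit(2) limit(3) limit(4) limit(5)])
  qed
  show ?thesis
    using assms(1)
  proof (induct rule: bounded_closure.induct)
    case (base X)
    then show ?case by (intro 1 assms(2))
  next
    case (lincomb X X' a b)
    from bounded_closure.lincomb[OF lincomb(2,4), of a b] show ?case by (simp add: algebra_simps)
  next
    case (limit X B X')
    obtain B' where "AE w in M. \<bar>Y w\<bar> \<le> B'" using closure_bounded[OF assms(2)] by blast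
    then have "(\<lambda>w. Y w * X' w) \<in> bounded_closure M C"
      by (rule closure_mult_limit[OF _ closure_measurable[OF assms(2)] _ limit(3-5)])
        (use limit(2) in \<open>simp add: mult.commute\<close>)
    then show ?case by (simp add: mult.commute)
  qed
qed

lemma closure_power: "X \<in> bounded_closure M C \<Longrightarrow> (\<lambda>w. X w ^ n) \<in> bounded_closure M C"
  by (induct n) (auto intro: closure_const closure_mult)

definition closure_sets :: "'b set set" where
  "closure_sets = {A \<in> sets M. indicator A \<in> bounded_closure M C}"

lemma closure_sets_Int:
  assumes "A \<in> closure_sets" "B \<in> closure_sets" shows "A \<inter> B \<in> closure_sets"
  using assms closure_mult[of "indicator A" "indicator B"]
  by (auto simp: closure_sets_def indicator_inter_arith[abs_def])

lemma closure_sets_Compl: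
  assumes "A \<in> closure_sets" shows "space M - A \<in> closure_sets"
proof -
  have "(\<lambda>w. 1 * 1 + (-1) * indicator A w) \<in> bounded_closure M C"
    by (intro bounded_closure.lincomb closure_const) (use assms in \<open>auto simp: closure_sets_def\<close>)
  then have "indicator (space M - A) \<in> bounded_closure M C"
    by (rule closure_cong_AE) (use assms in \<open>auto simp: closure_sets_def indicator_def\<close>)
  then show ?thesis using assms by (auto simp: closure_sets_def)
qed

text \<open>
  Intersections are products of indicators, complements are differences from the constant one, and
  countable unions are bounded limits of finite ones.
\<close>

lemma sigma_algebra_closure_sets: "sigma_algebra (space M) closure_sets"
proof (rule sigma_algebra_disjoint_iff[THEN iffD2], intro conjI allI impI)
  show "algebra (space M) closure_sets"
    unfolding algebra_iff_Int
  proof (intro conjI ballI)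
    show "closure_sets \<subseteq> Pow (space M)" by (auto simp: closure_sets_def dest: sets.sets_into_space)
    have "(\<lambda>_. 0) = indicat_real {}" by (auto simp: fun_eq_iff)
    from closure_const[of 0] have "indicat_real {} \<in> bounded_closure M C"
      unfolding \<open>(\<lambda>_. 0) = indicat_real {}\<close> .
    then show "{} \<in> closure_sets" by (simp add: closure_sets_def)
  qed (auto intro: closure_sets_Int closure_sets_Compl)
  then interpret algebra "space M" closure_sets .
  fix A :: "nat \<Rightarrow> 'b set"
  assume A: "range A \<subseteq> closure_sets"
  have U: "(\<Union>i<n. A i) \<in> closure_sets" for n using A by (intro finite_UN) auto
  have "indicator (\<Union>i. A i) \<in> bounded_closure M C"
  proof (rule bounded_closure.limit[where X="\<lambda>n. indicator (\<Union>i<n. A i)" and B=1])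
    show "indicator (\<Union>i<n. A i) \<in> bounded_closure M C" for n using U[of n] by (simp add: closure_sets_def)
    show "indicator (\<Union>i. A i) \<in> borel_measurable M"
      using A by (intro borel_measurable_indicator sets.countable_UN) (auto simp: closure_sets_def)
    show "AE w in M. (\<lambda>n. indicat_real (\<Union>i<n. A i) w) \<longlonglongrightarrow> indicator (\<Union>i. A i) w"
      by (intro AE_I2 LIMSEQ_indicator_UN)
  qed (auto simp: indicator_def)
  then show "(\<Union>i. A i) \<in> closure_sets" using A by (auto simp: closure_sets_def)
qed

text \<open>
  By induction the set \<open>{K \<ge> k}\<close> is already available. On it \<open>exp (k -
  K)\<close> is one where \<open>K = k\<close> and at most \<open>1/e\<close> elsewhere, so its
  powers tend to the indicator of \<open>{K = k}\<close>.
\<close>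

lemma closure_level_set:
  fixes K :: "'b \<Rightarrow> nat"
  assumes [measurable]: "K \<in> measurable M (count_space UNIV)"
    and V: "(\<lambda>w. exp (- real (K w))) \<in> bounded_closure M C"
  shows "{w\<in>space M. K w = k} \<in> closure_sets"
proof (induct k rule: less_induct)
  case (less k)
  interpret sigma_algebra "space M" closure_sets by (rule sigma_algebra_closure_sets)
  define L where "L = space M - (\<Union>j<k. {w\<in>space M. K w = j})"
  have L: "L \<in> closure_sets" unfolding L_def using less by (intro Diff finite_UN top) auto
  have LM: "L \<in> sets M" using L by (simp add: closure_sets_def)
  define Y where "Y w = indicator L w * (exp k * exp (- real (K w)) + 0 * exp (- real (K w)))" for w
  have Yin: "Y \<in> bounded_closure M C" unfolding Y_def
    by (intro closure_mult bounded_closure.lincomb V) (use L in \<open>simp add: closure_sets_def\<close>)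
  have Y: "Y w = (if K w < k then 0 else exp (- real (K w - k)))" if "w \<in> space M" for w
    using that by (auto simp: Y_def L_def exp_add[symmetric] of_nat_diff)
  have Y1: "0 \<le> Y w" "Y w \<le> 1" if "w \<in> space M" for w using Y[OF that] by auto
  have "indicator {w\<in>space M. K w = k} \<in> bounded_closure M C"
  proof (rule bounded_closure.limit[where X="\<lambda>n w. Y w ^ Suc n" and B=1])
    show "(\<lambda>w. Y w ^ Suc n) \<in> bounded_closure M C" for n by (rule closure_power[OF Yin])
    show "AE w in M. \<bar>Y w ^ Suc n\<bar> \<le> 1" for n
      using Y1 by (intro AE_I2) (simp only: power_abs, intro power_le_one, auto)
    show "AE w in M. (\<lambda>n. Y w ^ Suc n) \<longlonglongrightarrow> indicator {w\<in>space M. K w = k} w"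
    proof (intro AE_I2)
      fix w assume w: "w \<in> space M"
      consider "K w < k" | "K w = k" | "K w > k" by linarith
      then show "(\<lambda>n. Y w ^ Suc n) \<longlonglongrightarrow> indicator {w\<in>space M. K w = k} w"
      proof cases
        case 3
        then have "(\<lambda>n. Y w ^ n) \<longlonglongrightarrow> 0"
          using Y[OF w] Y1[OF w] by (intro LIMSEQ_power_zero) auto
        then show ?thesis using 3 using LIMSEQ_Suc[of "\<lambda>n. Y w ^ n" 0] by simp
      qed (use Y[OF w] w in auto)
    qed
  qed measurable
  then show ?case by (simp add: closure_sets_def)
qed

end

section \<open>Independence of increments from the augmented past\<close>

lemma nat_telescope:
  fixes g :: "nat \<Rightarrow> nat"
  assumes "\<And>i j. m \<le> i \<Longrightarrow> i \<le> j \<Longrightarrow> j \<le> m + k \<Longrightarrow> g i \<le> g j"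
  shows "(\<Sum>j=m..<m + k. g (Suc j) - g j) = g (m + k) - g m"
  using assms
proof (induct k)
  case (Suc k)
  have "g m \<le> g (m + k)" "g (m + k) \<le> g (Suc (m + k))" using Suc(2) by simp_all
  moreover have "(\<Sum>j=m..<m + k. g (Suc j) - g j) = g (m + k) - g m" using Suc by simp
  ultimately show ?case by simp
qed simp

context poisson_process begin

abbreviation "has_mean \<equiv> has_bochner_integral M"
abbreviation "\<G> \<equiv> natural_sigma_completed M N"
abbreviation "\<F> \<equiv> natural_filtration M T N"
abbreviation "\<H> \<equiv> energy_space M T \<F> lam"

lemma measurable_N: "t \<in> {0..T} \<Longrightarrow> N t \<in> measurable M (count_space UNIV)"
  by (rule random_variable_N)

lemma paths_mono: "AE w in M. \<forall>s t. 0 \<le> s \<longrightarrow> s \<le> t \<longrightarrow> t \<le> T \<longrightarrow> N s w \<le> N t w"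
  using paths by eventually_elim (auto simp: mono_on_def)

text \<open>
  The natural numbers are discrete, so a right continuous path is constant immediately after
  \<open>t\<close>.
\<close>

lemma paths_right_limit:
  assumes "\<And>n::nat. t \<le> r n" "r \<longlonglongrightarrow> t" "0 \<le> t" "t < T"
  shows "AE w in M. \<forall>\<^sub>F n in sequentially. N (r n) w = N t w"
  using paths
proof eventually_elim
  case (elim w)
  then have "((\<lambda>s. N s w) \<longlongrightarrow> N t w) (at_right t)"
    using assms by (auto simp: continuous_within)
  then have "\<forall>\<^sub>F s in at_right t. N s w = N t w" by (simp add: tendsto_discrete)
  then obtain b where b: "b > t" "\<And>y. y > t \<Longrightarrow> y < b \<Longrightarrow> N y w = N t w"
    by (auto simp: eventually_at_right_field)
  have "\<forall>\<^sub>F n in sequentially. r n < b" by (rule order_tendstoD(2)[OF assms(2) b(1)])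
  then show ?case
  proof eventually_elim
    case (elim n)
    then show ?case using b(2)[of "r n"] assms(1)[of n] by (cases "r n = t") auto
  qed
qed

lemma space_completed [simp]: "space (\<G> s) = space M"
  unfolding natural_sigma_completed_def by (simp add: space_measure_of_conv)

lemma sets_completed:
  assumes "s \<le> T"
  shows "sets (\<G> s) = sigma_sets (space M)
    ((\<Union>r\<in>{0..s}. {N r -` A \<inter> space M | A. True}) \<union> null_sets M)"
  unfolding natural_sigma_completed_def by (intro sets_measure_of) (auto dest: sets.sets_into_space)

lemma sets_completed_subset:
  assumes "s \<le> T" shows "sets (\<G> s) \<subseteq> sets M"
  unfolding sets_completed[OF assms]
proof (intro sets.sigma_sets_subset subsetI)
  fix X assume "X \<in> (\<Union>r\<in>{0..s}. {N r -` A \<inter> space M | A. True}) \<union> null_sets M"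
  then show "X \<in> sets M"
    using measurable_sets[OF measurable_N] assms by auto
qed

lemma space_augmented [simp]: "space (\<F> s) = space M"
  unfolding natural_filtration_def by (simp add: space_measure_of_conv)

lemma sets_augmented: "sets (\<F> t) = (\<Inter>s\<in>insert T {t<..T}. sets (\<G> s))"
proof -
  have "sigma_algebra (space M) (\<Inter>s\<in>insert T {t<..T}. sets (\<G> s))"
    unfolding sigma_algebra_iff2
  proof (intro conjI ballI allI impI)
    show "(\<Inter>s\<in>insert T {t<..T}. sets (\<G> s)) \<subseteq> Pow (space M)"
      using sets.space_closed[of "\<G> T"] by auto
    show "space M - A \<in> (\<Inter>s\<in>insert T {t<..T}. sets (\<G> s))"
      if "A \<in> (\<Inter>s\<in>insert T {t<..T}. sets (\<G> s))" for A
      using that sets.compl_sets[of A "\<G> _"] by (auto simp del: sets.compl_sets)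
  qed auto
  then show ?thesis unfolding natural_filtration_def
    by (metis sigma_algebra.sets_measure_of_eq)
qed

lemma sets_augmented_subset: "sets (\<F> t) \<subseteq> sets M"
  using sets_completed_subset[of T] by (auto simp: sets_augmented)

lemma sets_augmented_T: "sets (\<F> T) = sets (\<G> T)"
  by (simp add: sets_augmented)

lemma sets_augmented_mono: "s \<le> t \<Longrightarrow> sets (\<F> s) \<subseteq> sets (\<F> t)"
  unfolding sets_augmented by (intro INF_superset_mono) auto

lemma subalgebra_augmented: "subalgebra M (\<F> t)"
  using sets_augmented_subset by (simp add: subalgebra_def)

lemma augmented_measurable: "X \<in> borel_measurable (\<F> t) \<Longrightarrow> X \<in> borel_measurable M"
  by (rule measurable_from_subalg[OF subalgebra_augmented])

lemma augmented_measurable_mono: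
  "X \<in> measurable (\<F> s) L \<Longrightarrow> s \<le> t \<Longrightarrow> X \<in> measurable (\<F> t) L"
  by (rule measurable_from_subalg[of _ "\<F> s"]) (auto simp: subalgebra_def sets_augmented_mono dest: subsetD[OF sets_augmented_mono])

lemma N_measurable_augmented:
  assumes "0 \<le> r" "r \<le> t" "t \<le> T"
  shows "N r \<in> measurable (\<F> t) (count_space UNIV)"
proof (rule measurableI)
  fix A :: "nat set"
  have "N r -` A \<inter> space M \<in> sets (\<G> s)" if "r \<le> s" "s \<le> T" for s
    unfolding sets_completed[OF \<open>s \<le> T\<close>] using that assms by (intro sigma_sets.Basic UnI1 UN_I[of r]) auto
  then show "N r -` A \<inter> space (\<F> t) \<in> sets (\<F> t)"
    using assms by (simp add: sets_augmented)
qed simp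

text \<open>
  Products \<open>\<Prod> a\<^sub>i ^ (N(t\<^bsub>i+1\<^esub>) - N(t\<^sub>i))\<close> on the
  regular grid \<open>t\<^sub>i = s i / n\<close> of \<open>[0,s]\<close>. Regular grids of
  \<open>n\<close> and \<open>m\<close> cells have the one of \<open>n m\<close> cells as a common
  refinement, which makes these products multiplicative.
\<close>

definition grid_exponential :: "real \<Rightarrow> nat \<Rightarrow> (nat \<Rightarrow> real) \<Rightarrow> 'a \<Rightarrow> real" where
  "grid_exponential s n a w =
     (\<Prod>i<n. a i ^ (N (s * real (Suc i) / real n) w - N (s * real i / real n) w))"

definition grid_exponentials :: "real \<Rightarrow> ('a \<Rightarrow> real) set" where
  "grid_exponentials s = {grid_exponential s n a | n a. 0 < n \<and> (\<forall>i. 0 < a i \<and> a i \<le> 1)}"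

abbreviation "exp_closure s \<equiv> bounded_closure M (grid_exponentials s)"

lemma grid_point:
  assumes "0 \<le> s" "s \<le> T" "i \<le> n" "0 < n"
  shows "s * real i / real n \<in> {0..s}" "s * real i / real n \<in> {0..T}"
proof -
  have "s * real i \<le> s * real n" using assms by (intro mult_left_mono) auto
  then have "s * real i / real n \<le> s" using assms by (simp add: field_simps)
  then show "s * real i / real n \<in> {0..s}" "s * real i / real n \<in> {0..T}" using assms by auto
qed

lemma grid_path_mono:
  assumes N: "\<forall>s t. 0 \<le> s \<longrightarrow> s \<le> t \<longrightarrow> t \<le> T \<longrightarrow> N s w \<le> N t w"
    and s: "0 \<le> s" "s \<le> T" and ij: "i \<le> j" "j \<le> n"
  shows "N (s * real i / real n) w \<le> N (s * real j / real n) w"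
proof (cases "n = 0")
  case False
  have "s * real i / real n \<le> s * real j / real n"
    using s ij by (intro divide_right_mono mult_left_mono) auto
  moreover have "s * real i / real n \<in> {0..T}" "s * real j / real n \<in> {0..T}"
    by (intro grid_point; use s ij False in auto)+
  ultimately show ?thesis using N by auto
qed simp

lemma measurable_grid_exponential:
  assumes "0 \<le> s" "s \<le> T" "0 < n"
  shows "grid_exponential s n a \<in> borel_measurable M"
proof -
  have [measurable]: "N (s * real i / real n) \<in> measurable M (count_space UNIV)" if "i \<le> n" for i
    by (intro measurable_N grid_point) (use assms that in auto)
  show ?thesis unfolding grid_exponential_def
  proof (rule borel_measurable_prod)
    fix i assume "i \<in> {..<n}"
    then have [measurable]: "N (s * real i / real n) \<in> measurable M (count_space UNIV)"
       "N (s * real (Suc i) / real n) \<in> measurable M (count_space UNIV)"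
      by (intro measurable_N grid_point; use assms in auto)+
    show "(\<lambda>w. a i ^ (N (s * real (Suc i) / real n) w - N (s * real i / real n) w)) \<in> borel_measurable M"
      by measurable
  qed
qed

lemma grid_exponential_bounded:
  assumes "\<And>i. 0 < a i \<and> a i \<le> 1"
  shows "0 \<le> grid_exponential s n a w" "grid_exponential s n a w \<le> 1"
  unfolding grid_exponential_def using assms
  by (auto intro!: prod_nonneg prod_le_1 zero_le_power power_le_one simp: less_imp_le)

text \<open>
  The increment over a coarse cell is the sum of the increments over its \<open>k\<close> fine
  cells, so the base of a coarse cell is repeated on them.
\<close>

lemma grid_exponential_refine:
  assumes "0 \<le> s" "s \<le> T" "0 < n" "0 < k"
  shows "AE w in M. grid_exponential s n a w = grid_exponential s (n * k) (\<lambda>j. a (j div k)) w"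
  using paths_mono
proof eventually_elim
  case (elim w)
  define g where "g j = N (s * real j / real (n * k)) w" for j
  have g: "g i \<le> g j" if "i \<le> j" "j \<le> n * k" for i j
    unfolding g_def by (rule grid_path_mono[OF elim assms(1,2) that])
  have "grid_exponential s (n * k) (\<lambda>j. a (j div k)) w = (\<Prod>j<n * k. a (j div k) ^ (g (Suc j) - g j))"
    by (simp add: grid_exponential_def g_def)
  also have "\<dots> = (\<Prod>m<n. \<Prod>j=m * k..<m * k + k. a (j div k) ^ (g (Suc j) - g j))"
    by (rule prod.nat_group[symmetric])
  also have "\<dots> = (\<Prod>m<n. a m ^ (g (m * k + k) - g (m * k)))"
  proof (rule prod.cong[OF refl])
    fix m assume m: "m \<in> {..<n}"
    have le: "m * k + k \<le> n * k" using m mult_le_mono1[of "Suc m" n k] by simp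
    have "(\<Prod>j=m * k..<m * k + k. a (j div k) ^ (g (Suc j) - g j)) =
        (\<Prod>j=m * k..<m * k + k. a m ^ (g (Suc j) - g j))"
    proof (rule prod.cong[OF refl])
      fix j assume "j \<in> {m * k..<m * k + k}"
      then have "j div k = m" by (intro div_nat_eqI) (auto simp: mult.commute)
      then show "a (j div k) ^ (g (Suc j) - g j) = a m ^ (g (Suc j) - g j)" by simp
    qed
    also have "\<dots> = a m ^ (\<Sum>j=m * k..<m * k + k. g (Suc j) - g j)" by (rule power_sum[symmetric])
    also have "(\<Sum>j=m * k..<m * k + k. g (Suc j) - g j) = g (m * k + k) - g (m * k)"
      by (rule nat_telescope) (use g le in auto)
    finally show "(\<Prod>j=m * k..<m * k + k. a (j div k) ^ (g (Suc j) - g j)) = a m ^ (g (m * k + k) - g (m * k))" .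
  qed
  also have "\<dots> = grid_exponential s n a w"
  proof -
    have "g (m * k) = N (s * real m / real n) w" for m using assms by (simp add: g_def)
    from this[of "Suc _"] this show ?thesis unfolding grid_exponential_def by (simp add: add.commute)
  qed
  finally show ?case by simp
qed

lemma grid_exponentials_mult:
  assumes s: "0 \<le> s" "s \<le> T" and XY: "X \<in> grid_exponentials s" "Y \<in> grid_exponentials s"
  shows "\<exists>Z\<in>grid_exponentials s. AE w in M. X w * Y w = Z w"
proof -
  obtain n a where X: "0 < n" "\<And>i. 0 < a i \<and> a i \<le> 1" "X = grid_exponential s n a"
    using XY(1) by (auto simp: grid_exponentials_def)
  obtain m b where Y: "0 < m" "\<And>i. 0 < b i \<and> b i \<le> 1" "Y = grid_exponential s m b"
    using XY(2) by (auto simp: grid_exponentials_def)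
  define c where "c j = a (j div m) * b (j div n)" for j
  have c: "0 < c i \<and> c i \<le> 1" for i
    using X(2)[of "i div m"] Y(2)[of "i div n"] mult_mono[of "a (i div m)" 1 "b (i div n)" 1]
    by (auto simp: c_def)
  have "AE w in M. X w * Y w = grid_exponential s (n * m) c w"
    using grid_exponential_refine[OF s X(1) Y(1), of a] grid_exponential_refine[OF s Y(1) X(1), of b]
    unfolding X(3) Y(3)
    by eventually_elim
      (simp add: grid_exponential_def c_def mult.commute[of m n] prod.distrib[symmetric] power_mult_distrib)
  moreover have "grid_exponential s (n * m) c \<in> grid_exponentials s"
    unfolding grid_exponentials_def using X(1) Y(1) c by (auto intro!: exI[of _ "n * m"] exI[of _ c])
  ultimately show ?thesis by blast
qed

lemma multiplicative_class_grid_exponentials: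
  assumes s: "0 \<le> s" "s \<le> T"
  shows "multiplicative_class M (grid_exponentials s)"
proof
  fix X assume "X \<in> grid_exponentials s"
  then obtain n a where X: "0 < n" "\<And>i. 0 < a i \<and> a i \<le> 1" "X = grid_exponential s n a"
    by (auto simp: grid_exponentials_def)
  show "X \<in> borel_measurable M" unfolding X(3) by (intro measurable_grid_exponential s X)
  show "\<exists>B. AE w in M. \<bar>X w\<bar> \<le> B"
    unfolding X(3) using grid_exponential_bounded[OF X(2)] by (intro exI[of _ 1] AE_I2) simp
next
  have "grid_exponential s 1 (\<lambda>_. 1) \<in> grid_exponentials s"
    unfolding grid_exponentials_def using zero_less_one by (intro CollectI exI conjI refl) auto
  then show "\<exists>Z\<in>grid_exponentials s. AE w in M. Z w = 1"
    by (intro bexI[of _ "grid_exponential s 1 (\<lambda>_. 1)"]) (auto simp: grid_exponential_def)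
qed (use grid_exponentials_mult[OF s] in blast)

text \<open>
  At a grid time, \<open>b ^ N\<close> is a grid exponential with base \<open>b\<close> before that
  time and base one after it. Any other time \<open>r < s\<close> is approached from the right by
  grid times.
\<close>

lemma power_in_closure:
  assumes s: "0 \<le> s" "s \<le> T" and r: "0 \<le> r" "r \<le> s" and b: "0 < b" "b \<le> 1"
  shows "(\<lambda>w. b ^ N r w) \<in> exp_closure s"
proof -
  interpret multiplicative_class M "grid_exponentials s"
    by (rule multiplicative_class_grid_exponentials[OF s])
  have Nr: "N r \<in> measurable M (count_space UNIV)" using s r by (intro measurable_N) auto
  have grid: "(\<lambda>w. b ^ N (s * real i / real n) w) \<in> exp_closure s"
    if i: "i \<le> n" "0 < n" for i n
  proof (rule closure_cong_AE[OF bounded_closure.base[of "grid_exponential s n (\<lambda>j. if j < i then b else 1)"]])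
    show "grid_exponential s n (\<lambda>j. if j < i then b else 1) \<in> grid_exponentials s"
      unfolding grid_exponentials_def using i b by (intro CollectI exI conjI refl) auto
    have [measurable]: "N (s * real i / real n) \<in> measurable M (count_space UNIV)"
      by (intro measurable_N grid_point s i)
    show "(\<lambda>w. b ^ N (s * real i / real n) w) \<in> borel_measurable M" by measurable
    show "AE w in M. grid_exponential s n (\<lambda>j. if j < i then b else 1) w = b ^ N (s * real i / real n) w"
      using paths_mono paths
    proof eventually_elim
      case (elim w)
      define g where "g j = N (s * real j / real n) w" for j
      have g: "g i \<le> g j" if "i \<le> j" "j \<le> n" for i j
        unfolding g_def by (rule grid_path_mono[OF elim(1) s that])
      have "grid_exponential s n (\<lambda>j. if j < i then b else 1) w
          = (\<Prod>j<n. if j \<in> {..<i} then b ^ (g (Suc j) - g j) else 1)"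
        unfolding grid_exponential_def g_def by (intro prod.cong) auto
      also have "\<dots> = (\<Prod>j<i. b ^ (g (Suc j) - g j))"
        using i by (subst prod.inter_restrict[symmetric]) (auto intro!: prod.cong)
      also have "\<dots> = b ^ (\<Sum>j=0..<0+i. g (Suc j) - g j)"
        by (simp add: power_sum atLeast0LessThan)
      also have "(\<Sum>j=0..<0+i. g (Suc j) - g j) = g (0 + i) - g 0"
        by (rule nat_telescope) (use g i in auto)
      also have "\<dots> = N (s * real i / real n) w" using elim(2) by (simp add: g_def)
      finally show ?case .
    qed
  qed
  show ?thesis
  proof (cases "r = s")
    case True
    then show ?thesis using grid[of 1 1] by simp
  next
    case False
    then have rs: "r < s" using r by simp
    \<comment> \<open>\<open>u n\<close> is the first point at or after \<open>r\<close> of the grid with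
      \<open>Suc n\<close> cells.\<close>
    define i where "i n = nat \<lceil>r * real (Suc n) / s\<rceil>" for n
    define u where "u n = s * real (i n) / real (Suc n)" for n
    have ri: "real (i n) = of_int \<lceil>r * real (Suc n) / s\<rceil>" for n
    proof -
      have "0 \<le> r * real (Suc n) / s" using r rs by auto
      then have "0 \<le> \<lceil>r * real (Suc n) / s\<rceil>" by linarith
      then show ?thesis unfolding i_def by simp
    qed
    have i: "r * real (Suc n) / s \<le> real (i n)" "real (i n) \<le> r * real (Suc n) / s + 1" for n
      unfolding ri by linarith+
    have iN: "i n \<le> Suc n" for n
    proof -
      have "r * real (Suc n) \<le> s * real (Suc n)" using rs by (intro mult_right_mono) auto
      then have "r * real (Suc n) / s \<le> real (Suc n)" using rs r by (simp add: divide_le_eq mult.commute)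
      then have "\<lceil>r * real (Suc n) / s\<rceil> \<le> int (Suc n)" by (intro ceiling_le) (simp del: of_nat_Suc)
      then show ?thesis unfolding i_def by (simp only: nat_le_iff)
    qed
    have u1: "r \<le> u n" for n
      using i(1)[of n] rs r by (simp add: u_def field_simps)
    have u2: "u n \<le> r + s / real (Suc n)" for n
    proof -
      have "s * real (i n) \<le> s * (r * real (Suc n) / s + 1)" using i(2)[of n] rs r by (intro mult_left_mono) auto
      also have "\<dots> = (r + s / real (Suc n)) * real (Suc n)" using rs r by (simp add: field_simps del: of_nat_Suc)
      finally show ?thesis unfolding u_def by (simp add: pos_divide_le_eq del: of_nat_Suc)
    qed
    have ulim: "u \<longlonglongrightarrow> r"
    proof (rule tendsto_sandwich[of "\<lambda>_. r" _ _ "\<lambda>n. r + s / real (Suc n)"])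
      have "(\<lambda>n. r + s / real (Suc n)) \<longlonglongrightarrow> r + 0"
        by (intro tendsto_intros LIMSEQ_Suc[OF lim_const_over_n])
      then show "(\<lambda>n. r + s / real (Suc n)) \<longlonglongrightarrow> r" by simp
    qed (use u1 u2 in auto)
    show ?thesis
    proof (rule bounded_closure.limit[where B=1])
      show "(\<lambda>w. b ^ N (u n) w) \<in> exp_closure s" for n
        unfolding u_def by (rule grid[OF iN]) simp
      show "AE w in M. \<bar>b ^ N (u n) w\<bar> \<le> 1" for n using b by (auto simp: power_le_one)
      show "(\<lambda>w. b ^ N r w) \<in> borel_measurable M" using Nr by measurable
      show "AE w in M. (\<lambda>n. b ^ N (u n) w) \<longlonglongrightarrow> b ^ N r w"
        using paths_right_limit[OF u1 ulim r(1) order.strict_trans2[OF rs s(2)]]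
      proof eventually_elim
        case (elim w)
        show ?case by (rule tendsto_eventually) (use elim in \<open>auto elim: eventually_mono\<close>)
      qed
    qed
  qed
qed

lemma indicator_in_closure:
  assumes s: "0 \<le> s" "s \<le> T" and A: "A \<in> sets (\<G> s)"
  shows "indicator A \<in> exp_closure s"
proof -
  interpret multiplicative_class M "grid_exponentials s"
    by (rule multiplicative_class_grid_exponentials[OF s])
  interpret S: sigma_algebra "space M" closure_sets by (rule sigma_algebra_closure_sets)
  have "sets (\<G> s) \<subseteq> closure_sets"
    unfolding sets_completed[OF s(2)]
  proof (intro S.sigma_sets_subset subsetI)
    fix A assume "A \<in> (\<Union>r\<in>{0..s}. {N r -` A \<inter> space M | A. True}) \<union> null_sets M"
    then consider r B where "r \<in> {0..s}" "A = N r -` B \<inter> space M" | "A \<in> null_sets M" by auto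
    then show "A \<in> closure_sets"
    proof cases
      case 1
      have Nr: "N r \<in> measurable M (count_space UNIV)" using 1 s by (intro measurable_N) auto
      have "(\<lambda>w. exp (- 1) ^ N r w) \<in> exp_closure s"
        by (rule power_in_closure[OF s]) (use 1 in auto)
      then have "(\<lambda>w. exp (- real (N r w))) \<in> exp_closure s"
        by (simp add: exp_of_nat_mult[symmetric])
      then have "{w\<in>space M. N r w = k} \<in> closure_sets" for k by (rule closure_level_set[OF Nr])
      then have "(\<Union>k\<in>B. {w\<in>space M. N r w = k}) \<in> closure_sets" by (intro S.countable_UN') auto
      also have "(\<Union>k\<in>B. {w\<in>space M. N r w = k}) = A" using 1 by auto
      finally show ?thesis .
    next
      case 2
      then have "indicator A \<in> exp_closure s"
        by (intro closure_cong_AE[OF closure_const[of 0]])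
          (auto simp: eq_commute[of 0] dest: AE_not_in elim!: eventually_mono)
      then show ?thesis using 2 by (auto simp: closure_sets_def)
    qed
  qed
  then show ?thesis using A by (auto simp: closure_sets_def)
qed

lemma increment_measurable:
  assumes "0 \<le> s" "s \<le> t" "t \<le> T"
  shows "(\<lambda>w. N t w - N s w) \<in> measurable M (count_space UNIV)"
proof -
  have [measurable]: "N t \<in> measurable M (count_space UNIV)" "N s \<in> measurable M (count_space UNIV)"
    using assms by (auto intro!: measurable_N)
  show ?thesis by measurable
qed

text \<open>
  A grid exponential on \<open>[0,s]\<close> and the increment over \<open>(s,t]\<close> are
  functions of disjoint increments. The product formula is linear in \<open>X\<close> and passes to
  bounded limits, so it extends to the closure.
\<close>

lemma closure_increment_independent:
  assumes st: "0 \<le> s" "s < t" "t \<le> T" and X: "X \<in> exp_closure s"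
  shows "(\<integral>w. X w * indicator B (N t w - N s w) \<partial>M) =
    (\<integral>w. X w \<partial>M) * (\<integral>w. indicator B (N t w - N s w) \<partial>M)"
proof -
  interpret multiplicative_class M "grid_exponentials s"
    using st by (intro multiplicative_class_grid_exponentials) auto
  have Dm: "(\<lambda>w. N t w - N s w) \<in> measurable M (count_space UNIV)"
    using st by (intro increment_measurable) auto
  define J :: "'a \<Rightarrow> real" where "J w = indicator B (N t w - N s w)" for w
  have [measurable]: "J \<in> borel_measurable M" unfolding J_def using Dm by measurable
  have int: "integrable M (\<lambda>w. Y w * J w)" "integrable M Y" if Y: "Y \<in> exp_closure s" for Y
  proof -
    have [measurable]: "Y \<in> borel_measurable M" by (rule closure_measurable[OF Y])
    obtain C where C: "AE w in M. \<bar>Y w\<bar> \<le> C" using closure_bounded[OF Y] by blast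
    show "integrable M Y" by (rule integrable_const_bound[of _ C]) (use C in auto)
    show "integrable M (\<lambda>w. Y w * J w)"
    proof (rule integrable_const_bound[of _ C])
      show "AE w in M. norm (Y w * J w) \<le> C"
        using C by eventually_elim (auto simp: J_def indicator_def)
    qed measurable
  qed
  have "(\<integral>w. X w * J w \<partial>M) = (\<integral>w. X w \<partial>M) * (\<integral>w. J w \<partial>M)"
    using X
  proof (induct rule: bounded_closure.induct)
    case (base X)
    then obtain n a where na: "0 < n" "\<And>i. 0 < a i \<and> a i \<le> 1" "X = grid_exponential s n a"
      by (auto simp: grid_exponentials_def)
    show ?case
    \<comment> \<open>For \<open>s = 0\<close> all grid points coincide and the times are not strictly increasing,
      but then \<open>X\<close> is the constant one.\<close>
    proof (cases "s = 0")
      case True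
      then have "X = (\<lambda>_. 1)" by (auto simp: na grid_exponential_def fun_eq_iff)
      then show ?thesis by (simp add: prob_space)
    next
      case False
      then have s0: "0 < s" using st by simp
      define \<tau> where "\<tau> i = (if i \<le> n then s * real i / real n else t)" for i
      have \<tau>: "strict_mono_on {..Suc n} \<tau>" "\<tau> ` {..Suc n} \<subseteq> {0..T}"
      proof -
        show "strict_mono_on {..Suc n} \<tau>"
        proof (rule strict_mono_onI)
          fix i j assume ij: "i \<in> {..Suc n}" "j \<in> {..Suc n}" "i < j"
          then have "i \<le> n" by auto
          show "\<tau> i < \<tau> j"
          proof (cases "j \<le> n")
            case True
            then show ?thesis using ij s0 na(1) \<open>i \<le> n\<close> by (auto simp: \<tau>_def divide_strict_right_mono)
          next
            case False
            have "s * real i / real n \<le> s" using grid_point(1)[of s i n] st na(1) \<open>i \<le> n\<close> by auto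
            then show ?thesis using False \<open>i \<le> n\<close> st by (simp add: \<tau>_def)
          qed
        qed
        show "\<tau> ` {..Suc n} \<subseteq> {0..T}"
          using grid_point(2)[of s _ n] st na(1) by (auto simp: \<tau>_def)
      qed
      define Y :: "nat \<Rightarrow> nat \<Rightarrow> real" where "Y i = (if i < n then (\<lambda>k. a i ^ k) else indicator B)" for i
      define Z where "Z i w = Y i (N (\<tau> (Suc i)) w - N (\<tau> i) w)" for i w
      have ind: "indep_vars (\<lambda>_. borel) Z {..<Suc n}"
        unfolding Z_def by (rule indep_vars_compose2[OF indep_increments[OF \<tau>]]) auto
      have intZ: "integrable M (Z i)" if "i \<in> {..<Suc n}" for i
      proof (rule integrable_const_bound[of _ 1])
        show "Z i \<in> borel_measurable M" using ind that unfolding indep_vars_def2 by auto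
        show "AE w in M. norm (Z i w) \<le> 1"
          using na(2)[of i] by (intro AE_I2) (auto simp: Z_def Y_def power_le_one indicator_def)
      qed
      have "X w = (\<Prod>i<n. Z i w)" for w
        unfolding na(3) grid_exponential_def Z_def by (intro prod.cong) (auto simp: Y_def \<tau>_def)
      moreover have "J w = Z n w" for w
        using na(1) by (simp add: J_def Z_def Y_def \<tau>_def)
      moreover have "(\<integral>w. (\<Prod>i<Suc n. Z i w) \<partial>M) = (\<Prod>i<Suc n. \<integral>w. Z i w \<partial>M)"
        by (rule indep_vars_lebesgue_integral[OF _ ind intZ]) auto
      moreover have "(\<integral>w. (\<Prod>i<n. Z i w) \<partial>M) = (\<Prod>i<n. \<integral>w. Z i w \<partial>M)"
        by (rule indep_vars_lebesgue_integral[OF _ indep_vars_subset[OF ind] intZ]) auto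
      ultimately show ?thesis by simp
    qed
  next
    case (lincomb X Y a b)
    then show ?case
      using int[OF lincomb(1)] int[OF lincomb(3)]
      by (simp add: distrib_right mult.assoc)
  next
    case (limit X C Y)
    have [measurable]: "Y \<in> borel_measurable M" "X n \<in> borel_measurable M" for n
      using limit(4) closure_measurable[OF limit(1)] by auto
    have "(\<lambda>n. \<integral>w. X n w \<partial>M) \<longlonglongrightarrow> (\<integral>w. Y w \<partial>M)"
      by (rule integral_dominated_convergence[where w="\<lambda>_. C"]) (use limit in auto)
    then have 1: "(\<lambda>n. (\<integral>w. X n w \<partial>M) * (\<integral>w. J w \<partial>M)) \<longlonglongrightarrow> (\<integral>w. Y w \<partial>M) * (\<integral>w. J w \<partial>M)"
      by (rule tendsto_mult_right)
    have "(\<lambda>n. \<integral>w. X n w * J w \<partial>M) \<longlonglongrightarrow> (\<integral>w. Y w * J w \<partial>M)"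
    proof (rule integral_dominated_convergence[where w="\<lambda>_. C"])
      show "AE w in M. (\<lambda>n. X n w * J w) \<longlonglongrightarrow> Y w * J w"
        using limit(5) by eventually_elim (rule tendsto_mult_right)
      show "AE w in M. norm (X n w * J w) \<le> C" for n
        using limit(3)[of n] by eventually_elim (auto simp: J_def indicator_def)
    qed auto
    with 1 show ?case unfolding limit(2) by (rule LIMSEQ_unique[symmetric])
  qed
  then show ?thesis by (simp add: J_def)
qed

lemma completed_increment_independent:
  assumes st: "0 \<le> s" "s < t" "t \<le> T" and A: "A \<in> sets (\<G> s)"
  shows "(\<integral>w. indicator A w * indicator B (N t w - N s w) \<partial>M) =
    prob A * (\<integral>w. indicator B (N t w - N s w) \<partial>M)"
  using closure_increment_independent[OF st indicator_in_closure[OF _ _ A], of B] st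
    sets_completed_subset[of s] A by (auto simp: subset_eq)

text \<open>
  An event of the augmented past at \<open>s\<close> belongs to the completed past at every later
  time \<open>r\<close>, hence is independent of the increment over \<open>(r,t]\<close>. Let
  \<open>r\<close> decrease to \<open>s\<close> and use right continuity of the paths.
\<close>

lemma augmented_increment_independent:
  assumes st: "0 \<le> s" "s \<le> t" "t \<le> T" and A: "A \<in> sets (\<F> s)"
  shows "(\<integral>w. indicator A w * indicator B (N t w - N s w) \<partial>M) =
    prob A * (\<integral>w. indicator B (N t w - N s w) \<partial>M)"
proof (cases "s = t")
  case True
  have "A \<in> sets M" using A sets_augmented_subset by auto
  then show ?thesis using True by (simp add: prob_space)
next
  case False
  have AM[measurable]: "A \<in> sets M" using A sets_augmented_subset by auto
  define r where "r n = s + (t - s) / real (Suc (Suc n))" for n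
  have r: "s < r n" "r n < t" for n
  proof -
    have "(t - s) / real (Suc (Suc n)) < (t - s) / 1"
      using False st by (intro divide_strict_left_mono) auto
    then show "s < r n" "r n < t" using False st by (auto simp: r_def)
  qed
  have rlim: "r \<longlonglongrightarrow> s"
  proof -
    have "(\<lambda>n. s + (t - s) / real (Suc (Suc n))) \<longlonglongrightarrow> s + 0"
      by (intro tendsto_intros LIMSEQ_Suc lim_const_over_n)
    then show ?thesis unfolding r_def by simp
  qed
  have [measurable]: "(\<lambda>w. N t w - N (r n) w) \<in> measurable M (count_space UNIV)" for n
    using r[of n] st by (intro increment_measurable) auto
  have [measurable]: "(\<lambda>w. N t w - N s w) \<in> measurable M (count_space UNIV)"
    using st by (intro increment_measurable) auto
  have ev: "AE w in M. \<forall>\<^sub>F n in sequentially. N (r n) w = N s w"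
    by (rule paths_right_limit) (use r rlim st False in \<open>auto intro: less_imp_le\<close>)
  have eq: "(\<integral>w. indicator A w * indicator B (N t w - N (r n) w) \<partial>M) =
    prob A * (\<integral>w. indicator B (N t w - N (r n) w) \<partial>M)" for n
    by (rule completed_increment_independent) (use r[of n] st A in \<open>auto simp: sets_augmented\<close>)
  have "(\<lambda>n. \<integral>w. indicator B (N t w - N (r n) w) \<partial>M) \<longlonglongrightarrow> (\<integral>w. indicat_real B (N t w - N s w) \<partial>M)"
  proof (rule integral_dominated_convergence[where w="\<lambda>_. 1"])
    show "AE w in M. (\<lambda>n. indicat_real B (N t w - N (r n) w)) \<longlonglongrightarrow> indicator B (N t w - N s w)"
      using ev by eventually_elim (rule tendsto_eventually, auto elim: eventually_mono)
  qed (auto simp: indicator_def)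
  then have 1: "(\<lambda>n. prob A * (\<integral>w. indicator B (N t w - N (r n) w) \<partial>M))
      \<longlonglongrightarrow> prob A * (\<integral>w. indicat_real B (N t w - N s w) \<partial>M)"
    by (rule tendsto_mult_left)
  have "(\<lambda>n. \<integral>w. indicator A w * indicator B (N t w - N (r n) w) \<partial>M)
      \<longlonglongrightarrow> (\<integral>w. indicat_real A w * indicator B (N t w - N s w) \<partial>M)"
  proof (rule integral_dominated_convergence[where w="\<lambda>_. 1"])
    show "AE w in M. (\<lambda>n. indicat_real A w * indicator B (N t w - N (r n) w))
        \<longlonglongrightarrow> indicator A w * indicator B (N t w - N s w)"
      using ev by eventually_elim (intro tendsto_mult_left tendsto_eventually, auto elim: eventually_mono)
  qed (auto simp: indicator_def)
  with 1 show ?thesis unfolding eq by (rule LIMSEQ_unique[symmetric])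
qed

lemma indep_var_increment:
  fixes f :: "nat \<Rightarrow> real"
  assumes st: "0 \<le> s" "s \<le> t" "t \<le> T" and X: "X \<in> borel_measurable (\<F> s)"
  shows "indep_var borel X borel (\<lambda>w. f (N t w - N s w))"
proof -
  define D where "D w = f (N t w - N s w)" for w
  have D: "D \<in> borel_measurable M"
    unfolding D_def using increment_measurable[OF st] by measurable
  have XM: "X \<in> borel_measurable M" by (rule augmented_measurable[OF X])
  have stable: "Int_stable {Y -` A \<inter> space M |A. A \<in> sets borel}" for Y :: "'a \<Rightarrow> real"
  proof (rule Int_stableI, clarsimp)
    fix A B :: "real set" assume "A \<in> sets borel" "B \<in> sets borel"
    then show "\<exists>C. Y -` A \<inter> space M \<inter> (Y -` B \<inter> space M) = Y -` C \<inter> space M \<and> C \<in> sets borel"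
      by (intro exI[of _ "A \<inter> B"]) auto
  qed
  have "indep_set (sigma_sets (space M) {X -` A \<inter> space M |A. A \<in> sets borel})
      (sigma_sets (space M) {D -` A \<inter> space M |A. A \<in> sets borel})"
  proof (rule indep_set_sigma_sets)
    show "indep_set {X -` A \<inter> space M |A. A \<in> sets borel} {D -` A \<inter> space M |A. A \<in> sets borel}"
    proof (rule indep_setI)
      show "{X -` A \<inter> space M |A. A \<in> sets borel} \<subseteq> events" using measurable_sets[OF XM] by auto
      show "{D -` A \<inter> space M |A. A \<in> sets borel} \<subseteq> events" using measurable_sets[OF D] by auto
      fix a b assume "a \<in> {X -` A \<inter> space M |A. A \<in> sets borel}" "b \<in> {D -` A \<inter> space M |A. A \<in> sets borel}"
      then obtain A B where AB: "A \<in> sets borel" "B \<in> sets borel" "a = X -` A \<inter> space M" "b = D -` B \<inter> space M" by auto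
      have a: "a \<in> sets (\<F> s)" using measurable_sets[OF X AB(1)] AB(3) by simp
      have ab: "a \<in> events" "b \<in> events" using AB measurable_sets[OF XM] measurable_sets[OF D] by auto
      have "prob (a \<inter> b) = (\<integral>w. indicator (a \<inter> b) w \<partial>M)" using ab by simp
      also have "\<dots> = (\<integral>w. indicator a w * indicator (f -` B) (N t w - N s w) \<partial>M)"
        by (intro Bochner_Integration.integral_cong) (auto simp: AB D_def indicator_def)
      also have "\<dots> = prob a * (\<integral>w. indicator (f -` B) (N t w - N s w) \<partial>M)"
        by (rule augmented_increment_independent[OF st a])
      also have "(\<integral>w. indicator (f -` B) (N t w - N s w) \<partial>M) = (\<integral>w. indicat_real b w \<partial>M)"
        by (intro Bochner_Integration.integral_cong) (auto simp: AB D_def indicator_def)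
      finally show "prob (a \<inter> b) = prob a * prob b" using ab by simp
    qed
  qed (rule stable)+
  then have "indep_var borel X borel D"
    unfolding indep_var_eq using XM D by simp
  then show ?thesis unfolding D_def[abs_def] .
qed

lemma increment_has_integral:
  assumes "0 \<le> s" "s < t" "t \<le> T"
    and "has_poisson_mean (lam * (t - s)) f v"
  shows "has_mean (\<lambda>w. f (N t w - N s w)) (v :: real)"
proof -
  have D: "(\<lambda>w. N t w - N s w) \<in> measurable M (count_space UNIV)"
    using assms by (intro increment_measurable) auto
  show ?thesis
    using assms(4) unfolding increments[OF assms(1-3), symmetric] has_bochner_integral_iff
    by (simp add: integrable_distr_eq[OF D] integral_distr[OF D])
qed

section \<open>Elementary integrands and the energy space\<close>

definition increment :: "real \<Rightarrow> real \<Rightarrow> 'a \<Rightarrow> real" where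
  "increment s t w = compensated lam N t w - compensated lam N s w"

lemma increment_self [simp]: "increment s s = (\<lambda>_. 0)"
  by (simp add: increment_def fun_eq_iff)

lemma increment_split: "increment r t w = increment r s w + increment s t w"
  by (simp add: increment_def)

lemma increment_eq:
  assumes "0 \<le> s" "s \<le> t" "t \<le> T"
  shows "AE w in M. increment s t w = real (N t w - N s w) - lam * (t - s)"
  using paths_mono
  by eventually_elim (use assms in \<open>simp add: increment_def compensated_def of_nat_diff algebra_simps\<close>)

lemma increment_measurable_augmented:
  assumes "0 \<le> s" "s \<le> t" "t \<le> T"
  shows "increment s t \<in> borel_measurable (\<F> t)"
proof -
  have [measurable]: "N s \<in> measurable (\<F> t) (count_space UNIV)" "N t \<in> measurable (\<F> t) (count_space UNIV)"
    using assms by (auto intro!: N_measurable_augmented)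
  show ?thesis unfolding increment_def[abs_def] compensated_def by measurable
qed

lemma increment_measurable_M:
  assumes "0 \<le> s" "s \<le> t" "t \<le> T"
  shows "increment s t \<in> borel_measurable M"
  using increment_measurable_augmented[OF assms] by (rule augmented_measurable)

lemma increment_moments:
  assumes st: "0 \<le> s" "s \<le> t" "t \<le> T"
  shows "has_mean (increment s t) 0"
    and "has_mean (\<lambda>w. (increment s t w)^2) (lam * (t - s))"
proof -
  have "has_mean (increment s t) 0 \<and>
    has_mean (\<lambda>w. (increment s t w)^2) (lam * (t - s))"
  proof (cases "s = t")
    case False
    then have \<mu>: "0 < lam * (t - s)" using st intensity by simp
    note m = poisson_centred[OF this]
    note [measurable] = increment_measurable_M[OF st] increment_measurable[OF st]
    note hi = increment_has_integral[OF st(1) _ st(3)]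
    have "has_mean (\<lambda>w. real (N t w - N s w) - lam * (t - s)) 0"
      by (rule hi[OF _ m(1)]) (use False st in auto)
    moreover have "has_mean (\<lambda>w. (real (N t w - N s w) - lam * (t - s))^2) (lam * (t - s))"
      by (rule hi[OF _ m(2)]) (use False st in auto)
    moreover have "has_mean (increment s t) 0 \<longleftrightarrow>
        has_mean (\<lambda>w. real (N t w - N s w) - lam * (t - s)) 0"
      by (rule has_bochner_integral_cong_AE) (use increment_eq[OF st] in auto)
    moreover have "has_mean (\<lambda>w. (increment s t w)^2) (lam * (t - s)) \<longleftrightarrow>
        has_mean (\<lambda>w. (real (N t w - N s w) - lam * (t - s))^2) (lam * (t - s))"
      by (rule has_bochner_integral_cong_AE) (use increment_eq[OF st] in auto)
    ultimately show ?thesis by simp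
  qed (simp add: has_bochner_integral_zero)
  then show "has_mean (increment s t) 0"
    and "has_mean (\<lambda>w. (increment s t w)^2) (lam * (t - s))" by auto
qed

lemma expectation_times_function_of_increment:
  fixes f :: "nat \<Rightarrow> real"
  assumes st: "0 \<le> s" "s \<le> t" "t \<le> T"
    and X: "X \<in> borel_measurable (\<F> s)" "integrable M X"
    and Y: "has_mean Y c" "AE w in M. Y w = f (N t w - N s w)"
  shows "has_mean (\<lambda>w. X w * Y w) ((\<integral>w. X w \<partial>M) * c)"
proof -
  let ?g = "\<lambda>w. f (N t w - N s w)"
  have [measurable]: "Y \<in> borel_measurable M" using Y by auto
  note [measurable] = increment_measurable[OF st] augmented_measurable[OF X(1)]
  have "has_mean Y c \<longleftrightarrow> has_mean ?g c"
    by (rule has_bochner_integral_cong_AE) (use Y in auto)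
  then have g: "integrable M ?g" "(\<integral>w. ?g w \<partial>M) = c" using Y by (auto simp: has_bochner_integral_iff)
  note ind = indep_var_increment[OF st X(1), of f]
  have "has_mean (\<lambda>w. X w * ?g w) ((\<integral>w. X w \<partial>M) * c)"
    unfolding has_bochner_integral_iff
    using indep_var_lebesgue_integral[OF ind X(2) g(1)] indep_var_integrable[OF ind X(2) g(1)] g(2) by simp
  moreover have "has_mean (\<lambda>w. X w * Y w) ((\<integral>w. X w \<partial>M) * c) \<longleftrightarrow>
     has_mean (\<lambda>w. X w * ?g w) ((\<integral>w. X w \<partial>M) * c)"
    by (rule has_bochner_integral_cong_AE) (use Y(2) in auto)
  ultimately show ?thesis by simp
qed

lemma expectation_times_increment:
  assumes st: "0 \<le> s" "s \<le> t" "t \<le> T"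
    and X: "X \<in> borel_measurable (\<F> s)" "integrable M X"
  shows "has_mean (\<lambda>w. X w * increment s t w) 0"
    and "has_mean (\<lambda>w. X w * (increment s t w)^2) ((\<integral>w. X w \<partial>M) * (lam * (t - s)))"
proof -
  show "has_mean (\<lambda>w. X w * increment s t w) 0"
    using expectation_times_function_of_increment[OF st X increment_moments(1)[OF st],
        of "\<lambda>k. real k - lam * (t - s)"] increment_eq[OF st] by simp
  show "has_mean (\<lambda>w. X w * (increment s t w)^2) ((\<integral>w. X w \<partial>M) * (lam * (t - s)))"
    by (rule expectation_times_function_of_increment[OF st X increment_moments(2)[OF st],
        of "\<lambda>k. (real k - lam * (t - s))^2"]) (use increment_eq[OF st] in eventually_elim, simp)
qed

text \<open>
  The integrand \<open>\<xi>\<close> on \<open>(s,t]\<close>; its integral is \<open>\<xi> *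
  increment s t\<close>.
\<close>

definition elementary :: "real \<Rightarrow> real \<Rightarrow> ('a \<Rightarrow> real) \<Rightarrow> bool" where
  "elementary s t \<xi> \<longleftrightarrow> 0 \<le> s \<and> s \<le> t \<and> t \<le> T \<and> \<xi> \<in> borel_measurable (\<F> s) \<and>
     (\<exists>B. \<forall>w\<in>space M. \<bar>\<xi> w\<bar> \<le> B)"

lemma integrable_bounded:
  fixes f :: "'a \<Rightarrow> real"
  assumes "f \<in> borel_measurable M" "\<forall>w\<in>space M. \<bar>f w\<bar> \<le> B"
  shows "integrable M f"
  by (rule integrable_const_bound[of _ B]) (use assms in auto)

lemma integrable_bounded_times:
  fixes f g :: "'a \<Rightarrow> real"
  assumes f: "integrable M f" and g: "g \<in> borel_measurable M" "\<forall>w\<in>space M. \<bar>g w\<bar> \<le> B"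
  shows "integrable M (\<lambda>w. g w * f w)"
proof (rule Bochner_Integration.integrable_bound[of _ "\<lambda>w. B * f w"])
  show "AE w in M. norm (g w * f w) \<le> norm (B * f w)"
  proof (intro AE_I2)
    fix w assume "w \<in> space M"
    then have "\<bar>g w\<bar> * \<bar>f w\<bar> \<le> \<bar>B\<bar> * \<bar>f w\<bar>" using g(2) by (intro mult_right_mono) force+
    then show "norm (g w * f w) \<le> norm (B * f w)" by (simp add: abs_mult)
  qed
qed (use f g in auto)

text \<open>
  If \<open>t \<le> t'\<close>, the longer increment is the shorter one plus a later increment,
  which is centred and independent of the rest.
\<close>

lemma common_start_covariance:
  assumes st: "0 \<le> s" "s \<le> t" "s \<le> t'" "t \<le> T" "t' \<le> T"
    and Z: "Z \<in> borel_measurable (\<F> s)" "\<forall>w\<in>space M. \<bar>Z w\<bar> \<le> B"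
  shows "has_mean (\<lambda>w. Z w * (increment s t w * increment s t' w))
    ((\<integral>w. Z w \<partial>M) * (lam * (min t t' - s)))"
proof -
  have *: "has_mean (\<lambda>w. Z w * (increment s t w * increment s t' w))
    ((\<integral>w. Z w \<partial>M) * (lam * (t - s)))" if st: "s \<le> t" "t \<le> t'" "t' \<le> T" for t t'
  proof -
    have a: "0 \<le> t" "t \<le> T" using st assms(1) by auto
    note ZM = augmented_measurable[OF Z(1)]
    have "has_mean (\<lambda>w. Z w * (increment s t w)^2) ((\<integral>w. Z w \<partial>M) * (lam * (t - s)))"
      by (rule expectation_times_increment(2)[OF assms(1) st(1) a(2) Z(1)]) (rule integrable_bounded[OF ZM Z(2)])
    moreover have "has_mean (\<lambda>w. (Z w * increment s t w) * increment t t' w) 0"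
    proof (rule expectation_times_increment(1)[OF a(1) st(2,3)])
      show "(\<lambda>w. Z w * increment s t w) \<in> borel_measurable (\<F> t)"
        by (intro borel_measurable_times increment_measurable_augmented augmented_measurable_mono[OF Z(1)])
          (use assms(1) st a in auto)
      show "integrable M (\<lambda>w. Z w * increment s t w)"
        using increment_moments(1)[OF assms(1) st(1) a(2)]
        by (intro integrable_bounded_times[OF _ ZM Z(2)]) (simp add: has_bochner_integral_iff)
    qed
    ultimately have "has_mean (\<lambda>w. Z w * (increment s t w)^2 + (Z w * increment s t w) * increment t t' w)
      ((\<integral>w. Z w \<partial>M) * (lam * (t - s)) + 0)" by (rule has_bochner_integral_add)
    moreover have "Z w * (increment s t w)^2 + (Z w * increment s t w) * increment t t' w =
        Z w * (increment s t w * increment s t' w)" for w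
      using increment_split[of s t' w t] by (simp add: power2_eq_square algebra_simps)
    ultimately show ?thesis by simp
  qed
  show ?thesis
  proof (cases "t \<le> t'")
    case True
    then show ?thesis using *[of t t'] st by simp
  next
    case False
    then show ?thesis using *[of t' t] st by (simp add: mult.commute[of "increment s t _"])
  qed
qed

text \<open>
  Say \<open>s \<le> s'\<close>. The part of the first increment up to \<open>s'\<close> is known at
  \<open>s'\<close> and contributes nothing, because the second increment is centred; what remains
  starts at \<open>s'\<close> as well. No common refinement of partitions is involved, so the
  isometry follows at once for step processes on different partitions.
\<close>

lemma elementary_covariance:
  assumes "elementary s t \<xi>" "elementary s' t' \<xi>'"
  shows "has_mean (\<lambda>w. (\<xi> w * increment s t w) * (\<xi>' w * increment s' t' w))
    ((\<integral>w. \<xi> w * \<xi>' w \<partial>M) * (lam * max 0 (min t t' - max s s')))"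
proof -
  have *: "has_mean (\<lambda>w. (\<xi> w * increment s t w) * (\<xi>' w * increment s' t' w))
    ((\<integral>w. \<xi> w * \<xi>' w \<partial>M) * (lam * max 0 (min t t' - s')))"
    if e: "elementary s t \<xi>" "elementary s' t' \<xi>'" and ss: "s \<le> s'" for s t \<xi> s' t' \<xi>'
  proof -
    obtain B B' where B: "\<forall>w\<in>space M. \<bar>\<xi> w\<bar> \<le> B" "\<forall>w\<in>space M. \<bar>\<xi>' w\<bar> \<le> B'"
      using e unfolding elementary_def by blast
    have st: "0 \<le> s" "s \<le> t" "t \<le> T" "0 \<le> s'" "s' \<le> t'" "t' \<le> T"
      and m: "\<xi> \<in> borel_measurable (\<F> s)" "\<xi>' \<in> borel_measurable (\<F> s')"
      using e by (auto simp: elementary_def)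
    define Z where "Z w = \<xi> w * \<xi>' w" for w
    have Z: "Z \<in> borel_measurable (\<F> s')"
      unfolding Z_def[abs_def] using augmented_measurable_mono[OF m(1) ss] m(2) by measurable
    have ZB: "\<forall>w\<in>space M. \<bar>Z w\<bar> \<le> B * B'"
      unfolding Z_def abs_mult using B by (auto intro!: mult_mono intro: order_trans[OF abs_ge_zero])
    have past: "has_mean (\<lambda>w. (Z w * increment s r w) * increment s' t' w) 0"
      if r: "s \<le> r" "r \<le> s'" for r
    proof (rule expectation_times_increment(1)[OF st(4-6)])
      show "(\<lambda>w. Z w * increment s r w) \<in> borel_measurable (\<F> s')"
        by (intro borel_measurable_times Z augmented_measurable_mono[OF increment_measurable_augmented[of s r]])
          (use st r in auto)
      show "integrable M (\<lambda>w. Z w * increment s r w)"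
        using increment_moments(1)[of s r] st r
        by (intro integrable_bounded_times[OF _ augmented_measurable[OF Z] ZB]) (simp add: has_bochner_integral_iff)
    qed
    show ?thesis
    proof (cases "t \<le> s'")
      case True
      then show ?thesis using past[of t] st by (simp add: Z_def mult_ac)
    next
      case False
      have "has_mean (\<lambda>w. Z w * (increment s' t w * increment s' t' w))
          ((\<integral>w. Z w \<partial>M) * (lam * (min t t' - s')))"
        by (rule common_start_covariance[OF _ _ _ _ _ Z ZB]) (use st False in auto)
      from has_bochner_integral_add[OF past[of s'] this] ss
      have "has_mean (\<lambda>w. Z w * increment s s' w * increment s' t' w +
            Z w * (increment s' t w * increment s' t' w))
          ((\<integral>w. Z w \<partial>M) * (lam * (min t t' - s')))" by simp
      moreover have "Z w * increment s s' w * increment s' t' w + Z w * (increment s' t w * increment s' t' w)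
         = (\<xi> w * increment s t w) * (\<xi>' w * increment s' t' w)" for w
        using increment_split[of s t w s'] by (simp add: Z_def algebra_simps)
      ultimately show ?thesis using False st by (simp add: Z_def)
    qed
  qed
  show ?thesis
  proof (cases "s \<le> s'")
    case True
    then show ?thesis using *[OF assms True] by (simp add: max_def)
  next
    case False
    then have "s' \<le> s" by simp
    from *[OF assms(2,1) this] False show ?thesis by (simp add: max_def min.commute mult_ac)
  qed
qed

abbreviation "predictable \<equiv> predictable_sigma M T \<F>"

text \<open>
  The product \<open>dt \<otimes> P\<close> on the predictable \<open>\<sigma>\<close>-algebra.
  Carrying the smaller \<open>\<sigma>\<close>-algebra in the measure keeps mean square limits
  predictable, which is the completeness of the energy space.
\<close>

definition dtP :: "(real \<times> 'a) measure" where
  "dtP = restr_to_subalg (restrict_space lborel {0..T} \<Otimes>\<^sub>M M) predictable"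

abbreviation "dt \<equiv> restrict_space lborel {0..T}"

abbreviation predictable_rectangles :: "(real \<times> 'a) set set" where
  "predictable_rectangles \<equiv> {{0} \<times> A | A. A \<in> sets (\<F> 0)} \<union>
     {{s<..t} \<times> A | s t A. 0 \<le> s \<and> s < t \<and> t \<le> T \<and> A \<in> sets (\<F> s)}"

lemma predictable_generators:
  "predictable_rectangles
    \<subseteq> Pow ({0..T} \<times> space M)"
  using horizon sets.sets_into_space[of _ "\<F> _"] by fastforce

lemma space_predictable [simp]: "space predictable = {0..T} \<times> space M"
  unfolding predictable_sigma_def by (rule space_measure_of[OF predictable_generators])

lemma sets_predictable: "sets predictable = sigma_sets ({0..T} \<times> space M)
   predictable_rectangles"
  unfolding predictable_sigma_def by (rule sets_measure_of[OF predictable_generators])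

lemma subalgebra_predictable: "subalgebra (dt \<Otimes>\<^sub>M M) predictable"
proof -
  have sp: "space (dt \<Otimes>\<^sub>M M) = {0..T} \<times> space M"
    by (simp add: space_pair_measure space_restrict_space)
  have "sets predictable \<subseteq> sets (dt \<Otimes>\<^sub>M M)"
    unfolding sets_predictable sp[symmetric]
  proof (intro sets.sigma_sets_subset subsetI)
    fix X assume X: "X \<in> predictable_rectangles"
    have "{0} \<in> sets dt" "{s<..t} \<in> sets dt" if "0 \<le> s" "t \<le> T" for s t
      using that horizon by (auto simp: sets_restrict_space_iff)
    then show "X \<in> sets (dt \<Otimes>\<^sub>M M)"
      using X horizon by (auto intro!: pair_measureI intro: subsetD[OF sets_augmented_subset])
  qed
  then show ?thesis by (simp add: subalgebra_def sp)
qed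

lemma finite_time_measure: "finite_measure dt"
  by (intro finite_measureI) (use horizon in \<open>simp add: emeasure_restrict_space space_restrict_space\<close>)

lemma time_sample_pair: "pair_sigma_finite dt M"
proof -
  interpret F: finite_measure dt by (rule finite_time_measure)
  show ?thesis by unfold_locales
qed

lemma finite_measure_dtP: "finite_measure dtP"
  unfolding dtP_def
proof (rule finite_measure_restr_to_subalg[OF subalgebra_predictable])
  interpret F: finite_measure dt by (rule finite_time_measure)
  show "finite_measure (dt \<Otimes>\<^sub>M M)"
  proof (rule finite_measureI)
    have "emeasure (dt \<Otimes>\<^sub>M M) (space dt \<times> space M) = emeasure dt (space dt)"
      by (subst emeasure_pair_measure_Times[OF sets.top sets.top]) (simp add: emeasure_space_1)
    then show "emeasure (dt \<Otimes>\<^sub>M M) (space (dt \<Otimes>\<^sub>M M)) \<noteq> \<infinity>"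
      using F.emeasure_finite by (simp add: space_pair_measure)
  qed
qed

lemma sets_dtP [measurable_cong]: "sets dtP = sets predictable"
  unfolding dtP_def by (rule sets_restr_to_subalg[OF subalgebra_predictable])

lemma space_dtP [simp]: "space dtP = {0..T} \<times> space M"
  unfolding dtP_def by (simp add: space_restr_to_subalg space_pair_measure space_restrict_space)

lemma measurable_dtP: "borel_measurable dtP = borel_measurable predictable"
  by (rule measurable_cong_sets[OF sets_dtP refl])

lemma energy_sqnorm_eq:
  assumes u: "(\<lambda>(t, w). u t w) \<in> borel_measurable dtP"
  shows "energy_sqnorm M T lam u = ennreal lam * msq dtP (\<lambda>(t, w). u t w)"
proof -
  interpret P: pair_sigma_finite dt M by (rule time_sample_pair)
  have uP: "(\<lambda>(t, w). u t w) \<in> borel_measurable predictable" using u measurable_dtP by simp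
  note uS[measurable] = measurable_from_subalg[OF subalgebra_predictable uP]
  have "msq dtP (\<lambda>(t, w). u t w) = (\<integral>\<^sup>+z. ennreal ((case z of (t, w) \<Rightarrow> u t w)^2) \<partial>(dt \<Otimes>\<^sub>M M))"
    unfolding msq_def dtP_def
    by (rule nn_integral_subalgebra2[OF subalgebra_predictable]) (use uP in measurable)
  also have "\<dots> = (\<integral>\<^sup>+w. (\<integral>\<^sup>+t. ennreal ((u t w)^2) \<partial>dt) \<partial>M)"
    by (subst P.nn_integral_snd[symmetric]) auto
  also have "\<dots> = (\<integral>\<^sup>+w. (\<integral>\<^sup>+t\<in>{0..T}. ennreal (\<bar>u t w\<bar>^2) \<partial>lborel) \<partial>M)"
    by (simp add: nn_integral_restrict_space)
  finally show ?thesis by (simp add: energy_sqnorm_def)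
qed

lemma energy_space_iff:
  "u \<in> \<H> \<longleftrightarrow>
    (\<lambda>(t, w). u t w) \<in> borel_measurable dtP \<and> msq dtP (\<lambda>(t, w). u t w) < top"
  unfolding energy_space_def measurable_dtP[symmetric]
  using energy_sqnorm_eq[of u] intensity by (auto simp: ennreal_mult_less_top)

lemma energy_inner_eq:
  assumes u: "u \<in> \<H>" and v: "v \<in> \<H>"
  shows "energy_inner M T lam u v =
    lam * (\<integral>z. (case z of (t, w) \<Rightarrow> u t w) * (case z of (t, w) \<Rightarrow> v t w) \<partial>dtP)"
proof -
  interpret P: pair_sigma_finite dt M by (rule time_sample_pair)
  let ?u = "\<lambda>(t, w). u t w" and ?v = "\<lambda>(t, w). v t w"
  have m: "?u \<in> borel_measurable dtP" "?v \<in> borel_measurable dtP"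
    and f: "msq dtP ?u < top" "msq dtP ?v < top" using u v by (auto simp: energy_space_iff)
  have i: "integrable dtP (\<lambda>z. ?u z * ?v z)"
    by (intro integrable_mult_square m) (use f m in \<open>simp_all add: msq_finite_iff[symmetric]\<close>)
  have uvP: "(\<lambda>z. ?u z * ?v z) \<in> borel_measurable predictable"
    using i measurable_dtP by auto
  have iS: "integrable (dt \<Otimes>\<^sub>M M) (\<lambda>(t, w). u t w * v t w)"
    using integrable_from_subalg[OF subalgebra_predictable i[unfolded dtP_def]]
    by (simp add: case_prod_unfold)
  have "(\<integral>z. ?u z * ?v z \<partial>dtP) = (\<integral>z. ?u z * ?v z \<partial>(dt \<Otimes>\<^sub>M M))"
    unfolding dtP_def by (rule integral_subalgebra2[OF subalgebra_predictable uvP])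
  also have "\<dots> = (\<integral>w. (\<integral>t. u t w * v t w \<partial>dt) \<partial>M)"
    using P.integral_snd[OF iS] by (simp add: case_prod_unfold)
  also have "\<dots> = (\<integral>w. (LINT t:{0..T}|lborel. u t w * v t w) \<partial>M)"
    by (simp add: integral_restrict_space set_lebesgue_integral_def)
  finally show ?thesis by (simp add: energy_inner_def)
qed

lemma elementary_measurable:
  assumes "elementary s t \<xi>"
  shows "(\<lambda>(r, w). \<xi> w * indicator {s<..t} r) \<in> borel_measurable dtP"
proof (cases "s = t")
  case False
  then have st: "0 \<le> s" "s < t" "t \<le> T" and \<xi>: "\<xi> \<in> borel_measurable (\<F> s)"
    using assms by (auto simp: elementary_def)
  have rect: "{s<..t} \<times> A \<in> sets predictable" if "A \<in> sets (\<F> s)" for A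
    unfolding sets_predictable using st that by (intro sigma_sets.Basic) auto
  show ?thesis unfolding measurable_dtP
  proof (rule measurableI)
    fix A :: "real set" assume A: "A \<in> sets borel"
    have 1: "{s<..t} \<times> (\<xi> -` A \<inter> space M) \<in> sets predictable"
      using measurable_sets[OF \<xi> A] by (intro rect) simp
    have "space M \<in> sets (\<F> s)" using sets.top[of "\<F> s"] by simp
    then have 2: "space predictable - {s<..t} \<times> space M \<in> sets predictable"
      by (intro sets.compl_sets rect)
    have "(\<lambda>(r, w). \<xi> w * indicator {s<..t} r) -` A \<inter> space predictable =
       {s<..t} \<times> (\<xi> -` A \<inter> space M) \<union> (if 0 \<in> A then space predictable - {s<..t} \<times> space M else {})"
      using st by (auto simp: indicator_def of_bool_def split: if_splits)
    then show "(\<lambda>(r, w). \<xi> w * indicator {s<..t} r) -` A \<inter> space predictable \<in> sets predictable"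
      using 1 2 by auto
  qed simp
qed (simp add: case_prod_unfold)

lemma integral_product_time_sample:
  fixes f :: "real \<Rightarrow> real" and g :: "'a \<Rightarrow> real"
  assumes fg: "integrable dt f" "integrable M g"
    and m: "(\<lambda>(r, w). g w * f r) \<in> borel_measurable dtP"
  shows "has_bochner_integral dtP (\<lambda>(r, w). g w * f r)
    ((\<integral>w. g w \<partial>M) * (\<integral>r. f r \<partial>dt))"
proof -
  interpret P: pair_sigma_finite dt M by (rule time_sample_pair)
  have mP: "(\<lambda>(r, w). g w * f r) \<in> borel_measurable predictable" using m measurable_dtP by simp
  note mS = measurable_from_subalg[OF subalgebra_predictable mP]
  have i: "integrable (dt \<Otimes>\<^sub>M M) (\<lambda>(r, w). g w * f r)"
  proof (rule P.Fubini_integrable[OF mS])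
    have "integrable dt (\<lambda>x. (\<integral>w. \<bar>g w\<bar> \<partial>M) * \<bar>f x\<bar>)" using fg by auto
    then show "integrable dt (\<lambda>x. \<integral>y. norm (case (x, y) of (r, w) \<Rightarrow> g w * f r) \<partial>M)"
      by (simp add: abs_mult)
  qed (use fg in auto)
  have "(\<integral>z. (case z of (r, w) \<Rightarrow> g w * f r) \<partial>dtP) = (\<integral>z. (case z of (r, w) \<Rightarrow> g w * f r) \<partial>(dt \<Otimes>\<^sub>M M))"
    unfolding dtP_def by (rule integral_subalgebra2[OF subalgebra_predictable mP])
  also have "\<dots> = (\<integral>w. (\<integral>r. g w * f r \<partial>dt) \<partial>M)"
    using P.integral_snd[OF i] by simp
  finally have "(\<integral>z. (case z of (r, w) \<Rightarrow> g w * f r) \<partial>dtP) = (\<integral>w. g w \<partial>M) * (\<integral>r. f r \<partial>dt)"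
    by simp
  moreover have "integrable dtP (\<lambda>(r, w). g w * f r)"
    unfolding dtP_def by (rule integrable_in_subalg[OF subalgebra_predictable mP i])
  ultimately show ?thesis by (simp add: has_bochner_integral_iff)
qed

text \<open>
  Matches \<open>elementary_covariance\<close>: \<open>max 0 (min t t' - max s s')\<close> is the
  length of the overlap of the two intervals.
\<close>

lemma elementary_energy:
  assumes e: "elementary s t \<xi>" "elementary s' t' \<xi>'"
  shows "has_bochner_integral dtP
    (\<lambda>(r, w). (\<xi> w * indicator {s<..t} r) * (\<xi>' w * indicator {s'<..t'} r))
    ((\<integral>w. \<xi> w * \<xi>' w \<partial>M) * max 0 (min t t' - max s s'))"
proof -
  obtain B B' where B: "\<forall>w\<in>space M. \<bar>\<xi> w\<bar> \<le> B" "\<forall>w\<in>space M. \<bar>\<xi>' w\<bar> \<le> B'"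
    using e unfolding elementary_def by blast
  have st: "0 \<le> s" "s \<le> t" "t \<le> T" "0 \<le> s'" "s' \<le> t'" "t' \<le> T"
    and m: "\<xi> \<in> borel_measurable M" "\<xi>' \<in> borel_measurable M"
    using e augmented_measurable by (auto simp: elementary_def)
  let ?I = "{max s s'<..min t t'}"
  have eq: "(\<lambda>(r, w). (\<xi> w * indicator {s<..t} r) * (\<xi>' w * indicator {s'<..t'} r)) =
      (\<lambda>(r, w). (\<xi> w * \<xi>' w) * indicator ?I r)"
    by (auto simp: fun_eq_iff indicator_def)
  have I: "?I \<subseteq> {0..T}" using st by auto
  have Is: "?I \<in> sets dt" using I by (subst sets_restrict_space_iff) auto
  have "measure dt ?I = measure lborel ?I"
    using I by (intro measure_restrict_space) auto
  also have "\<dots> = max 0 (min t t' - max s s')" by (cases "max s s' \<le> min t t'") auto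
  finally have I2: "measure dt ?I = max 0 (min t t' - max s s')" .
  interpret F: finite_measure dt by (rule finite_time_measure)
  have "has_bochner_integral dtP (\<lambda>(r, w). (\<xi> w * \<xi>' w) * indicator ?I r)
    ((\<integral>w. \<xi> w * \<xi>' w \<partial>M) * (\<integral>r. indicator ?I r \<partial>dt))"
  proof (rule integral_product_time_sample)
    show "integrable M (\<lambda>w. \<xi> w * \<xi>' w)"
      by (intro integrable_bounded_times[OF _ m(1) B(1)] integrable_bounded[OF m(2) B(2)])
    show "integrable dt (indicat_real ?I)" using Is by (simp add: F.emeasure_finite less_top[symmetric])
    show "(\<lambda>(r, w). \<xi> w * \<xi>' w * indicat_real ?I r) \<in> borel_measurable dtP"
      unfolding eq[symmetric] using borel_measurable_times[OF elementary_measurable[OF e(1)] elementary_measurable[OF e(2)]]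
      by (simp add: case_prod_unfold)
  qed
  also have "(\<integral>r. indicator ?I r \<partial>dt) = max 0 (min t t' - max s s')"
    using I I2 by (simp add: space_restrict_space Int_absorb2)
  finally show ?thesis unfolding eq .
qed

section \<open>Step processes and their density\<close>

abbreviation "is_step \<equiv> predictable_step M T \<F>"
abbreviation "step_fun n \<tau> \<xi> \<equiv> (\<lambda>(r, w). step_process n \<tau> \<xi> r w)"
abbreviation "step_int \<equiv> step_integral (compensated lam N)"
abbreviation "integral_of \<equiv> has_stochastic_integral M T lam N"

text \<open>
  A step process, read as a function of time and sample point, together with its integral. Limit
  arguments need only this pair and not the partition.
\<close>

definition simple_integrand :: "(real \<times> 'a \<Rightarrow> real) \<Rightarrow> ('a \<Rightarrow> real) \<Rightarrow> bool" where
  "simple_integrand f I \<longleftrightarrow> (\<exists>n \<tau> \<xi>. is_step n \<tau> \<xi> \<and> f = step_fun n \<tau> \<xi> \<and> I = step_int n \<tau> \<xi>)"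

lemma is_step_elementary:
  assumes "is_step n \<tau> \<xi>" "i < n"
  shows "elementary (\<tau> i) (\<tau> (Suc i)) (\<xi> i)"
proof -
  have "\<tau> i \<in> {0..T}" "\<tau> (Suc i) \<in> {0..T}"
    using assms unfolding predictable_step_def by (auto simp: image_subset_iff)
  moreover have "\<tau> i \<le> \<tau> (Suc i)"
    using assms unfolding predictable_step_def by (auto elim!: mono_onD)
  ultimately show ?thesis using assms by (auto simp: predictable_step_def elementary_def)
qed

lemma step_int_eq: "step_int n \<tau> \<xi> w = (\<Sum>i<n. \<xi> i w * increment (\<tau> i) (\<tau> (Suc i)) w)"
  by (simp add: step_integral_def increment_def)

lemma step_fun_eq: "step_fun n \<tau> \<xi> z = (\<Sum>i<n. (\<lambda>(r, w). \<xi> i w * indicator {\<tau> i<..\<tau> (Suc i)} r) z)"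
  by (cases z) (simp add: step_process_def)

lemma simple_measurable:
  assumes "simple_integrand f I"
  shows "f \<in> borel_measurable dtP" "I \<in> borel_measurable M"
proof -
  obtain n \<tau> \<xi> where s: "is_step n \<tau> \<xi>" and fI: "f = step_fun n \<tau> \<xi>" "I = step_int n \<tau> \<xi>"
    using assms unfolding simple_integrand_def by blast
  show "f \<in> borel_measurable dtP"
    unfolding fI step_fun_eq by (intro borel_measurable_sum elementary_measurable is_step_elementary[OF s]) auto
  have "(\<lambda>w. \<xi> i w * increment (\<tau> i) (\<tau> (Suc i)) w) \<in> borel_measurable M" if "i < n" for i
    using is_step_elementary[OF s that] unfolding elementary_def
    by (intro borel_measurable_times increment_measurable_M) (auto dest: augmented_measurable)
  then show "I \<in> borel_measurable M" unfolding fI step_int_eq[abs_def] by (intro borel_measurable_sum) auto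
qed

text \<open>
  Both sides are double sums over the cells of the two partitions, and they agree term by term.
\<close>

lemma simple_covariance:
  assumes "simple_integrand f I" "simple_integrand g J"
  obtains c where "has_mean (\<lambda>w. I w * J w) (lam * c)"
    and "has_bochner_integral dtP (\<lambda>z. f z * g z) c"
proof -
  obtain n \<tau> \<xi> where s: "is_step n \<tau> \<xi>" and fI: "f = step_fun n \<tau> \<xi>" "I = step_int n \<tau> \<xi>"
    using assms(1) unfolding simple_integrand_def by blast
  obtain n' \<tau>' \<xi>' where s': "is_step n' \<tau>' \<xi>'" and gJ: "g = step_fun n' \<tau>' \<xi>'" "J = step_int n' \<tau>' \<xi>'"
    using assms(2) unfolding simple_integrand_def by blast
  note e = is_step_elementary[OF s] is_step_elementary[OF s']
  define c where "c i j = (\<integral>w. \<xi> i w * \<xi>' j w \<partial>M) * max 0 (min (\<tau> (Suc i)) (\<tau>' (Suc j)) - max (\<tau> i) (\<tau>' j))" for i j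
  have "has_mean (\<lambda>w. \<Sum>i<n. \<Sum>j<n'. (\<xi> i w * increment (\<tau> i) (\<tau> (Suc i)) w) *
      (\<xi>' j w * increment (\<tau>' j) (\<tau>' (Suc j)) w)) (\<Sum>i<n. \<Sum>j<n'. lam * c i j)"
    by (intro has_bochner_integral_sum) (use elementary_covariance[OF e] in \<open>simp add: c_def mult_ac\<close>)
  then have 1: "has_mean (\<lambda>w. I w * J w) (lam * (\<Sum>i<n. \<Sum>j<n'. c i j))"
    unfolding fI gJ step_int_eq sum_product sum_distrib_left[symmetric] .
  have "has_bochner_integral dtP (\<lambda>z. \<Sum>i<n. \<Sum>j<n'.
       (\<lambda>(r, w). \<xi> i w * indicator {\<tau> i<..\<tau> (Suc i)} r) z * (\<lambda>(r, w). \<xi>' j w * indicator {\<tau>' j<..\<tau>' (Suc j)} r) z)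
       (\<Sum>i<n. \<Sum>j<n'. c i j)"
    by (intro has_bochner_integral_sum) (use elementary_energy[OF e] in \<open>simp add: c_def case_prod_unfold\<close>)
  then have 2: "has_bochner_integral dtP (\<lambda>z. f z * g z) (\<Sum>i<n. \<Sum>j<n'. c i j)"
    unfolding fI gJ step_fun_eq sum_product .
  show thesis by (rule that[OF 1 2])
qed

lemma simple_msq_finite:
  assumes "simple_integrand f I"
  shows "msq dtP f < top" "msq M I < top"
proof -
  obtain c where "has_mean (\<lambda>w. I w * I w) (lam * c)" "has_bochner_integral dtP (\<lambda>z. f z * f z) c"
    by (rule simple_covariance[OF assms assms])
  then show "msq dtP f < top" "msq M I < top"
    using simple_measurable[OF assms] by (simp_all only: msq_finite_iff has_bochner_integral_iff power2_eq_square)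
qed

lemma simple_isometry:
  assumes s: "simple_integrand f I" "simple_integrand g J"
  shows "msq M (\<lambda>w. I w - J w) = ennreal lam * msq dtP (\<lambda>z. f z - g z)"
proof -
  obtain a where a: "has_mean (\<lambda>w. I w * I w) (lam * a)" "has_bochner_integral dtP (\<lambda>z. f z * f z) a"
    by (rule simple_covariance[OF s(1) s(1)])
  obtain b where b: "has_mean (\<lambda>w. I w * J w) (lam * b)" "has_bochner_integral dtP (\<lambda>z. f z * g z) b"
    by (rule simple_covariance[OF s])
  obtain c where c: "has_mean (\<lambda>w. J w * J w) (lam * c)" "has_bochner_integral dtP (\<lambda>z. g z * g z) c"
    by (rule simple_covariance[OF s(2) s(2)])
  have sq: "x * x - 2 * (x * y) + y * y = (x - y)^2" for x y :: real
    by (simp add: power2_eq_square algebra_simps)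
  have "has_mean (\<lambda>w. (I w - J w)^2) (lam * a - 2 * (lam * b) + lam * c)"
    using has_bochner_integral_add[OF has_bochner_integral_diff[OF a(1) has_bochner_integral_mult_right[OF b(1), of 2]] c(1)]
    by (simp add: sq)
  moreover have "has_bochner_integral dtP (\<lambda>z. (f z - g z)^2) (a - 2 * b + c)"
    using has_bochner_integral_add[OF has_bochner_integral_diff[OF a(2) has_bochner_integral_mult_right[OF b(2), of 2]] c(2)]
    by (simp only: sq)
  moreover have "lam * a - 2 * (lam * b) + lam * c = lam * (a - 2 * b + c)" by (simp add: algebra_simps)
  ultimately show ?thesis using intensity
    by (simp only: has_bochner_integral_iff msq_eq_integral) (simp add: ennreal_mult')
qed

lemma simple_mean:
  assumes "simple_integrand f I"
  shows "has_mean I 0"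
proof -
  obtain n \<tau> \<xi> where s: "is_step n \<tau> \<xi>" and I: "I = step_int n \<tau> \<xi>"
    using assms unfolding simple_integrand_def by blast
  have "has_mean (\<lambda>w. \<Sum>i<n. \<xi> i w * increment (\<tau> i) (\<tau> (Suc i)) w) (\<Sum>i<n. 0)"
  proof (intro has_bochner_integral_sum)
    fix i assume "i \<in> {..<n}"
    then have e: "elementary (\<tau> i) (\<tau> (Suc i)) (\<xi> i)" using is_step_elementary[OF s] by simp
    then show "has_mean (\<lambda>w. \<xi> i w * increment (\<tau> i) (\<tau> (Suc i)) w) 0"
      by (intro expectation_times_increment(1)) (auto simp: elementary_def intro: integrable_bounded augmented_measurable)
  qed
  then show ?thesis unfolding I step_int_eq[abs_def] by simp
qed

definition grid :: "nat \<Rightarrow> nat \<Rightarrow> real" where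
  "grid n i = T * real i / real n"

lemma grid_mono: "i \<le> j \<Longrightarrow> grid n i \<le> grid n j"
  unfolding grid_def using horizon by (intro divide_right_mono mult_left_mono) auto

lemma grid_range: "i \<le> n \<Longrightarrow> grid n i \<in> {0..T}"
  using grid_point(1)[of T i n] horizon by (cases "n = 0") (auto simp: grid_def)

lemma is_step_grid_iff:
  "is_step n (grid n) \<xi> \<longleftrightarrow>
    (\<forall>i<n. \<xi> i \<in> borel_measurable (\<F> (grid n i)) \<and> (\<exists>B. \<forall>w\<in>space M. \<bar>\<xi> i w\<bar> \<le> B))"
  using grid_mono grid_range by (auto simp: predictable_step_def image_subset_iff intro!: mono_onI)

definition grid_integrand :: "nat \<Rightarrow> (real \<times> 'a \<Rightarrow> real) \<Rightarrow> ('a \<Rightarrow> real) \<Rightarrow> bool" where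
  "grid_integrand n f I \<longleftrightarrow>
     (\<exists>\<xi>. is_step n (grid n) \<xi> \<and> f = step_fun n (grid n) \<xi> \<and> I = step_int n (grid n) \<xi>)"

lemma grid_integrand_simple: "grid_integrand n f I \<Longrightarrow> simple_integrand f I"
  unfolding grid_integrand_def simple_integrand_def by blast

lemma grid_integrand_0: "grid_integrand n (\<lambda>_. 0) (\<lambda>_. 0)"
  unfolding grid_integrand_def
  by (intro exI[of _ "\<lambda>_ _. 0"]) (auto simp: is_step_grid_iff step_process_def step_integral_def fun_eq_iff)

lemma grid_integrand_lincomb:
  assumes "grid_integrand n f I" "grid_integrand n g J"
  shows "grid_integrand n (\<lambda>z. a * f z + b * g z) (\<lambda>w. a * I w + b * J w)"
proof -
  obtain \<xi> \<eta> where s: "is_step n (grid n) \<xi>" "is_step n (grid n) \<eta>"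
    and eq: "f = step_fun n (grid n) \<xi>" "I = step_int n (grid n) \<xi>" "g = step_fun n (grid n) \<eta>" "J = step_int n (grid n) \<eta>"
    using assms unfolding grid_integrand_def by blast
  let ?\<zeta> = "\<lambda>i w. a * \<xi> i w + b * \<eta> i w"
  have "is_step n (grid n) ?\<zeta>"
    unfolding is_step_grid_iff
  proof (intro allI impI conjI)
    fix i assume i: "i < n"
    have [measurable]: "\<xi> i \<in> borel_measurable (\<F> (grid n i))" "\<eta> i \<in> borel_measurable (\<F> (grid n i))"
      using s i by (auto simp: is_step_grid_iff)
    show "?\<zeta> i \<in> borel_measurable (\<F> (grid n i))" by measurable
    obtain B B' where B: "\<forall>w\<in>space M. \<bar>\<xi> i w\<bar> \<le> B" "\<forall>w\<in>space M. \<bar>\<eta> i w\<bar> \<le> B'"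
      using s i unfolding is_step_grid_iff by blast
    have "\<bar>?\<zeta> i w\<bar> \<le> \<bar>a\<bar> * B + \<bar>b\<bar> * B'" if "w \<in> space M" for w
      using that B by (intro abs_lincomb_le) auto
    then show "\<exists>B. \<forall>w\<in>space M. \<bar>?\<zeta> i w\<bar> \<le> B" by blast
  qed
  moreover have "(\<lambda>z. a * f z + b * g z) = step_fun n (grid n) ?\<zeta>" "(\<lambda>w. a * I w + b * J w) = step_int n (grid n) ?\<zeta>"
    unfolding eq fun_eq_iff step_process_def step_integral_def case_prod_unfold sum_distrib_left sum.distrib[symmetric]
    by (intro allI sum.cong refl; simp add: algebra_simps)+
  ultimately show ?thesis unfolding grid_integrand_def by blast
qed

text \<open>
  One approximation for every grid size, so that approximations of two functions can be added on the
  same grid.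
\<close>

definition approximable :: "(real \<times> 'a \<Rightarrow> real) \<Rightarrow> bool" where
  "approximable f \<longleftrightarrow> (\<exists>g I. (\<forall>n. grid_integrand n (g n) (I n)) \<and> L2_lim dtP g f)"

lemma approximable_cong:
  assumes "AE z in dtP. f z = g z" "approximable f"
  shows "approximable g"
proof -
  have "msq dtP (\<lambda>z. h z - f z) = msq dtP (\<lambda>z. h z - g z)" for h
    by (rule msq_cong_AE) (use assms(1) in auto)
  then show ?thesis using assms(2) unfolding approximable_def by simp
qed

lemma approximable_lincomb:
  assumes f: "f \<in> borel_measurable dtP" "approximable f"
    and g: "g \<in> borel_measurable dtP" "approximable g"
  shows "approximable (\<lambda>z. a * f z + b * g z)"
proof -
  obtain f' I where F: "\<And>n. grid_integrand n (f' n) (I n)" "L2_lim dtP f' f"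
    using f(2) unfolding approximable_def by blast
  obtain g' J where G: "\<And>n. grid_integrand n (g' n) (J n)" "L2_lim dtP g' g"
    using g(2) unfolding approximable_def by blast
  note m = simple_measurable(1)[OF grid_integrand_simple]
  show ?thesis unfolding approximable_def
    by (intro exI conjI allI, rule grid_integrand_lincomb[OF F(1) G(1)],
        rule msq_lim_lincomb[OF m[OF F(1)] m[OF G(1)] f(1) g(1) F(2) G(2)])
qed

text \<open>
  A function close to \<open>f\<close> has good grid approximations from some grid size on;
  \<open>diagonal_choice\<close> combines these for all error bounds.
\<close>

lemma approximable_limit:
  assumes F: "\<And>i. approximable (F i)" "\<And>i. F i \<in> borel_measurable dtP"
    and f: "f \<in> borel_measurable dtP" and lim: "L2_lim dtP F f"
  shows "approximable f"
proof -
  have "\<forall>\<^sub>F n in sequentially. \<exists>x. grid_integrand n (fst x) (snd x) \<and> msq dtP (\<lambda>z. fst x z - f z) \<le> ennreal e"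
    if e: "0 < e" for e
  proof -
    have e4: "0 < ennreal (e / 4)" using e by simp
    obtain i where i: "msq dtP (\<lambda>z. F i z - f z) < ennreal (e / 4)"
      using order_tendstoD(2)[OF lim e4] by (auto simp: eventually_sequentially)
    obtain g I where g: "\<And>n. grid_integrand n (g n) (I n)" "L2_lim dtP g (F i)"
      using F(1)[of i] unfolding approximable_def by blast
    have "\<forall>\<^sub>F n in sequentially. msq dtP (\<lambda>z. g n z - F i z) < ennreal (e / 4)"
      by (rule order_tendstoD(2)[OF g(2) e4])
    then show ?thesis
    proof eventually_elim
      case (elim n)
      have "msq dtP (\<lambda>z. g n z - f z) \<le> 2 * msq dtP (\<lambda>z. g n z - F i z) + 2 * msq dtP (\<lambda>z. F i z - f z)"
        by (rule msq_triangle[OF simple_measurable(1)[OF grid_integrand_simple[OF g(1)]] F(2) f])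
      also have "\<dots> \<le> 2 * ennreal (e / 4) + 2 * ennreal (e / 4)"
        by (intro add_mono mult_left_mono less_imp_le[OF elim] less_imp_le[OF i]) auto
      also have "\<dots> = ennreal e" using e by (simp flip: ennreal_numeral ennreal_mult' ennreal_plus)
      finally show ?case using g(1) by (intro exI[of _ "(g n, I n)"]) simp
    qed
  qed
  moreover have "\<exists>x. grid_integrand n (fst x) (snd x)" for n
    using grid_integrand_0 by (intro exI[of _ "(\<lambda>_. 0, \<lambda>_. 0)"]) simp
  ultimately obtain x where "\<And>n. grid_integrand n (fst (x n)) (snd (x n))" "(\<lambda>n. msq dtP (\<lambda>z. fst (x n) z - f z)) \<longlonglongrightarrow> 0"
    using diagonal_choice[of "\<lambda>n x. grid_integrand n (fst x) (snd x)" "\<lambda>n x. msq dtP (\<lambda>z. fst x z - f z)"] by blast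
  then show ?thesis unfolding approximable_def
    by (intro exI[of _ "\<lambda>n. fst (x n)"] exI[of _ "\<lambda>n. snd (x n)"]) simp
qed

lemma grid_cell:
  assumes r: "0 < r" "r \<le> T" and n: "0 < n"
  obtains i where "i < n" "grid n i < r" "r \<le> grid n (Suc i)"
    "\<And>f. (\<Sum>j<n. f j * indicator {grid n j<..grid n (Suc j)} r) = (f i :: real)"
proof -
  have T: "0 < T" using r by simp
  define k where "k = \<lceil>r * real n / T\<rceil>"
  have k1: "0 < k" unfolding k_def using r n T by simp
  define i where "i = nat (k - 1)"
  have ik: "of_int k = real i + 1" using k1 by (simp add: i_def)
  have x: "of_int k - 1 < r * real n / T" "r * real n / T \<le> of_int k"
    unfolding k_def by linarith+
  have "r * real n / T \<le> real n" using mult_right_mono[OF r(2), of "real n"] T by (simp add: field_simps)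
  then have "k \<le> int n" unfolding k_def by (simp add: ceiling_le)
  then have i: "i < n" using k1 by (simp add: i_def)
  have g: "grid n i < r" "r \<le> grid n (Suc i)"
    using x[unfolded ik] T n by (auto simp: grid_def field_simps)
  have "(\<Sum>j<n. f j * indicator {grid n j<..grid n (Suc j)} r) = (f i :: real)" for f
  proof -
    have "(\<Sum>j<n. f j * indicator {grid n j<..grid n (Suc j)} r) = (\<Sum>j<n. if j = i then f i else 0)"
    proof (rule sum.cong[OF refl])
      fix j
      consider "j < i" | "j = i" | "j > i" by linarith
      then show "f j * indicator {grid n j<..grid n (Suc j)} r = (if j = i then f i else 0)"
      proof cases
        case 1
        then have "grid n (Suc j) \<le> grid n i" by (intro grid_mono) auto
        then show ?thesis using 1 g by auto
      next
        case 3
        then have "grid n (Suc i) \<le> grid n j" by (intro grid_mono) auto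
        then show ?thesis using 3 g by auto
      qed (use g in auto)
    qed
    then show ?thesis using i by simp
  qed
  then show thesis using that i g by blast
qed

lemma predictable_rectangle:
  assumes "0 \<le> s" "s < t" "t \<le> T" "A \<in> sets (\<F> s)"
  shows "{s<..t} \<times> A \<in> sets dtP"
  unfolding sets_dtP sets_predictable using assms by (intro sigma_sets.Basic) auto

text \<open>
  The approximation is \<open>A\<close> on the grid cells whose left end point lies in
  \<open>[s,t)\<close>. This is adapted, since \<open>A\<close> is known from \<open>s\<close> on.
  It agrees with the rectangle at every time whose distance from \<open>s\<close> and from
  \<open>t\<close> is zero or more than one cell.
\<close>

lemma approximable_rectangle:
  assumes st: "0 \<le> s" "s < t" "t \<le> T" and A: "A \<in> sets (\<F> s)"
  shows "approximable (indicator ({s<..t} \<times> A))"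
proof -
  define \<xi> where "\<xi> n i = (if s \<le> grid n i \<and> grid n i < t then indicator A else (\<lambda>_. 0 :: real))" for n i
  define S where "S n = step_fun n (grid n) (\<xi> n)" for n
  have step: "is_step n (grid n) (\<xi> n)" for n
    unfolding is_step_grid_iff
  proof (intro allI impI conjI)
    fix i
    have "A \<in> sets (\<F> (grid n i))" if "s \<le> grid n i" using sets_augmented_mono[OF that] A by auto
    then show "\<xi> n i \<in> borel_measurable (\<F> (grid n i))" by (auto simp: \<xi>_def)
    show "\<exists>B. \<forall>w\<in>space M. \<bar>\<xi> n i w\<bar> \<le> B" by (intro exI[of _ 1]) (auto simp: \<xi>_def indicator_def)
  qed
  then have grid: "grid_integrand n (S n) (step_int n (grid n) (\<xi> n))" for n
    unfolding grid_integrand_def S_def by blast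
  note Sm = simple_measurable(1)[OF grid_integrand_simple[OF grid]]
  have val: "S n (r, w) \<in> {0, 1} \<and> ((r \<noteq> s \<longrightarrow> T / real n < \<bar>r - s\<bar>) \<longrightarrow> (r \<noteq> t \<longrightarrow> T / real n < \<bar>r - t\<bar>) \<longrightarrow>
      S n (r, w) = indicator ({s<..t} \<times> A) (r, w))"
    if r: "0 \<le> r" "r \<le> T" and n: "0 < n" for r w n
  proof (cases "r = 0")
    case True
    have "grid n i \<ge> 0" if "i < n" for i using grid_range[of i n] that by auto
    then have "S n (r, w) = 0"
      using True by (auto simp: S_def step_process_def intro!: sum.neutral) (metis linorder_not_le)
    then show ?thesis using True st by auto
  next
    case False
    then have "0 < r" using r by simp
    then obtain i where i: "grid n i < r" "r \<le> grid n (Suc i)"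
      "\<And>f. (\<Sum>j<n. f j * indicator {grid n j<..grid n (Suc j)} r) = (f i :: real)"
      using grid_cell[OF _ r(2) n] by blast
    have v: "S n (r, w) = \<xi> n i w"
      using i(3)[of "\<lambda>j. \<xi> n j w"] by (simp add: S_def step_process_def)
    have "grid n (Suc i) = grid n i + T / real n"
      by (simp add: grid_def add_divide_distrib algebra_simps)
    then show ?thesis unfolding v using i(1,2) st by (auto simp: \<xi>_def indicator_def)
  qed
  have "L2_lim dtP S (indicator ({s<..t} \<times> A))"
  proof (rule LIMSEQ_imp_Suc, rule msq_dominated[where w="\<lambda>_. 1"])
    show "msq dtP (\<lambda>_. 1) < top" by (rule msq_const_finite[OF finite_measure_dtP])
    show "AE z in dtP. \<bar>S (Suc n) z\<bar> \<le> 1" for n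
    proof (intro AE_I2)
      fix z assume "z \<in> space dtP"
      then show "\<bar>S (Suc n) z\<bar> \<le> 1" using val[of "fst z" "Suc n" "snd z"] by (cases z) auto
    qed
    show "AE z in dtP. (\<lambda>n. S (Suc n) z) \<longlonglongrightarrow> indicator ({s<..t} \<times> A) z"
    proof (intro AE_I2)
      fix z assume "z \<in> space dtP"
      then obtain r w where z: "z = (r, w)" and r: "0 \<le> r" "r \<le> T" by auto
      have small: "\<forall>\<^sub>F n in sequentially. T / real (Suc n) < d" if "0 < d" for d
        by (rule order_tendstoD(2)[OF LIMSEQ_Suc[OF lim_const_over_n] that])
      have "\<forall>\<^sub>F n in sequentially. r \<noteq> s \<longrightarrow> T / real (Suc n) < \<bar>r - s\<bar>"
        "\<forall>\<^sub>F n in sequentially. r \<noteq> t \<longrightarrow> T / real (Suc n) < \<bar>r - t\<bar>"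
        using small[of "\<bar>r - s\<bar>"] small[of "\<bar>r - t\<bar>"] by (cases "r = s"; cases "r = t"; simp)+
      then have "\<forall>\<^sub>F n in sequentially. S (Suc n) z = indicator ({s<..t} \<times> A) z"
        by eventually_elim (use val[OF r, of "Suc _" w] in \<open>simp add: z\<close>)
      then show "(\<lambda>n. S (Suc n) z) \<longlonglongrightarrow> indicator ({s<..t} \<times> A) z" by (rule tendsto_eventually)
    qed
  qed (use predictable_rectangle[OF st A] Sm in auto)
  then show ?thesis unfolding approximable_def using grid
    by (intro exI[of _ S] exI[of _ "\<lambda>n. step_int n (grid n) (\<xi> n)"]) simp
qed

lemma approximable_0: "approximable (\<lambda>_. 0)"
  unfolding approximable_def using grid_integrand_0
  by (intro exI[of _ "\<lambda>_ _. 0"] conjI) (auto simp: msq_def)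

lemma time_zero_null:
  assumes "A \<in> sets (\<F> 0)"
  shows "{0} \<times> A \<in> null_sets dtP"
proof -
  have "{0} \<times> A \<in> sets predictable"
    unfolding sets_predictable using assms by (intro sigma_sets.Basic) auto
  then have "emeasure dtP ({0} \<times> A) = emeasure (dt \<Otimes>\<^sub>M M) ({0} \<times> A)"
    unfolding dtP_def by (rule emeasure_restr_to_subalg[OF subalgebra_predictable])
  also have "\<dots> = 0"
    using subsetD[OF sets_augmented_subset assms] horizon
    by (subst emeasure_pair_measure_Times) (auto simp: sets_restrict_space_iff emeasure_restrict_space)
  finally show ?thesis using \<open>{0} \<times> A \<in> sets predictable\<close> sets_dtP by auto
qed

text \<open>
  The part of a predictable set at time zero is invisible to \<open>dt\<close>.
\<close>

lemma approximable_time_zero: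
  assumes "A \<in> sets (\<F> 0)"
  shows "approximable (indicator ({0} \<times> A))"
  by (rule approximable_cong[OF _ approximable_0])
    (use AE_not_in[OF time_zero_null[OF assms]] in \<open>auto elim: eventually_mono\<close>)

lemma Int_stable_predictable_generators:
  "Int_stable predictable_rectangles" (is "Int_stable ?G")
proof (rule Int_stableI)
  have empty: "{} \<in> ?G" by (intro UnI1 CollectI exI[of _ "{}"]) auto
  fix a b assume "a \<in> ?G" "b \<in> ?G"
  then show "a \<inter> b \<in> ?G"
  proof (elim UnE CollectE exE conjE)
    fix A B assume "a = {0} \<times> A" "A \<in> sets (\<F> 0)" "b = {0} \<times> B" "B \<in> sets (\<F> 0)"
    then show ?thesis by (intro UnI1 CollectI exI[of _ "A \<inter> B"]) auto
  next
    fix A s t B assume "a = {0} \<times> A" "b = {s<..t} \<times> B" "0 \<le> s"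
    then have "a \<inter> b = {}" by auto
    then show ?thesis using empty by simp
  next
    fix A s t B assume "a = {s<..t} \<times> B" "b = {0} \<times> A" "0 \<le> s"
    then have "a \<inter> b = {}" by auto
    then show ?thesis using empty by simp
  next
    fix s t A s' t' A'
    assume r: "a = {s<..t} \<times> A" "b = {s'<..t'} \<times> A'" "0 \<le> s" "t \<le> T" "0 \<le> s'"
      "A \<in> sets (\<F> s)" "A' \<in> sets (\<F> s')"
    have eq: "a \<inter> b = {max s s'<..min t t'} \<times> (A \<inter> A')" using r by auto
    have AA: "A \<inter> A' \<in> sets (\<F> (max s s'))"
      using r sets_augmented_mono[of s "max s s'"] sets_augmented_mono[of s' "max s s'"] by auto
    show ?thesis
    proof (cases "max s s' < min t t'")
      case True
      then show ?thesis unfolding eq using r AA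
        by (intro UnI2 CollectI exI[of _ "max s s'"] exI[of _ "min t t'"] exI[of _ "A \<inter> A'"]) auto
    next
      case False
      then have "a \<inter> b = {}" unfolding eq by auto
      then show ?thesis using empty by simp
    qed
  qed
qed

lemma approximable_indicator:
  assumes "A \<in> sets dtP"
  shows "approximable (indicator A)"
proof -
  have sets_Q: "sets dtP = sigma_sets ({0..T} \<times> space M)
     predictable_rectangles"
    by (simp add: sets_dtP sets_predictable)
  have sp: "space M \<in> sets (\<F> s)" for s using sets.top[of "\<F> s"] by simp
  have none: "approximable (indicator {})"
    by (rule approximable_cong[OF _ approximable_0]) simp
  have late: "{0<..T} \<times> space M \<in> sets dtP" "approximable (indicator ({0<..T} \<times> space M))"
    using predictable_rectangle[of 0 T] approximable_rectangle[of 0 T] sp[of 0] horizon none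
    by (cases "T = 0"; simp)+
  have "approximable (\<lambda>z. 1 * indicator ({0} \<times> space M) z + 1 * indicator ({0<..T} \<times> space M) z)"
    by (rule approximable_lincomb)
      (use late time_zero_null[OF sp] approximable_time_zero[OF sp] in auto)
  then have whole: "approximable (indicator ({0..T} \<times> space M))"
    by (rule approximable_cong[rotated]) (use horizon in \<open>auto simp: indicator_def\<close>)
  show ?thesis
    using Int_stable_predictable_generators predictable_generators assms[unfolded sets_Q]
  proof (induct rule: sigma_sets_induct_disjoint)
    case (basic A)
    then show ?case using approximable_rectangle approximable_time_zero by auto
  next
    case empty
    then show ?case by (rule none)
  next
    case (compl A)
    then have A: "A \<in> sets dtP" by (simp add: sets_Q)
    have "approximable (\<lambda>z. 1 * indicator ({0..T} \<times> space M) z + (-1) * indicator A z)"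
      by (rule approximable_lincomb) (use whole compl A sets.top[of dtP] in auto)
    then show ?case
      by (rule approximable_cong[rotated]) (use sets.sets_into_space[OF A] in \<open>auto simp: indicator_def\<close>)
  next
    case (union A)
    then have A: "A i \<in> sets dtP" for i by (auto simp: sets_Q)
    have disj: "(\<Sum>i<n. indicator (A i) z) = indicat_real (\<Union>i<n. A i) z" for n z
      using union(1) by (subst indicator_UN_disjoint) (auto simp: disjoint_family_on_def)
    have sums: "approximable (\<lambda>z. \<Sum>i<n. indicator (A i) z)" for n
    proof (induct n)
      case (Suc n)
      have "approximable (\<lambda>z. 1 * (\<Sum>i<n. indicator (A i) z) + 1 * indicator (A n) z)"
        by (rule approximable_lincomb) (use A Suc union(3) in auto)
      then show ?case by simp
    qed (simp add: approximable_0)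
    show ?case
    proof (rule approximable_limit[OF sums])
      show "L2_lim dtP (\<lambda>n z. \<Sum>i<n. indicator (A i) z) (indicator (\<Union>i. A i))"
        unfolding disj
      proof (rule msq_dominated[where w="\<lambda>_. 1"])
        show "msq dtP (\<lambda>_. 1) < top" by (rule msq_const_finite[OF finite_measure_dtP])
        show "AE z in dtP. (\<lambda>n. indicat_real (\<Union>i<n. A i) z) \<longlonglongrightarrow> indicator (\<Union>i. A i) z"
          by (intro AE_I2 LIMSEQ_indicator_UN)
      qed (use A in \<open>auto simp: indicator_def\<close>)
    qed (use A in auto)
  qed
qed

lemma energy_space_approximable:
  assumes "u \<in> \<H>"
  shows "approximable (case_prod u)"
proof -
  have "case_prod u \<in> borel_measurable dtP" "msq dtP (case_prod u) < top"
    using assms by (simp_all add: energy_space_iff)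
  then have "case_prod u \<in> borel_measurable dtP \<and> approximable (case_prod u)"
    by (rule L2_induct) (auto intro: approximable_indicator approximable_lincomb approximable_limit)
  then show ?thesis by simp
qed

section \<open>The stochastic integral\<close>

lemma has_stochastic_integral_iff:
  "integral_of u X \<longleftrightarrow> u \<in> \<H> \<and> X \<in> L2_space M \<and>
     (\<exists>f I. (\<forall>k. simple_integrand (f k) (I k)) \<and> L2_lim dtP f (case_prod u) \<and> L2_lim M I X)" (is "_ \<longleftrightarrow> ?R")
proof (cases "u \<in> \<H>")
  case True
  have lim: "((\<lambda>k. energy_sqnorm M T lam (\<lambda>t w. step_process (n k) (\<tau> k) (\<xi> k) t w - u t w)) \<longlonglongrightarrow> 0) \<longleftrightarrow>
     L2_lim dtP (\<lambda>k. step_fun (n k) (\<tau> k) (\<xi> k)) (case_prod u)"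
    if s: "\<forall>k. is_step (n k) (\<tau> k) (\<xi> k)" for n :: "nat \<Rightarrow> nat" and \<tau> \<xi>
  proof -
    have "energy_sqnorm M T lam (\<lambda>t w. step_process (n k) (\<tau> k) (\<xi> k) t w - u t w) =
        ennreal lam * msq dtP (\<lambda>z. step_fun (n k) (\<tau> k) (\<xi> k) z - case_prod u z)" for k
    proof -
      have eq: "(\<lambda>(t, w). step_process (n k) (\<tau> k) (\<xi> k) t w - u t w) =
          (\<lambda>z. step_fun (n k) (\<tau> k) (\<xi> k) z - case_prod u z)" by (auto simp: fun_eq_iff)
      have "simple_integrand (step_fun (n k) (\<tau> k) (\<xi> k)) (step_int (n k) (\<tau> k) (\<xi> k))"
        unfolding simple_integrand_def using s by blast
      from simple_measurable(1)[OF this]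
      have "(\<lambda>z. step_fun (n k) (\<tau> k) (\<xi> k) z - case_prod u z) \<in> borel_measurable dtP"
        using True by (intro borel_measurable_diff) (auto simp: energy_space_iff)
      then show ?thesis by (subst energy_sqnorm_eq) (simp_all only: eq)
    qed
    then show ?thesis using ennreal_cmult_tendsto_0_iff[OF intensity] by simp
  qed
  show ?thesis
  proof
    assume "integral_of u X"
    then obtain n \<tau> \<xi> where X: "X \<in> L2_space M" and s: "\<forall>k. is_step (n k) (\<tau> k) (\<xi> k)"
      and 1: "(\<lambda>k. energy_sqnorm M T lam (\<lambda>t w. step_process (n k) (\<tau> k) (\<xi> k) t w - u t w)) \<longlonglongrightarrow> 0"
      and 2: "L2_lim M (\<lambda>k. step_int (n k) (\<tau> k) (\<xi> k)) X"
      unfolding has_stochastic_integral_def msq_def[of M] by blast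
    have "simple_integrand (step_fun (n k) (\<tau> k) (\<xi> k)) (step_int (n k) (\<tau> k) (\<xi> k))" for k
      unfolding simple_integrand_def using s by blast
    then show ?R
      using True X 2 1[unfolded lim[OF s]]
      by (intro conjI exI[of _ "\<lambda>k. step_fun (n k) (\<tau> k) (\<xi> k)"] exI[of _ "\<lambda>k. step_int (n k) (\<tau> k) (\<xi> k)"] allI)
  next
    assume *: ?R
    then obtain f I where X: "X \<in> L2_space M" and fI: "\<And>k. simple_integrand (f k) (I k)"
      and l: "L2_lim dtP f (case_prod u)" "L2_lim M I X" by blast
    obtain n \<tau> \<xi> where s: "\<forall>k. is_step (n k) (\<tau> k) (\<xi> k)"
      and eq: "\<And>k. f k = step_fun (n k) (\<tau> k) (\<xi> k)" "\<And>k. I k = step_int (n k) (\<tau> k) (\<xi> k)"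
      using fI unfolding simple_integrand_def by metis
    show "integral_of u X"
      unfolding has_stochastic_integral_def
      using True X s l(1)[unfolded eq, folded lim[OF s]] l(2)[unfolded eq, unfolded msq_def]
      by (intro conjI exI[of _ n] exI[of _ \<tau>] exI[of _ \<xi>])
  qed
qed (simp add: has_stochastic_integral_def)

lemma integral_ofD:
  assumes "integral_of u X"
  shows "case_prod u \<in> borel_measurable dtP" "msq dtP (case_prod u) < top"
    "X \<in> borel_measurable M" "msq M X < top"
  using assms by (auto simp: has_stochastic_integral_iff energy_space_iff L2_space_iff)

lemma integral_of_simple:
  assumes "integral_of u X"
  obtains f I where "\<And>k. simple_integrand (f k) (I k)" "L2_lim dtP f (case_prod u)" "L2_lim M I X"
  using assms by (auto simp: has_stochastic_integral_iff)

lemma simple_integral_of: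
  assumes "simple_integrand f I"
  shows "integral_of (curry f) I"
  unfolding has_stochastic_integral_iff energy_space_iff L2_space_iff
  using simple_measurable[OF assms] simple_msq_finite[OF assms] assms
  by (intro conjI exI[of _ "\<lambda>_. f"] exI[of _ "\<lambda>_. I"]) (auto simp: msq_def)

text \<open>
  Both mean squares are limits of those of approximating steps, for which the identity is
  \<open>simple_isometry\<close>.
\<close>

lemma integral_isometry:
  assumes X: "integral_of u X" and Y: "integral_of v Y"
  shows "msq M (\<lambda>w. X w - Y w) = ennreal lam * msq dtP (\<lambda>z. case_prod u z - case_prod v z)"
proof -
  obtain f I where f: "\<And>k. simple_integrand (f k) (I k)" "L2_lim dtP f (case_prod u)" "L2_lim M I X"
    by (rule integral_of_simple[OF X]) (rule that)
  obtain g J where g: "\<And>k. simple_integrand (g k) (J k)" "L2_lim dtP g (case_prod v)" "L2_lim M J Y"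
    by (rule integral_of_simple[OF Y]) (rule that)
  have *: "(\<lambda>k. msq Q (\<lambda>x. h k x - h' k x)) \<longlonglongrightarrow> msq Q (\<lambda>x. l x - l' x)"
    if m: "\<And>k. h k \<in> borel_measurable Q" "\<And>k. h' k \<in> borel_measurable Q" "l \<in> borel_measurable Q" "l' \<in> borel_measurable Q"
      and fin: "msq Q l < top" "msq Q l' < top" and lim: "L2_lim Q h l" "L2_lim Q h' l'" for Q :: "'x measure" and h h' l l'
    using msq_lim_lincomb[OF m lim, of 1 "-1"]
    by (intro msq_tendsto msq_diff_finite borel_measurable_diff m fin) (simp_all add: algebra_simps)
  note mf = simple_measurable[OF f(1)] and mg = simple_measurable[OF g(1)]
  note mX = integral_ofD[OF X] and mY = integral_ofD[OF Y]
  have 1: "(\<lambda>k. msq M (\<lambda>w. I k w - J k w)) \<longlonglongrightarrow> msq M (\<lambda>w. X w - Y w)"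
    by (rule *[OF mf(2) mg(2) mX(3) mY(3) mX(4) mY(4) f(3) g(3)])
  have "(\<lambda>k. msq dtP (\<lambda>z. f k z - g k z)) \<longlonglongrightarrow> msq dtP (\<lambda>z. case_prod u z - case_prod v z)"
    by (rule *[OF mf(1) mg(1) mX(1) mY(1) mX(2) mY(2) f(2) g(2)])
  then have "(\<lambda>k. ennreal lam * msq dtP (\<lambda>z. f k z - g k z)) \<longlonglongrightarrow> ennreal lam * msq dtP (\<lambda>z. case_prod u z - case_prod v z)"
    by (intro ennreal_tendsto_cmult) auto
  then show ?thesis
    using 1 unfolding simple_isometry[OF f(1) g(1), symmetric] by (rule LIMSEQ_unique[rotated])
qed

lemma integral_lim_iff:
  assumes "\<And>k. integral_of (u k) (X k)" "integral_of v Y"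
  shows "L2_lim dtP (\<lambda>k. case_prod (u k)) (case_prod v) \<longleftrightarrow> L2_lim M X Y"
  unfolding integral_isometry[OF assms] by (rule ennreal_cmult_tendsto_0_iff[OF intensity, symmetric])

text \<open>
  Replace each \<open>u k\<close> by a step process that is close to it both as an integrand and in
  its integral.
\<close>

lemma integral_closed:
  assumes I: "\<And>k. integral_of (u k) (X k)"
    and v: "v \<in> \<H>" and Y: "Y \<in> L2_space M"
    and lim: "L2_lim dtP (\<lambda>k. case_prod (u k)) (case_prod v)" "L2_lim M X Y"
  shows "integral_of v Y"
proof -
  let ?P = "\<lambda>x. simple_integrand (fst x) (snd x)"
  let ?d = "\<lambda>k x. msq dtP (\<lambda>z. fst x z - case_prod (u k) z) + msq M (\<lambda>w. snd x w - X k w)"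
  have "\<exists>x. ?P x \<and> ?d k x \<le> ennreal e" if e: "0 < e" for e k
  proof -
    obtain f J where f: "\<And>j. simple_integrand (f j) (J j)" "L2_lim dtP f (case_prod (u k))" "L2_lim M J (X k)"
      by (rule integral_of_simple[OF I[of k]]) (rule that)
    have "(\<lambda>j. ?d k (f j, J j)) \<longlonglongrightarrow> 0 + 0" unfolding fst_conv snd_conv by (intro tendsto_add f)
    then have "\<forall>\<^sub>F j in sequentially. ?d k (f j, J j) < ennreal e"
      by (intro order_tendstoD(2)) (use e in auto)
    then obtain j where "?d k (f j, J j) < ennreal e" by (auto simp: eventually_sequentially)
    then show ?thesis using f(1) by (intro exI[of _ "(f j, J j)"]) (auto intro: less_imp_le)
  qed
  moreover have "\<exists>x. ?P x"
    using grid_integrand_simple[OF grid_integrand_0] by (intro exI[of _ "(\<lambda>_. 0, \<lambda>_. 0)"]) simp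
  ultimately obtain x where x: "\<And>k. ?P (x k)" "(\<lambda>k. ?d k (x k)) \<longlonglongrightarrow> 0"
    using diagonal_choice[of "\<lambda>_. ?P" ?d] by (auto simp: always_eventually)
  note xm = simple_measurable[OF x(1)] and um = integral_ofD[OF I]
  have vm: "case_prod v \<in> borel_measurable dtP" and Ym: "Y \<in> borel_measurable M"
    using v Y by (auto simp: energy_space_iff L2_space_iff)
  have "L2_lim dtP (\<lambda>k. fst (x k)) (case_prod v)"
    by (rule msq_lim_triangle[OF xm(1) um(1) vm _ lim(1)], rule ennreal_tendsto_0_le[OF x(2)]) simp
  moreover have "L2_lim M (\<lambda>k. snd (x k)) Y"
    by (rule msq_lim_triangle[OF xm(2) um(3) Ym _ lim(2)], rule ennreal_tendsto_0_le[OF x(2)]) simp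
  ultimately show ?thesis
    unfolding has_stochastic_integral_iff using v Y x(1)
    by (intro conjI exI[of _ "\<lambda>k. fst (x k)"] exI[of _ "\<lambda>k. snd (x k)"] allI)
qed

lemma integral_exists:
  assumes u: "u \<in> \<H>"
  obtains X where "integral_of u X"
proof -
  obtain f I where f: "\<And>n. grid_integrand n (f n) (I n)" "L2_lim dtP f (case_prod u)"
    using energy_space_approximable[OF u] unfolding approximable_def by blast
  note s = grid_integrand_simple[OF f(1)]
  note m = simple_measurable[OF s] and fin = simple_msq_finite[OF s]
  have um: "case_prod u \<in> borel_measurable dtP" using u by (simp add: energy_space_iff)
  have "L2_Cauchy M I"
    using L2_lim_Cauchy[OF m(1) um f(2)] L2_Cauchy_isometry[OF intensity simple_isometry[OF s s]] by simp
  then obtain X where X: "X \<in> borel_measurable M" "L2_lim M I X"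
    using msq_complete[where f=I, OF m(2)] by blast
  have "msq M X < top" by (rule msq_limit_finite[OF m(2) fin(2) X])
  then have "integral_of u X"
    unfolding has_stochastic_integral_iff L2_space_iff using u X s f(2) by blast
  then show thesis by (rule that)
qed

text \<open>
  The approximations provided with \<open>X\<close> and \<open>Y\<close> may live on unrelated
  partitions. By the isometry any approximation of the integrands can be used instead, in particular
  two on the same grids, which can be added.
\<close>

lemma integral_lincomb:
  assumes X: "integral_of u X" and Y: "integral_of v Y"
  shows "integral_of (\<lambda>t w. a * u t w + b * v t w) (\<lambda>w. a * X w + b * Y w)"
proof -
  have uv: "u \<in> \<H>" "v \<in> \<H>"
    using X Y by (auto simp: has_stochastic_integral_def)
  obtain f I where f: "\<And>n. grid_integrand n (f n) (I n)" "L2_lim dtP f (case_prod u)"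
    using energy_space_approximable[OF uv(1)] unfolding approximable_def by blast
  obtain g J where g: "\<And>n. grid_integrand n (g n) (J n)" "L2_lim dtP g (case_prod v)"
    using energy_space_approximable[OF uv(2)] unfolding approximable_def by blast
  note sf = grid_integrand_simple[OF f(1)] and sg = grid_integrand_simple[OF g(1)]
  note mf = simple_measurable[OF sf] and mg = simple_measurable[OF sg]
  note m = integral_ofD[OF X] integral_ofD[OF Y]
  have lim: "L2_lim M I X" "L2_lim M J Y"
    using integral_lim_iff[OF simple_integral_of[OF sf] X] integral_lim_iff[OF simple_integral_of[OF sg] Y] f(2) g(2)
    by simp_all
  have "L2_lim dtP (\<lambda>k z. a * f k z + b * g k z) (\<lambda>z. a * case_prod u z + b * case_prod v z)"
    by (rule msq_lim_lincomb[OF mf(1) mg(1) m(1,5) f(2) g(2)])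
  moreover have "L2_lim M (\<lambda>k w. a * I k w + b * J k w) (\<lambda>w. a * X w + b * Y w)"
    by (rule msq_lim_lincomb[OF mf(2) mg(2) m(3,7) lim])
  moreover have eq: "(\<lambda>(t, w). a * u t w + b * v t w) = (\<lambda>z. a * case_prod u z + b * case_prod v z)"
    by (auto simp: fun_eq_iff)
  moreover have "(\<lambda>t w. a * u t w + b * v t w) \<in> \<H>"
    unfolding energy_space_iff eq
    by (intro conjI msq_add_finite msq_cmult_finite borel_measurable_add borel_measurable_times borel_measurable_const m)
  moreover have "(\<lambda>w. a * X w + b * Y w) \<in> L2_space M"
    unfolding L2_space_iff
    by (intro conjI msq_add_finite msq_cmult_finite borel_measurable_add borel_measurable_times borel_measurable_const m)
  ultimately show ?thesis
    unfolding has_stochastic_integral_iff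
    using grid_integrand_simple[OF grid_integrand_lincomb[OF f(1) g(1), of _ a b]]
    by (intro conjI exI[of _ "\<lambda>k z. a * f k z + b * g k z"] exI[of _ "\<lambda>k w. a * I k w + b * J k w"]) (simp_all only: eq, simp_all)
qed

lemma square_integrable_integrable:
  fixes X :: "'a \<Rightarrow> real"
  assumes "X \<in> borel_measurable M" "msq M X < top"
  shows "integrable M X"
  using integrable_mult_square[OF assms(1), of "\<lambda>_. 1"] assms by (simp add: msq_finite_iff)

lemma expectation_square_le:
  fixes X :: "'a \<Rightarrow> real"
  assumes "X \<in> borel_measurable M" "msq M X < top"
  shows "ennreal ((expectation X)^2) \<le> msq M X"
proof -
  have i: "integrable M (\<lambda>w. (X w)^2)" using assms by (simp add: msq_finite_iff)
  have "0 \<le> expectation (\<lambda>w. (X w)^2) - (expectation X)^2"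
    using variance_eq[OF square_integrable_integrable[OF assms] i] variance_positive[of X] by simp
  then show ?thesis by (simp add: msq_eq_integral[OF i])
qed

lemma integral_zero: "integral_of (\<lambda>_ _. 0) (\<lambda>_. 0)"
  using simple_integral_of[OF grid_integrand_simple[OF grid_integrand_0]] by (simp add: curry_def)

text \<open>
  Steps have mean zero, and \<open>(E X)\<^sup>2 \<le> E (X\<^sup>2)\<close> makes the mean continuous
  in mean square.
\<close>

lemma integral_mean:
  assumes X: "integral_of u X"
  shows "expectation X = 0"
proof -
  note m = integral_ofD(3,4)[OF X]
  obtain f I where f: "\<And>k. simple_integrand (f k) (I k)" "L2_lim dtP f (case_prod u)" "L2_lim M I X"
    by (rule integral_of_simple[OF X]) (rule that)
  have "ennreal ((expectation X)^2) \<le> msq M (\<lambda>w. I k w - X w)" for k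
  proof -
    note Im = simple_measurable(2)[OF f(1), of k] simple_msq_finite(2)[OF f(1), of k]
    have "expectation (\<lambda>w. I k w - X w) = - expectation X"
      using simple_mean[OF f(1), of k] square_integrable_integrable[OF m] by (simp add: has_bochner_integral_iff)
    then show ?thesis
      using expectation_square_le[of "\<lambda>w. I k w - X w"] Im m msq_diff_finite[OF Im(1) m(1) Im(2) m(2)] by simp
  qed
  then have "ennreal ((expectation X)^2) \<le> 0"
    by (intro LIMSEQ_le_const[OF f(3)]) auto
  then show ?thesis by simp
qed

text \<open>
  Polarisation of the isometry.
\<close>

lemma integral_inner:
  assumes X: "integral_of u X" and Y: "integral_of v Y"
  shows "expectation (\<lambda>w. X w * Y w) = energy_inner M T lam u v"
proof -
  have sq: "integrable M (\<lambda>w. (Z w - Z' w)^2)" "integrable dtP (\<lambda>z. (case_prod w z - case_prod w' z)^2)"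
    "expectation (\<lambda>w. (Z w - Z' w)^2) = lam * (\<integral>z. (case_prod w z - case_prod w' z)^2 \<partial>dtP)"
    if Z: "integral_of w Z" "integral_of w' Z'" for w w' Z Z'
  proof -
    note m = integral_ofD[OF Z(1)] integral_ofD[OF Z(2)]
    show 1: "integrable M (\<lambda>w. (Z w - Z' w)^2)"
      by (subst msq_finite_iff[symmetric]) (intro msq_diff_finite borel_measurable_diff m)+
    show 2: "integrable dtP (\<lambda>z. (case_prod w z - case_prod w' z)^2)"
      by (subst msq_finite_iff[symmetric]) (intro msq_diff_finite borel_measurable_diff m)+
    show "expectation (\<lambda>w. (Z w - Z' w)^2) = lam * (\<integral>z. (case_prod w z - case_prod w' z)^2 \<partial>dtP)"
      using integral_isometry[OF Z] intensity
      unfolding msq_eq_integral[OF 1] msq_eq_integral[OF 2] by (simp add: ennreal_mult'[symmetric])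
  qed
  have z: "case_prod (\<lambda>_ _. 0) z = (0::real)" for z :: "real \<times> 'a" by (simp add: case_prod_unfold)
  note X0 = sq[OF X integral_zero, unfolded z diff_0_right]
  note Y0 = sq[OF Y integral_zero, unfolded z diff_0_right]
  note XY = sq[OF X Y]
  note m = integral_ofD[OF X] integral_ofD[OF Y]
  have iM: "integrable M (\<lambda>w. X w * Y w)" by (intro integrable_mult_square m X0 Y0)
  have iQ: "integrable dtP (\<lambda>z. case_prod u z * case_prod v z)"
    by (intro integrable_mult_square m X0 Y0)
  have e: "(a - b)^2 = a^2 + b^2 - 2 * (a * b)" for a b :: real by (simp add: power2_eq_square algebra_simps)
  have "expectation (\<lambda>w. (X w - Y w)^2) =
      expectation (\<lambda>w. (X w)^2) + expectation (\<lambda>w. (Y w)^2) - 2 * expectation (\<lambda>w. X w * Y w)"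
    unfolding e using X0(1) Y0(1) iM by simp
  moreover have "(\<integral>z. (case_prod u z - case_prod v z)^2 \<partial>dtP) =
      (\<integral>z. (case_prod u z)^2 \<partial>dtP) + (\<integral>z. (case_prod v z)^2 \<partial>dtP)
      - 2 * (\<integral>z. case_prod u z * case_prod v z \<partial>dtP)"
    unfolding e using X0(2) Y0(2) iQ by (simp del: integrable_mult_left_iff)
  ultimately have "lam * (\<integral>z. (case_prod u z)^2 \<partial>dtP) + lam * (\<integral>z. (case_prod v z)^2 \<partial>dtP)
        - 2 * expectation (\<lambda>w. X w * Y w) =
      lam * ((\<integral>z. (case_prod u z)^2 \<partial>dtP) + (\<integral>z. (case_prod v z)^2 \<partial>dtP)
        - 2 * (\<integral>z. case_prod u z * case_prod v z \<partial>dtP))"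
    using X0(3) Y0(3) XY(3) by (simp only:)
  then have "expectation (\<lambda>w. X w * Y w) = lam * (\<integral>z. case_prod u z * case_prod v z \<partial>dtP)"
    unfolding right_diff_distrib distrib_left by linarith
  moreover have "u \<in> \<H>" "v \<in> \<H>"
    using X Y by (auto simp: has_stochastic_integral_def)
  ultimately show ?thesis by (simp add: energy_inner_eq)
qed

section \<open>Martingale representation\<close>

definition representable :: "('a \<Rightarrow> real) \<Rightarrow> bool" where
  "representable F \<longleftrightarrow> F \<in> borel_measurable M \<and>
     (\<exists>c u X. integral_of u X \<and> (AE w in M. F w = c + X w))"

lemma representable_msq:
  assumes "representable F"
  shows "F \<in> borel_measurable M" "msq M F < top"
proof -
  obtain c u X where X: "integral_of u X" "AE w in M. F w = c + X w"
    using assms by (auto simp: representable_def)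
  have "msq M F = msq M (\<lambda>w. c + X w)" by (rule msq_cong_AE[OF X(2)])
  also have "\<dots> < top"
    using integral_ofD[OF X(1)] by (intro msq_add_finite msq_const_finite) (auto intro: finite_measure_axioms)
  finally show "msq M F < top" .
qed (use assms in \<open>simp add: representable_def\<close>)

lemma representable_const: "representable (\<lambda>_. c)"
  unfolding representable_def using integral_zero by force

lemma representable_lincomb:
  assumes "representable F" "representable G"
  shows "representable (\<lambda>w. a * F w + b * G w)"
proof -
  obtain c u X where X: "integral_of u X" "AE w in M. F w = c + X w"
    using assms(1) by (auto simp: representable_def)
  obtain d v Y where Y: "integral_of v Y" "AE w in M. G w = d + Y w"
    using assms(2) by (auto simp: representable_def)
  have "AE w in M. a * F w + b * G w = (a * c + b * d) + (a * X w + b * Y w)"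
    using X(2) Y(2) by eventually_elim (simp add: algebra_simps)
  moreover have "(\<lambda>w. a * F w + b * G w) \<in> borel_measurable M"
    using assms by (auto simp: representable_def)
  ultimately show ?thesis unfolding representable_def using integral_lincomb[OF X(1) Y(1), of a b] by blast
qed

text \<open>
  If \<open>F k = c k + X k\<close> converges, so does \<open>c k = E (F k)\<close>, and hence
  \<open>X k\<close>. By the isometry the integrands form a Cauchy sequence; their limit represents
  the limit of \<open>X k\<close>.
\<close>

lemma representable_limit:
  assumes F: "\<And>k. representable (F k)" and G: "G \<in> borel_measurable M" "msq M G < top"
    and lim: "L2_lim M F G"
  shows "representable G"
proof -
  note Fm = representable_msq[OF F]
  define P where "P k c u X \<longleftrightarrow> integral_of u X \<and> (AE w in M. F k w = c + X w)" for k c u X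
  have "\<exists>c u X. P k c u X" for k
    using F[of k] by (simp add: representable_def P_def)
  then obtain c u X where "\<And>k. P k (c k) (u k) (X k)" by metis
  then have X: "\<And>k. integral_of (u k) (X k)" "\<And>k. AE w in M. F k w = c k + X k w"
    unfolding P_def by blast+
  note Xm = integral_ofD[OF X(1)]
  define d where "d = expectation G"
  define Y where "Y w = G w - d" for w
  have Ym: "Y \<in> borel_measurable M" "msq M Y < top"
    unfolding Y_def using G by (auto intro!: msq_diff_finite msq_const_finite finite_measure_axioms)
  have iG: "integrable M G" by (rule square_integrable_integrable[OF G])
  have cd: "ennreal ((c k - d)^2) \<le> msq M (\<lambda>w. F k w - G w)" for k
  proof -
    have iX: "integrable M (X k)" by (rule square_integrable_integrable[OF Xm(3,4)])
    have iF: "integrable M (F k)" by (rule square_integrable_integrable[OF Fm])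
    have "expectation (F k) = expectation (\<lambda>w. c k + X k w)"
      by (rule integral_cong_AE) (use X(2) Fm Xm in auto)
    also have "\<dots> = c k" using iX integral_mean[OF X(1), of k] by (simp add: prob_space)
    finally have "expectation (\<lambda>w. F k w - G w) = c k - d" using iF iG by (simp add: d_def)
    then show ?thesis
      using expectation_square_le[of "\<lambda>w. F k w - G w"] Fm G msq_diff_finite[OF Fm(1) G(1) Fm(2) G(2)] by simp
  qed
  have XY: "L2_lim M X Y"
  proof (rule ennreal_tendsto_0_le[OF ennreal_tendsto_0_lincomb[OF lim lim, of 2 2]])
    show "\<forall>\<^sub>F k in sequentially. msq M (\<lambda>w. X k w - Y w) \<le>
        2 * msq M (\<lambda>w. F k w - G w) + 2 * msq M (\<lambda>w. F k w - G w)"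
    proof (intro always_eventually allI)
      fix k
      have "msq M (\<lambda>w. X k w - Y w) = msq M (\<lambda>w. (F k w - G w) + (d - c k))"
        by (rule msq_cong_AE) (use X(2)[of k] in eventually_elim, simp add: Y_def)
      also have "\<dots> \<le> 2 * msq M (\<lambda>w. F k w - G w) + 2 * msq M (\<lambda>w. d - c k)"
        by (rule msq_add_le) (use Fm G in auto)
      also have "msq M (\<lambda>w. d - c k) = ennreal ((c k - d)^2)"
        by (simp add: msq_def emeasure_space_1 power2_commute)
      also have "2 * msq M (\<lambda>w. F k w - G w) + 2 * ennreal ((c k - d)^2) \<le>
          2 * msq M (\<lambda>w. F k w - G w) + 2 * msq M (\<lambda>w. F k w - G w)"
        by (intro add_left_mono mult_left_mono cd) simp
      finally show "msq M (\<lambda>w. X k w - Y w) \<le>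
        2 * msq M (\<lambda>w. F k w - G w) + 2 * msq M (\<lambda>w. F k w - G w)" .
    qed
  qed auto
  have "L2_Cauchy dtP (\<lambda>k. case_prod (u k))"
    using L2_lim_Cauchy[OF Xm(3) Ym(1) XY] L2_Cauchy_isometry[OF intensity integral_isometry[OF X(1) X(1)]] by simp
  then obtain g where g: "g \<in> borel_measurable dtP"
    "L2_lim dtP (\<lambda>k. case_prod (u k)) g"
    using msq_complete[where f="\<lambda>k. case_prod (u k)", OF Xm(1)] by blast
  have gf: "msq dtP g < top" by (rule msq_limit_finite[OF Xm(1,2) g])
  have gc: "case_prod (curry g) = g" by simp
  have "integral_of (curry g) Y"
  proof (rule integral_closed[OF X(1)])
    show "curry g \<in> \<H>" using g gf by (simp add: energy_space_iff gc)
    show "Y \<in> L2_space M" using Ym by (simp add: L2_space_iff)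
    show "L2_lim dtP (\<lambda>k. case_prod (u k)) (case_prod (curry g))"
      unfolding gc by (rule g(2))
  qed (rule XY)
  moreover have "AE w in M. G w = d + Y w" by (simp add: Y_def)
  ultimately show ?thesis unfolding representable_def using G(1) by blast
qed

text \<open>
  The grid exponential with every factor divided by its mean; a martingale along the grid.
\<close>

definition exp_martingale :: "nat \<Rightarrow> (nat \<Rightarrow> real) \<Rightarrow> nat \<Rightarrow> 'a \<Rightarrow> real" where
  "exp_martingale m b j w =
     (\<Prod>i<j. b i ^ (N (grid m (Suc i)) w - N (grid m i) w) * exp ((1 - b i) * (lam * (T / real m))))"

lemma exp_martingale_Suc:
  "exp_martingale m b (Suc j) w = exp_martingale m b j w *
     (b j ^ (N (grid m (Suc j)) w - N (grid m j) w) * exp ((1 - b j) * (lam * (T / real m))))"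
  by (simp add: exp_martingale_def)

lemma grid_increment_measurable:
  assumes "i < j" "j \<le> m"
  shows "(\<lambda>w. N (grid m (Suc i)) w - N (grid m i) w) \<in> measurable (\<F> (grid m j)) (count_space UNIV)"
proof -
  have "grid m i \<in> {0..T}" "grid m (Suc i) \<in> {0..T}" "grid m j \<in> {0..T}"
    using assms by (auto simp only: intro!: grid_range)
  then have [measurable]: "N (grid m i) \<in> measurable (\<F> (grid m j)) (count_space UNIV)"
    "N (grid m (Suc i)) \<in> measurable (\<F> (grid m j)) (count_space UNIV)"
    using assms by (auto intro!: N_measurable_augmented grid_mono)
  show ?thesis by measurable
qed

lemma exp_martingale_measurable:
  assumes "j \<le> m"
  shows "exp_martingale m b j \<in> borel_measurable (\<F> (grid m j))"
  unfolding exp_martingale_def[abs_def]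
proof (rule borel_measurable_prod)
  fix i assume "i \<in> {..<j}"
  then have [measurable]: "(\<lambda>w. N (grid m (Suc i)) w - N (grid m i) w) \<in> measurable (\<F> (grid m j)) (count_space UNIV)"
    using assms by (intro grid_increment_measurable) auto
  show "(\<lambda>w. b i ^ (N (grid m (Suc i)) w - N (grid m i) w) * exp ((1 - b i) * (lam * (T / real m))))
      \<in> borel_measurable (\<F> (grid m j))" by measurable
qed

lemma exp_martingale_bounded:
  assumes b: "\<And>i. 0 < b i \<and> b i \<le> 1" and j: "j \<le> m" "0 < m"
  shows "0 \<le> exp_martingale m b j w" "exp_martingale m b j w \<le> exp (lam * T)"
proof -
  define h where "h = lam * (T / real m)"
  have h: "0 \<le> h" using intensity horizon by (simp add: h_def)
  show "0 \<le> exp_martingale m b j w"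
    unfolding exp_martingale_def using b by (intro prod_nonneg) (simp add: less_imp_le)
  have "exp_martingale m b j w \<le> (\<Prod>i<j. exp h)"
    unfolding exp_martingale_def h_def[symmetric]
  proof (rule prod_mono, intro conjI)
    fix i
    have "b i ^ n * exp ((1 - b i) * h) \<le> 1 * exp h" for n
    proof (rule mult_mono)
      have "(1 - b i) * h \<le> 1 * h" using b[of i] h by (intro mult_right_mono) auto
      then show "exp ((1 - b i) * h) \<le> exp h" by simp
    qed (use b[of i] in \<open>auto simp: power_le_one\<close>)
    then show "b i ^ (N (grid m (Suc i)) w - N (grid m i) w) * exp ((1 - b i) * h) \<le> exp h" by simp
    show "0 \<le> b i ^ (N (grid m (Suc i)) w - N (grid m i) w) * exp ((1 - b i) * h)"
      using b[of i] by simp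
  qed
  also have "\<dots> = exp (real j * h)" by (simp add: exp_of_nat_mult)
  also have "\<dots> \<le> exp (real m * h)" using j h by (auto intro: mult_right_mono)
  also have "real m * h = lam * T" using j by (simp add: h_def)
  finally show "exp_martingale m b j w \<le> exp (lam * T)" .
qed

text \<open>
  Write \<open>Z\<close> for the martingale and \<open>h\<close> for the mean of an increment over
  one cell. Then \<open>Z\<^bsub>j+1\<^esub> - Z\<^sub>j\<close> is \<open>(b\<^sub>j - 1)
  Z\<^sub>j\<close> times the compensated increment, plus \<open>Z\<^sub>j R\<^sub>j\<close> with
  the remainder \<open>R\<^sub>j\<close> of \<open>exp_remainder\<close>. Summed over
  \<open>j\<close>, the first terms are a step integral. The second ones are orthogonal, because
  \<open>R\<^sub>j\<close> is centred and independent of the past, and each has mean square of order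
  \<open>h\<^sup>2\<close>.
\<close>

lemma exp_martingale_step_error:
  assumes b: "\<And>i. 0 < b i \<and> b i \<le> 1" and m: "0 < m" and T: "0 < T" and small: "lam * (T / real m) \<le> 1"
  defines "\<xi> \<equiv> \<lambda>j w. (b j - 1) * exp_martingale m b j w"
  shows "is_step m (grid m) \<xi>"
    and "msq M (\<lambda>w. (1 + step_int m (grid m) \<xi> w) - exp_martingale m b m w)
      \<le> ennreal (real m * ((exp (lam * T))^2 * (lam * (T / real m))^2))"
proof -
  define h where "h = lam * (T / real m)"
  have h: "0 < h" "h \<le> 1" using T m intensity small by (simp_all add: h_def)
  define D where "D j w = N (grid m (Suc j)) w - N (grid m j) w" for j w
  define Z where "Z = exp_martingale m b"
  define R where "R j w = exp_remainder (b j) h (D j w)" for j w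
  have Zb: "\<bar>Z j w\<bar> \<le> exp (lam * T)" if "j \<le> m" for j w
    using exp_martingale_bounded[OF b that m] by (simp add: Z_def)
  have Zm: "Z j \<in> borel_measurable (\<F> (grid m j))" if "j \<le> m" for j
    unfolding Z_def by (rule exp_martingale_measurable[OF that])
  have gap: "0 \<le> grid m j" "grid m j < grid m (Suc j)" "grid m (Suc j) \<le> T"
    "lam * (grid m (Suc j) - grid m j) = h" if "j < m" for j
  proof -
    have "grid m (Suc j) = grid m j + T / real m" by (simp add: grid_def add_divide_distrib algebra_simps)
    then show "grid m j < grid m (Suc j)" "lam * (grid m (Suc j) - grid m j) = h" using T m by (auto simp: h_def)
    show "0 \<le> grid m j" "grid m (Suc j) \<le> T" using grid_range[of j m] grid_range[of "Suc j" m] that by auto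
  qed
  show "is_step m (grid m) \<xi>"
    unfolding is_step_grid_iff
  proof (intro allI impI conjI)
    fix j assume j: "j < m"
    show "\<xi> j \<in> borel_measurable (\<F> (grid m j))"
      unfolding \<xi>_def using Zm[of j] j by (auto simp: Z_def)
    have "\<bar>\<xi> j w\<bar> \<le> \<bar>b j - 1\<bar> * exp (lam * T)" for w
      unfolding \<xi>_def abs_mult using Zb[of j] j by (intro mult_left_mono) (auto simp: Z_def)
    then show "\<exists>B. \<forall>w\<in>space M. \<bar>\<xi> j w\<bar> \<le> B" by blast
  qed
  have tele: "AE w in M. Z m w - 1 - step_int m (grid m) \<xi> w = (\<Sum>j<m. Z j w * R j w)"
  proof -
    have "AE w in M. \<forall>j\<in>{..<m}. increment (grid m j) (grid m (Suc j)) w = real (D j w) - h"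
    proof (rule AE_finite_allI)
      fix j assume "j \<in> {..<m}"
      then show "AE w in M. increment (grid m j) (grid m (Suc j)) w = real (D j w) - h"
        using increment_eq[of "grid m j" "grid m (Suc j)"] gap[of j] by (simp add: D_def)
    qed simp
    then show ?thesis
    proof eventually_elim
      case (elim w)
      have "Z m w - 1 = (\<Sum>j<m. Z (Suc j) w - Z j w)"
        using sum_lessThan_telescope[of "\<lambda>j. Z j w" m] by (simp add: Z_def exp_martingale_def)
      also have "\<dots> = (\<Sum>j<m. \<xi> j w * increment (grid m j) (grid m (Suc j)) w + Z j w * R j w)"
      proof (rule sum.cong[OF refl])
        fix j assume j: "j \<in> {..<m}"
        have "Z (Suc j) w = Z j w * (b j ^ D j w * exp ((1 - b j) * h))"
          by (simp add: Z_def exp_martingale_Suc D_def h_def)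
        moreover have "increment (grid m j) (grid m (Suc j)) w = real (D j w) - h" using elim j by blast
        ultimately show "Z (Suc j) w - Z j w = \<xi> j w * increment (grid m j) (grid m (Suc j)) w + Z j w * R j w"
          by (simp only: R_def exp_remainder_def \<xi>_def Z_def[symmetric]) (simp add: algebra_simps)
      qed
      finally show ?case unfolding step_int_eq by (simp add: sum.distrib)
    qed
  qed
  define K where "K = (exp (lam * T))^2 * h^2"
  define S where "S n w = (\<Sum>j<n. Z j w * R j w)" for n w
  have DM: "D j \<in> measurable (\<F> (grid m n)) (count_space UNIV)" if "j < n" "n \<le> m" for j n
    unfolding D_def using that by (rule grid_increment_measurable)
  \<comment> \<open>Orthogonality is used one cell at a time: \<open>S n\<close> and \<open>Z n\<close> are known
    at the left end point of cell \<open>n\<close>, so \<open>S n * Z n * R n\<close> has mean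
    zero.\<close>
  have "S n \<in> borel_measurable (\<F> (grid m n)) \<and> integrable M (\<lambda>w. (S n w)^2) \<and>
      (\<integral>w. (S n w)^2 \<partial>M) \<le> real n * K" if "n \<le> m" for n
    using that
  proof (induct n)
    case 0
    then show ?case by (simp add: S_def[abs_def])
  next
    case (Suc n)
    then have n: "n < m" and IH: "S n \<in> borel_measurable (\<F> (grid m n))"
      "integrable M (\<lambda>w. (S n w)^2)" "(\<integral>w. (S n w)^2 \<partial>M) \<le> real n * K" by auto
    note g = gap[OF n]
    have gle: "grid m n \<le> grid m (Suc n)" using g by simp
    have mZ: "Z n \<in> borel_measurable (\<F> (grid m n))" using Zm n by simp
    have bd: "0 < h" "0 \<le> b n" using h b[of n] by auto
    note pr = poisson_exp_remainder[OF bd]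
    define q where "q = exp (h * (1 - b n)^2) - 1 - h * (1 - b n)^2"
    have hR: "has_mean (R n) 0"
      unfolding R_def[abs_def] D_def
      by (rule increment_has_integral[OF g(1,2,3)]) (unfold g(4), rule pr(1))
    have hR2: "has_mean (\<lambda>w. (R n w)^2) q"
      unfolding R_def[abs_def] D_def q_def
      by (rule increment_has_integral[OF g(1,2,3)]) (unfold g(4), rule pr(2))
    have q: "0 \<le> q" "q \<le> h^2"
    proof -
      have b1: "(1 - b n)^2 \<le> 1" using b[of n] by (simp add: abs_square_le_1)
      have x: "0 \<le> h * (1 - b n)^2" "h * (1 - b n)^2 \<le> h"
        using h b1 mult_left_mono[OF b1, of h] by auto
      \<comment> \<open>\<open>e\<^sup>x \<le> 1 + x + x\<^sup>2\<close> for \<open>0 \<le> x \<le> 1\<close>;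
        this is where \<open>h \<le> 1\<close> enters.\<close>
      have "q \<le> (h * (1 - b n)^2)^2"
        using exp_bound[of "h * (1 - b n)^2"] x h by (simp add: q_def)
      also have "\<dots> \<le> h^2" using x by (intro power_mono)
      finally show "q \<le> h^2" .
      show "0 \<le> q" using exp_ge_add_one_self[of "h * (1 - b n)^2"] unfolding q_def by linarith
    qed
    have iSZ: "integrable M (\<lambda>w. Z n w * S n w)"
    proof (rule integrable_bounded_times[OF _ augmented_measurable[OF mZ]])
      show "integrable M (S n)"
        using augmented_measurable[OF IH(1)] IH(2) by (intro square_integrable_integrable) (auto simp: msq_finite_iff)
      show "\<forall>w\<in>space M. \<bar>Z n w\<bar> \<le> exp (lam * T)" using Zb n by simp
    qed
    have cross: "has_mean (\<lambda>w. (Z n w * S n w) * R n w) ((\<integral>w. Z n w * S n w \<partial>M) * 0)"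
      by (rule expectation_times_function_of_increment[OF g(1) gle g(3) _ iSZ hR])
        (use mZ IH(1) in \<open>auto simp: R_def D_def\<close>)
    have ZZ: "integrable M (\<lambda>w. (Z n w)^2)" "(\<integral>w. (Z n w)^2 \<partial>M) \<le> (exp (lam * T))^2"
    proof -
      have sq: "(Z n w)^2 \<le> (exp (lam * T))^2" for w using Zb[of n w] n by (simp add: abs_le_square_iff[symmetric])
      show i: "integrable M (\<lambda>w. (Z n w)^2)"
        by (rule integrable_bounded[where B="(exp (lam * T))^2"]) (use sq augmented_measurable[OF mZ] in auto)
      have "(\<integral>w. (Z n w)^2 \<partial>M) \<le> (\<integral>w. (exp (lam * T))^2 \<partial>M)" by (intro integral_mono i sq) simp
      then show "(\<integral>w. (Z n w)^2 \<partial>M) \<le> (exp (lam * T))^2" by (simp add: prob_space)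
    qed
    have diag: "has_mean (\<lambda>w. (Z n w)^2 * (R n w)^2) ((\<integral>w. (Z n w)^2 \<partial>M) * q)"
      by (rule expectation_times_function_of_increment[OF g(1) gle g(3) _ ZZ(1) hR2,
            of "\<lambda>k. (exp_remainder (b n) h k)^2"]) (use mZ in \<open>auto simp: R_def D_def\<close>)
    have "has_mean (\<lambda>w. (S n w)^2 + 2 * ((Z n w * S n w) * R n w) + (Z n w)^2 * (R n w)^2)
       ((\<integral>w. (S n w)^2 \<partial>M) + 2 * ((\<integral>w. Z n w * S n w \<partial>M) * 0) + (\<integral>w. (Z n w)^2 \<partial>M) * q)"
      by (intro has_bochner_integral_add has_bochner_integral_mult_right cross diag has_bochner_integral_integrable IH(2))
    moreover have "(S n w)^2 + 2 * ((Z n w * S n w) * R n w) + (Z n w)^2 * (R n w)^2 = (S (Suc n) w)^2" for w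
      by (simp add: S_def power2_eq_square algebra_simps)
    ultimately have hS: "has_mean (\<lambda>w. (S (Suc n) w)^2) ((\<integral>w. (S n w)^2 \<partial>M) + (\<integral>w. (Z n w)^2 \<partial>M) * q)"
      by simp
    have "(\<integral>w. (Z n w)^2 \<partial>M) * q \<le> K"
      unfolding K_def by (intro mult_mono ZZ q) auto
    then have le: "(\<integral>w. (S n w)^2 \<partial>M) + (\<integral>w. (Z n w)^2 \<partial>M) * q \<le> real (Suc n) * K"
      using IH(3) by (simp add: algebra_simps)
    have "S (Suc n) \<in> borel_measurable (\<F> (grid m (Suc n)))"
    proof -
      have [measurable]: "S n \<in> borel_measurable (\<F> (grid m (Suc n)))"
        "Z n \<in> borel_measurable (\<F> (grid m (Suc n)))"
        "D n \<in> measurable (\<F> (grid m (Suc n))) (count_space UNIV)"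
        using augmented_measurable_mono[OF IH(1) gle] augmented_measurable_mono[OF mZ gle] DM[of n "Suc n"] n by auto
      have "(\<lambda>w. S n w + Z n w * exp_remainder (b n) h (D n w)) \<in> borel_measurable (\<F> (grid m (Suc n)))"
        by measurable
      then show ?thesis by (simp add: S_def[abs_def] R_def)
    qed
    then show ?case using hS le by (simp add: has_bochner_integral_iff)
  qed
  from this[of m] have S: "integrable M (\<lambda>w. (S m w)^2)" "(\<integral>w. (S m w)^2 \<partial>M) \<le> real m * K" by auto
  have "msq M (\<lambda>w. (1 + step_int m (grid m) \<xi> w) - exp_martingale m b m w) =
      msq M (\<lambda>w. exp_martingale m b m w - (1 + step_int m (grid m) \<xi> w))" by (rule msq_minus_commute)
  also have "\<dots> = msq M (S m)"
    by (rule msq_cong_AE) (use tele in eventually_elim, simp add: S_def Z_def)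
  also have "\<dots> \<le> ennreal (real m * K)"
    unfolding msq_eq_integral[OF S(1)] by (rule ennreal_leI[OF S(2)])
  finally show "msq M (\<lambda>w. (1 + step_int m (grid m) \<xi> w) - exp_martingale m b m w)
      \<le> ennreal (real m * ((exp (lam * T))^2 * (lam * (T / real m))^2))" by (simp add: K_def h_def)
qed

text \<open>
  Refine the grid while keeping the exponential unchanged. On \<open>m\<close> cells the error of
  \<open>exp_martingale_step_error\<close> is \<open>m\<close> times a quantity of order \<open>1 /
  m\<^sup>2\<close>, so it tends to zero.
\<close>

lemma representable_grid_exponential:
  assumes n: "0 < n" and a: "\<And>i. 0 < a i \<and> a i \<le> 1"
  shows "representable (grid_exponential T n a)"
proof (cases "T = 0")
  case True
  then have "grid_exponential T n a = (\<lambda>_. 1)" by (simp add: grid_exponential_def fun_eq_iff)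
  then show ?thesis using representable_const by simp
next
  case False
  then have T: "0 < T" using horizon by simp
  let ?X = "grid_exponential T n a"
  have Xm: "?X \<in> borel_measurable M" by (rule measurable_grid_exponential) (use n horizon in auto)
  \<comment> \<open>Refining into at least \<open>k0\<close> parts makes the mean of an increment over one cell at
    most one.\<close>
  obtain k0 :: nat where k0: "lam * T \<le> real k0" using real_arch_simple by blast
  define m where "m k = n * Suc (k0 + k)" for k
  define b where "b k j = a (j div Suc (k0 + k))" for k j
  have b: "0 < b k j \<and> b k j \<le> 1" for k j using a by (simp add: b_def)
  have m: "0 < m k" "Suc (k0 + k) \<le> m k" for k using n mult_le_mono1[of 1 n "Suc (k0 + k)"] by (simp_all add: m_def)
  define \<xi> where "\<xi> k j w = (b k j - 1) * exp_martingale (m k) (b k) j w" for k j w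
  define C where "C k = (\<Prod>j<m k. exp ((1 - b k j) * (lam * (T / real (m k)))))" for k
  \<comment> \<open>So dividing by \<open>C k\<close>, which undoes the normalisation, does not increase the
    error.\<close>
  have C: "1 \<le> C k" for k
    unfolding C_def using b intensity T by (intro prod_ge_1) auto
  have ZX: "AE w in M. exp_martingale (m k) (b k) (m k) w = C k * ?X w" for k
    using grid_exponential_refine[of T n "Suc (k0 + k)" a] horizon n
    by (auto simp: exp_martingale_def C_def prod.distrib grid_exponential_def grid_def m_def b_def elim!: eventually_mono)
  have small: "lam * (T / real (m k)) \<le> 1" for k
  proof -
    have "lam * T \<le> real (m k)" using k0 m(2)[of k] by linarith
    then show ?thesis using m(1)[of k] by (simp add: field_simps)
  qed
  define F where "F k w = (1 / C k) * (1 + step_int (m k) (grid (m k)) (\<xi> k) w)" for k w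
  have \<xi>_eq: "\<xi> k = (\<lambda>j w. (b k j - 1) * exp_martingale (m k) (b k) j w)" for k
    by (simp add: \<xi>_def fun_eq_iff)
  have step: "is_step (m k) (grid (m k)) (\<xi> k)" for k
    unfolding \<xi>_eq by (rule exp_martingale_step_error(1)[OF b m(1) T small])
  have err: "msq M (\<lambda>w. F k w - ?X w) \<le> ennreal ((exp (lam * T))^2 * (lam * T)^2 * (1 / real (Suc k)))" for k
  proof -
    let ?E = "\<lambda>w. (1 + step_int (m k) (grid (m k)) (\<xi> k) w) - exp_martingale (m k) (b k) (m k) w"
    have C0: "C k \<noteq> 0" using C[of k] by linarith
    have "msq M (\<lambda>w. F k w - ?X w) = msq M (\<lambda>w. (1 / C k) * ?E w)"
      by (rule msq_cong_AE) (use ZX[of k] in eventually_elim, use C0 in \<open>simp add: F_def right_diff_distrib\<close>)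
    also have "\<dots> \<le> msq M ?E"
    proof (rule msq_mono, intro AE_I2)
      fix w
      have "\<bar>1 / C k\<bar> * \<bar>?E w\<bar> \<le> 1 * \<bar>?E w\<bar>" using C[of k] by (intro mult_right_mono) auto
      then show "\<bar>1 / C k * ?E w\<bar> \<le> \<bar>?E w\<bar>" by (simp only: abs_mult mult_1)
    qed
    also have "\<dots> \<le> ennreal (real (m k) * ((exp (lam * T))^2 * (lam * (T / real (m k)))^2))"
      unfolding \<xi>_eq by (rule exp_martingale_step_error(2)[OF b m(1) T small])
    also have "real (m k) * ((exp (lam * T))^2 * (lam * (T / real (m k)))^2) =
        (exp (lam * T))^2 * (lam * T)^2 * (1 / real (m k))"
      using m(1)[of k] by (simp add: power2_eq_square field_simps)
    also have "ennreal \<dots> \<le> ennreal ((exp (lam * T))^2 * (lam * T)^2 * (1 / real (Suc k)))"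
      using m(2)[of k] by (intro ennreal_leI mult_left_mono divide_left_mono) (auto simp del: of_nat_Suc)
    finally show ?thesis .
  qed
  show ?thesis
  proof (rule representable_limit)
    show "representable (F k)" for k
    proof -
      have "simple_integrand (step_fun (m k) (grid (m k)) (\<xi> k))
          (step_int (m k) (grid (m k)) (\<xi> k))"
        unfolding simple_integrand_def using step by blast
      then have "representable (step_int (m k) (grid (m k)) (\<xi> k))"
        unfolding representable_def using simple_measurable(2) simple_integral_of by fastforce
      from representable_lincomb[OF representable_const[of 1] this, of "1 / C k" "1 / C k"]
      show ?thesis unfolding F_def[abs_def] distrib_left .
    qed
    show "msq M ?X < top"
    proof -
      have "msq M ?X \<le> msq M (\<lambda>_. 1)"
        by (rule msq_mono) (use grid_exponential_bounded[OF a, of T n] in auto)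
      also have "\<dots> < top" by (rule msq_const_finite[OF finite_measure_axioms])
      finally show ?thesis .
    qed
    show "L2_lim M F ?X"
    proof (rule ennreal_tendsto_0_le[OF _ always_eventually])
      have "(\<lambda>k. ennreal ((exp (lam * T))^2 * (lam * T)^2 * (1 / real (Suc k)))) \<longlonglongrightarrow> ennreal ((exp (lam * T))^2 * (lam * T)^2 * 0)"
        by (intro tendsto_ennrealI tendsto_mult_left LIMSEQ_Suc[OF lim_1_over_n])
      then show "(\<lambda>k. ennreal ((exp (lam * T))^2 * (lam * T)^2 * (1 / real (Suc k)))) \<longlonglongrightarrow> 0"
        by (simp only: mult_zero_right ennreal_0)
    qed (use err in blast)
  qed (rule Xm)
qed

lemma representable_bounded_closure:
  assumes "X \<in> exp_closure T"
  shows "representable X"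
  using assms
proof (induct rule: bounded_closure.induct)
  case (base X)
  then show ?case by (auto simp: grid_exponentials_def intro: representable_grid_exponential)
next
  case (lincomb X Y a b)
  then show ?case by (intro representable_lincomb)
next
  case (limit X B Y)
  have fin: "msq M (\<lambda>_. B) < top" by (rule msq_const_finite[OF finite_measure_axioms])
  note Xm = representable_msq[OF limit(2)]
  have lim: "L2_lim M X Y"
    by (rule msq_dominated[OF Xm(1) limit(4) _ fin limit(3) limit(5)]) simp
  have "msq M Y < top" by (rule msq_limit_finite[OF Xm limit(4) lim])
  then show ?case by (rule representable_limit[OF limit(2) limit(4) _ lim])
qed

text \<open>
  Exponentials are representable, and representability is linear and closed under mean square
  limits. So it extends to the bounded closure, which contains the indicators of all events of the
  completed past at \<open>T\<close>, and from there to all square integrable functions.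
\<close>

theorem martingale_representation:
  assumes F: "F \<in> borel_measurable (\<F> T)" "msq M F < top"
  shows "representable F"
proof -
  let ?M = "restr_to_subalg M (\<F> T)"
  have sub: "subalgebra M (\<F> T)" by (rule subalgebra_augmented)
  have meas: "borel_measurable ?M = (borel_measurable (\<F> T) :: ('a \<Rightarrow> real) set)"
    by (rule measurable_cong_sets[OF sets_restr_to_subalg[OF sub] refl])
  have msq: "msq ?M f = msq M f" if "f \<in> borel_measurable ?M" for f
    unfolding msq_def by (rule nn_integral_subalgebra2[OF sub]) (use that[unfolded meas] in measurable)
  show ?thesis
  proof (rule L2_induct[of F ?M representable])
    show "F \<in> borel_measurable ?M" using F meas by simp
    then show "msq ?M F < top" using F msq by simp
    show "representable (indicator A)" if "A \<in> sets ?M" for A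
      using that horizon sets_restr_to_subalg[OF sub] sets_augmented_T
      by (intro representable_bounded_closure indicator_in_closure) auto
    show "representable (\<lambda>x. a * f x + b * g x)" if "representable f" "representable g" for f g a b
      using that by (rule representable_lincomb)
    fix G g assume *: "\<And>i. representable (G i)" "\<And>i. G i \<in> borel_measurable ?M" "g \<in> borel_measurable ?M"
       "msq ?M g < top" "L2_lim ?M G g"
    show "representable g"
    proof (rule representable_limit[OF *(1)])
      show "g \<in> borel_measurable M" using *(3) meas augmented_measurable by simp
      show "msq M g < top" using *(3,4) msq by simp
      show "L2_lim M G g"
        using *(5) by (subst (asm) msq) (use *(2,3) in auto)
    qed
  qed
qed

section \<open>The operator--covariant derivative\<close>

lemma stochastic_integral_of:
  assumes "u \<in> \<H>"
  shows "integral_of u (stochastic_integral M T lam N u)"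
  unfolding stochastic_integral_def using integral_exists[OF assms] by (metis someI)

text \<open>
  Let \<open>F = c + X\<close> with \<open>X\<close> the integral of \<open>u\<close>. Integrals
  have mean zero, so \<open>c = E F\<close> and \<open>E (F \<delta>(v)) = E (X \<delta>(v)) =
  \<langle>u, v\<rangle>\<close>: thus \<open>u\<close> is a derivative of \<open>F\<close>. The
  chosen derivative \<open>g\<close> has the same inner products with all \<open>v\<close>. Taking
  \<open>v = u\<close> and \<open>v = g\<close> shows that \<open>X - \<delta>(g)\<close> is
  orthogonal to \<open>X\<close> and to \<open>\<delta>(g)\<close>, hence zero.
\<close>

theorem clark_formula:
  assumes F: "F \<in> borel_measurable (\<F> T)" "F \<in> L2_space M"
  shows "AE w in M. F w = expectation F + stochastic_integral M T lam N (covariant_derivative M T lam N F) w"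
proof -
  let ?\<delta> = "stochastic_integral M T lam N"
  have F2: "msq M F < top" "F \<in> borel_measurable M" using F(2) by (auto simp: L2_space_iff)
  obtain c u X where X: "integral_of u X" "AE w in M. F w = c + X w"
    using martingale_representation[OF F(1) F2(1)] by (auto simp: representable_def)
  note Xm = integral_ofD(3,4)[OF X(1)]
  have iX: "integrable M X" by (rule square_integrable_integrable[OF Xm])
  have "expectation F = expectation (\<lambda>w. c + X w)"
    by (rule integral_cong_AE) (use X(2) F2 Xm in auto)
  then have c: "expectation F = c" using iX integral_mean[OF X(1)] by (simp add: prob_space)
  have u: "u \<in> \<H>" using X(1) by (simp add: has_stochastic_integral_def)
  have XY: "integrable M (\<lambda>w. Y w * Z w)" if "integral_of v Y" "integral_of w Z" for v w Y Z
    using integral_ofD[OF that(1)] integral_ofD[OF that(2)] by (intro integrable_mult_square) (auto simp: msq_finite_iff)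
  have FY: "expectation (\<lambda>w. F w * Y w) = expectation (\<lambda>w. X w * Y w)" if Y: "integral_of v Y" for v Y
  proof -
    note Ym = integral_ofD(3,4)[OF Y]
    have "expectation (\<lambda>w. F w * Y w) = expectation (\<lambda>w. c * Y w + X w * Y w)"
      by (rule integral_cong_AE) (use X(2) F2 Xm Ym in \<open>auto simp: distrib_right\<close>)
    also have "\<dots> = c * expectation Y + expectation (\<lambda>w. X w * Y w)"
      using square_integrable_integrable[OF Ym] XY[OF X(1) Y] by simp
    finally show ?thesis using integral_mean[OF Y] by simp
  qed
  have "has_covariant_derivative M T lam N F u"
    unfolding has_covariant_derivative_def
    using u FY[OF stochastic_integral_of] integral_inner[OF X(1) stochastic_integral_of] by auto
  then have g: "has_covariant_derivative M T lam N F (covariant_derivative M T lam N F)"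
    unfolding covariant_derivative_def by (rule someI[of "has_covariant_derivative M T lam N F"])
  define g where "g = covariant_derivative M T lam N F"
  have gE: "g \<in> \<H>"
    and gd: "\<And>v. v \<in> \<H> \<Longrightarrow> expectation (\<lambda>w. F w * ?\<delta> v w) = energy_inner M T lam g v"
    using g by (auto simp: has_covariant_derivative_def g_def)
  note Ig = stochastic_integral_of[OF gE]
  have inner: "energy_inner M T lam u v = energy_inner M T lam g v" if v: "v \<in> \<H>" for v
    using gd[OF v] FY[OF stochastic_integral_of[OF v]] integral_inner[OF X(1) stochastic_integral_of[OF v]] by simp
  have e: "expectation (\<lambda>w. X w * X w) = expectation (\<lambda>w. ?\<delta> g w * X w)"
    "expectation (\<lambda>w. X w * ?\<delta> g w) = expectation (\<lambda>w. ?\<delta> g w * ?\<delta> g w)"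
    unfolding integral_inner[OF X(1) X(1)] integral_inner[OF Ig X(1)] integral_inner[OF X(1) Ig] integral_inner[OF Ig Ig]
    using inner[OF u] inner[OF gE] by simp_all
  have id: "(\<lambda>w. (X w - ?\<delta> g w)^2) = (\<lambda>w. (X w * X w - ?\<delta> g w * X w) - (X w * ?\<delta> g w - ?\<delta> g w * ?\<delta> g w))"
    by (auto simp: fun_eq_iff power2_eq_square algebra_simps)
  note i = XY[OF X(1) X(1)] XY[OF Ig X(1)] XY[OF X(1) Ig] XY[OF Ig Ig]
  have "expectation (\<lambda>w. (X w - ?\<delta> g w)^2) =
      (expectation (\<lambda>w. X w * X w) - expectation (\<lambda>w. ?\<delta> g w * X w)) -
      (expectation (\<lambda>w. X w * ?\<delta> g w) - expectation (\<lambda>w. ?\<delta> g w * ?\<delta> g w))"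
    unfolding id using i by (simp add: mult.commute)
  also have "\<dots> = 0" unfolding e by simp
  finally have "expectation (\<lambda>w. (X w - ?\<delta> g w)^2) = 0" .
  moreover have "integrable M (\<lambda>w. (X w - ?\<delta> g w)^2)"
    unfolding id by (intro Bochner_Integration.integrable_diff i)
  ultimately have "msq M (\<lambda>w. X w - ?\<delta> g w) = 0" by (simp add: msq_eq_integral)
  then have "AE w in M. X w - ?\<delta> g w = 0"
    using Xm integral_ofD(3)[OF Ig] by (intro msq_eq_0) auto
  then show ?thesis
    using X(2) unfolding c g_def[symmetric] by eventually_elim simp
qed

end

theorem corollary4p6:
  fixes M :: "'a measure" and T lam :: real and N :: "real \<Rightarrow> 'a \<Rightarrow> nat" and F :: "'a \<Rightarrow> real"
  assumes "complete_measure M"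
    and "poisson_process M T lam N"
    and "F \<in> L2_space M"
    and "F \<in> borel_measurable (natural_filtration M T N T)"
  shows "AE \<omega> in M. F \<omega> = (\<integral>\<omega>'. F \<omega>' \<partial>M)
           + stochastic_integral M T lam N (covariant_derivative M T lam N F) \<omega>"
  using poisson_process.clark_formula[OF assms(2,4,3)] .

end
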